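(* Let $F$ be a field, $A$ a finite subset of $\mathbb N$, and let $P=(P_1,\ldots,P_l),Q=(Q_1,\ldots,Q_k)\in\Pi_A^<$ be such that $Q\preceq P$. Then the elements $$e_{Q(1)^\circ}\vee\cdots\vee e_{Q(l)^\circ}$$ with $Q(i)\in\Pi_{P_i}^\dagger$ for all $i\in\{1,\ldots,l\}$ and $Q(1)\vee\cdots\vee Q(l)\approx Q$, form a linear basis of $e_P\wedge F\Pi_A\wedge e_Q$. In particular, $$C_{P,Q}=(m_1-1)!\cdots(m_l-1)!,$$ where $m_j=\#\{i\in\{1,\ldots,k\}\mid Q_i\subseteq P_j\}$ for all $j\in\{1,\ldots,l\}$.
   Context: For a finite subset $A$ of $\mathbb N=\{1,2,\ldots\}$, a set composition of $A$ is a tuple $P=(P_1,\ldots,P_l)$ of mutually disjoint non-empty subsets of $A$ with union $A$; its length is $\ell(P)=l$; $\Pi_A$ is the set of all set compositions of $A$ ($\Pi_\emptyset$ consists of the empty tuple). $\Pi=\bigcup_A\Pi_A$; $F\Pi_A$ is the $F$-vector space with basis $\Pi_A$ and $F\Pi=\bigoplus_AF\Pi_A$, over all finite $A\subset\mathbb N$. Bilinear products on $F\Pi$: for $P=(P_1,\ldots,P_l)\in\Pi_A$, $Q=(Q_1,\ldots,Q_k)\in\Pi_B$, $P\wedge Q=(P_1\cap Q_1,\ldots,P_1\cap Q_k,\ldots,P_l\cap Q_1,\ldots,P_l\cap Q_k)$ with empty sets deleted if $A=B$, and $0$ if $A\neq B$; $P\vee Q=(P_1,\ldots,P_l,Q_1,\ldots,Q_k)$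 if $A\cap B=\emptyset$, and $0$ otherwise. $F\Pi_A$ is regarded as an associative algebra with identity under $\wedge$. For non-empty finite $B$: $e_B=\sum_P(-1)^{\ell(P)-1}P$, the sum over all $P=(P_1,\ldots,P_l)\in\Pi_B$ with $\min B\in P_1$. For $Q=(Q_1,\ldots,Q_k)\in\Pi$, $e_Q=e_{Q_1}\vee\cdots\vee e_{Q_k}$ (the empty tuple if $k=0$); $Q\mapsto e_Q$ is extended linearly to $F\Pi$. Right-normed Dynkin mapping: with $f\circ g=f\vee g-g\vee f$, the linear map $f\mapsto f^\circ$ is given by $(B)^\circ=(B)$ and $(Q_1,\ldots,Q_k)^\circ=(Q_1)\circ\big((Q_2,\ldots,Q_k)^\circ\big)$ for $k>1$. For non-empty $B$, $\Pi_B^\dagger=\{(Q_1,\ldots,Q_k)\in\Pi_B\mid\min B\in Q_k\}$. $\Pi_A^<=\{(Q_1,\ldots,Q_k)\in\Pi_A\mid\min Q_1<\cdots<\min Q_k\}$. $Q\preceq P$ means that each component of $Q$ is contained in a component of $P$; $Q\approx P$ means that $Q$ is a rearrangement of the components of $P$. For $Q\in\Pi_A^<$: $\Lambda_Q=F\Pi_A\wedge e_Q$ (an indecomposable left ideal), $\mathrm{rad}_{F\Pi_A}\Lambda_Q$ is the intersection of its maximal submodules, and $M_Q=\Lambda_Q/\mathrm{rad}_{F\Pi_A}\Lambda_Q$, which is a one-dimensional irreducible left $F\Pi_A$-module; the $M_Q$, $Q\in\Pi_A^<$, are a complete set of irreducible modules up to isomorphism. For $P,Q\in\Pi_A^<$,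 the Cartan invariant $C_{P,Q}$ is the multiplicity of $M_P$ in a composition series of $\Lambda_Q$. *)

theory Defs
  imports Complex_Main "HOL-Library.Multiset" "HOL-Library.Poly_Mapping" "HOL-Algebra.Module"
    "HOL-Algebra.AbelCoset"
begin

section \<open>Set compositions\<close>

type_synonym scomp = "nat set list"

definition set_comps :: "nat set \<Rightarrow> scomp set" where
  "set_comps A = {P. sorted_wrt disjnt P \<and> {} \<notin> set P \<and> \<Union>(set P) = A}"

definition set_comps_less :: "nat set \<Rightarrow> scomp set" where
  "set_comps_less A = {P \<in> set_comps A. sorted_wrt (\<lambda>X Y. Min X < Min Y) P}"

text \<open>The set written with a dagger; only meaningful for non-empty \<open>B\<close>.\<close>
definition set_comps_dag :: "nat set \<Rightarrow> scomp set" where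
  "set_comps_dag B = {P \<in> set_comps B. Min B \<in> last P}"

definition refines :: "scomp \<Rightarrow> scomp \<Rightarrow> bool"  (infix \<open>\<preceq>\<close> 50) where
  "Q \<preceq> P \<longleftrightarrow> (\<forall>X\<in>set Q. \<exists>Y\<in>set P. X \<subseteq> Y)"

definition rearrangement :: "scomp \<Rightarrow> scomp \<Rightarrow> bool"  (infix \<open>\<approx>\<close> 50) where
  "Q \<approx> P \<longleftrightarrow> mset Q = mset P"


section \<open>Formal linear combinations\<close>

text \<open>
  Formal linear combinations of set compositions are finitely supported functions on
  lists of sets; \<open>FPi_on A\<close> is the span of the set compositions of \<open>A\<close> among them.
\<close>

type_synonym 'f fpi = "scomp \<Rightarrow>\<^sub>0 'f"

definition FPi_on :: "nat set \<Rightarrow> 'f::field fpi set" where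
  "FPi_on A = {f. Poly_Mapping.keys f \<subseteq> set_comps A}"

abbreviation basis_elt :: "scomp \<Rightarrow> 'f::field fpi" where
  "basis_elt P \<equiv> Poly_Mapping.single P 1"

definition scal :: "'f::field \<Rightarrow> ('b \<Rightarrow>\<^sub>0 'f) \<Rightarrow> ('b \<Rightarrow>\<^sub>0 'f)" where
  "scal c f = Poly_Mapping.map ((*) c) f"

lemma lookup_scal [simp]: "Poly_Mapping.lookup (scal c f) x = c * Poly_Mapping.lookup f x"
  by (simp add: scal_def Poly_Mapping.map.rep_eq when_def)

global_interpretation fpi: vector_space "scal :: 'f::field \<Rightarrow> ('b \<Rightarrow>\<^sub>0 'f) \<Rightarrow> ('b \<Rightarrow>\<^sub>0 'f)"
  by standard (auto intro!: poly_mapping_eqI simp: lookup_add algebra_simps)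

definition lin_ext :: "('b \<Rightarrow> ('c \<Rightarrow>\<^sub>0 'f)) \<Rightarrow> ('b \<Rightarrow>\<^sub>0 'f::field) \<Rightarrow> ('c \<Rightarrow>\<^sub>0 'f)" where
  "lin_ext b f = (\<Sum>x\<in>Poly_Mapping.keys f. scal (Poly_Mapping.lookup f x) (b x))"

definition bilin_ext ::
    "('b \<Rightarrow> 'c \<Rightarrow> ('d \<Rightarrow>\<^sub>0 'f)) \<Rightarrow> ('b \<Rightarrow>\<^sub>0 'f::field) \<Rightarrow> ('c \<Rightarrow>\<^sub>0 'f) \<Rightarrow> ('d \<Rightarrow>\<^sub>0 'f)" where
  "bilin_ext b f g = lin_ext (\<lambda>x. lin_ext (b x) g) f"


section \<open>The two products\<close>

definition wedge_comp :: "scomp \<Rightarrow> scomp \<Rightarrow> 'f::field fpi" where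
  "wedge_comp P Q =
     (if \<Union>(set P) = \<Union>(set Q)
      then basis_elt (filter (\<lambda>X. X \<noteq> {}) (concat (map (\<lambda>X. map (\<lambda>Y. X \<inter> Y) Q) P)))
      else 0)"

definition vee_comp :: "scomp \<Rightarrow> scomp \<Rightarrow> 'f::field fpi" where
  "vee_comp P Q = (if \<Union>(set P) \<inter> \<Union>(set Q) = {} then basis_elt (P @ Q) else 0)"

definition wedge :: "'f::field fpi \<Rightarrow> 'f fpi \<Rightarrow> 'f fpi"  (infixl \<open>\<^bold>\<and>\<close> 70) where
  "f \<^bold>\<and> g = bilin_ext wedge_comp f g"

definition vee :: "'f::field fpi \<Rightarrow> 'f fpi \<Rightarrow> 'f fpi"  (infixl \<open>\<^bold>\<or>\<close> 70) where
  "f \<^bold>\<or> g = bilin_ext vee_comp f g"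

definition vee_list :: "'f::field fpi list \<Rightarrow> 'f fpi" where
  "vee_list fs = foldr (\<^bold>\<or>) fs (basis_elt [])"


section \<open>The elements \<open>e_Q\<close> and the Dynkin mapping\<close>

definition e_set :: "nat set \<Rightarrow> 'f::field fpi" where
  "e_set B = (\<Sum>P | P \<in> set_comps B \<and> Min B \<in> hd P. scal ((- 1) ^ (length P - 1)) (basis_elt P))"

definition e_comp :: "scomp \<Rightarrow> 'f::field fpi" where
  "e_comp Q = vee_list (map e_set Q)"

definition e_lin :: "'f::field fpi \<Rightarrow> 'f fpi" where
  "e_lin f = lin_ext e_comp f"

definition circ :: "'f::field fpi \<Rightarrow> 'f fpi \<Rightarrow> 'f fpi" where
  "circ f g = f \<^bold>\<or> g - g \<^bold>\<or> f"

text \<open>The value at the empty tuple is a convention; it is never used on set compositions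
  of non-empty sets.\<close>
fun dynkin_comp :: "scomp \<Rightarrow> 'f::field fpi" where
  "dynkin_comp [] = basis_elt []"
| "dynkin_comp [B] = basis_elt [B]"
| "dynkin_comp (B # C # Q) = circ (basis_elt [B]) (dynkin_comp (C # Q))"

definition dynkin :: "'f::field fpi \<Rightarrow> 'f fpi" where
  "dynkin f = lin_ext dynkin_comp f"


section \<open>Left modules and composition multiplicities\<close>

text \<open>
  Left modules over a not necessarily commutative ring \<open>R\<close> are described by the
  \<^type>\<open>module\<close> record of HOL-Algebra (whose fields \<open>mult\<close> and \<open>one\<close> play no role) together
  with the predicate \<^const>\<open>submodule\<close>, which does not need \<open>R\<close> to be commutative.
\<close>

definition maximal_submodule ::
    "('a, 'r) ring_scheme \<Rightarrow> ('a, 'b, 'm) module_scheme \<Rightarrow> 'b set \<Rightarrow> bool" where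
  "maximal_submodule R M N \<longleftrightarrow>
     submodule N R M \<and> N \<noteq> carrier M \<and>
     (\<forall>K. submodule K R M \<longrightarrow> N \<subseteq> K \<longrightarrow> K = N \<or> K = carrier M)"

definition module_rad :: "('a, 'r) ring_scheme \<Rightarrow> ('a, 'b, 'm) module_scheme \<Rightarrow> 'b set" where
  "module_rad R M = carrier M \<inter> \<Inter>{N. maximal_submodule R M N}"

definition restr_module :: "('a, 'b) module \<Rightarrow> 'b set \<Rightarrow> ('a, 'b) module" where
  "restr_module M N = M\<lparr>carrier := N\<rparr>"

definition quot_module :: "('a, 'b) module \<Rightarrow> 'b set \<Rightarrow> ('a, 'b set) module" where
  "quot_module M N =
     \<lparr>carrier = a_rcosets\<^bsub>M\<^esub> N, mult = undefined, one = undefined,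
      zero = N, add = set_add M,
      smult = (\<lambda>r X. \<Union>x\<in>X. N +>\<^bsub>M\<^esub> (r \<odot>\<^bsub>M\<^esub> x))\<rparr>"

definition module_iso ::
    "('a, 'r) ring_scheme \<Rightarrow> ('a, 'b, 'm) module_scheme \<Rightarrow> ('a, 'c, 'n) module_scheme \<Rightarrow> bool" where
  "module_iso R M N \<longleftrightarrow>
     (\<exists>h \<in> iso (add_monoid M) (add_monoid N).
        \<forall>r\<in>carrier R. \<forall>x\<in>carrier M. h (r \<odot>\<^bsub>M\<^esub> x) = r \<odot>\<^bsub>N\<^esub> h x)"

definition irreducible_module ::
    "('a, 'r) ring_scheme \<Rightarrow> ('a, 'b, 'm) module_scheme \<Rightarrow> bool" where
  "irreducible_module R M \<longleftrightarrow>
     carrier M \<noteq> {\<zero>\<^bsub>M\<^esub>} \<and>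
     (\<forall>N. submodule N R M \<longrightarrow> N = {\<zero>\<^bsub>M\<^esub>} \<or> N = carrier M)"

definition factor_module :: "('a, 'b) module \<Rightarrow> 'b set list \<Rightarrow> nat \<Rightarrow> ('a, 'b set) module" where
  "factor_module M Ns i = quot_module (restr_module M (Ns ! Suc i)) (Ns ! i)"

definition composition_series ::
    "('a, 'r) ring_scheme \<Rightarrow> ('a, 'b) module \<Rightarrow> 'b set list \<Rightarrow> bool" where
  "composition_series R M Ns \<longleftrightarrow>
     Ns \<noteq> [] \<and> hd Ns = {\<zero>\<^bsub>M\<^esub>} \<and> last Ns = carrier M \<and>
     (\<forall>N\<in>set Ns. submodule N R M) \<and>
     (\<forall>i. Suc i < length Ns \<longrightarrow>
        Ns ! i \<subseteq> Ns ! Suc i \<and> irreducible_module R (factor_module M Ns i))"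

definition series_multiplicity ::
    "('a, 'r) ring_scheme \<Rightarrow> ('a, 'b) module \<Rightarrow> 'b set list \<Rightarrow> ('a, 'c) module \<Rightarrow> nat" where
  "series_multiplicity R M Ns S =
     card {i. Suc i < length Ns \<and> module_iso R (factor_module M Ns i) S}"


section \<open>The algebra, its indecomposable left ideals and the Cartan invariants\<close>

definition FPi_ring :: "nat set \<Rightarrow> 'f::field fpi ring" where
  "FPi_ring A =
     \<lparr>carrier = FPi_on A, mult = wedge,
      one = basis_elt (if A = {} then [] else [A]),
      zero = 0, add = (+)\<rparr>"

definition Lambda :: "nat set \<Rightarrow> scomp \<Rightarrow> ('f::field fpi, 'f fpi) module" where
  "Lambda A Q =
     \<lparr>carrier = (\<lambda>f. f \<^bold>\<and> e_comp Q) ` FPi_on A, mult = undefined, one = undefined,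
      zero = 0, add = (+), smult = wedge\<rparr>"

definition irr_M :: "nat set \<Rightarrow> scomp \<Rightarrow> ('f::field fpi, 'f fpi set) module" where
  "irr_M A Q = quot_module (Lambda A Q) (module_rad (FPi_ring A) (Lambda A Q))"

text \<open>
  \<open>c\<close> is the multiplicity of \<open>M_P\<close> in a composition series of \<open>\<Lambda>_Q\<close>: such a series exists and
  \<open>c\<close> is the multiplicity for each of them. The type argument carries the ground field.
\<close>
definition is_cartan_invariant ::
    "'f::field itself \<Rightarrow> nat set \<Rightarrow> scomp \<Rightarrow> scomp \<Rightarrow> nat \<Rightarrow> bool" where
  "is_cartan_invariant F A P Q c \<longleftrightarrow>
     (\<exists>Ns. composition_series (FPi_ring A) (Lambda A Q :: ('f fpi, 'f fpi) module) Ns) \<and>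
     (\<forall>Ns. composition_series (FPi_ring A) (Lambda A Q :: ('f fpi, 'f fpi) module) Ns \<longrightarrow>
        series_multiplicity (FPi_ring A) (Lambda A Q) Ns (irr_M A P) = c)"


section \<open>The basis\<close>

text \<open>
  The index set consists of the tuples \<open>(Q(1), \<dots>, Q(l))\<close>, and the join of the \<open>Q(i)\<close> is the
  concatenation because the components of \<open>P\<close> are disjoint.
\<close>
definition dag_tuples :: "scomp \<Rightarrow> scomp \<Rightarrow> scomp list set" where
  "dag_tuples P Q =
     {Qs. length Qs = length P \<and> (\<forall>i<length P. Qs ! i \<in> set_comps_dag (P ! i)) \<and>
          concat Qs \<approx> Q}"

definition dag_elt :: "scomp list \<Rightarrow> 'f::field fpi" where
  "dag_elt Qs = vee_list (map (\<lambda>R. e_lin (dynkin (basis_elt R))) Qs)"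

end

theory Submission
  imports Defs
begin

text \<open>
  A product \<open>P \<and> Q\<close> always refines \<open>P\<close>, and it equals \<open>P\<close> if \<open>P\<close> refines \<open>Q\<close>; in other words,
  \<open>F\<Pi>\<^sub>A\<close> is the algebra of a left regular band. The proof describes its action on \<open>\<Lambda>\<^sub>Q\<close> explicitly.

  \<^bold>\<open>The action on \<open>\<Lambda>\<^sub>Q\<close>.\<close> The sum \<open>e\<^sub>B\<close> is alternating, and splitting or merging a single block is a
  sign-reversing involution on its terms (\<open>sum_rooted_cancel\<close>). Applied to a block \<open>B\<close> of \<open>Q\<close> that meets
  two blocks of \<open>P\<close>, it shows \<open>P \<and> e\<^sub>Q = 0\<close> unless \<open>Q \<preceq> P\<close>; if \<open>Q \<preceq> P\<close>, every block of \<open>Q\<close> is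
  moved as a whole and \<open>P \<and> e\<^sub>Q = e\<^bsub>P \<and> Q\<^esub>\<close> (\<open>wedge_e_comp_not_refines\<close>, \<open>wedge_e_comp_refines\<close>). Thus
  \<open>\<Lambda>\<^sub>Q\<close> is spanned by the \<open>e\<^sub>R\<close> with \<open>R \<approx> Q\<close>.

  \<^bold>\<open>The basis.\<close> Let \<open>R \<in> \<Pi>\<^sub>B\<close>. If \<open>min B\<close> is not in the last block of \<open>R\<close>, the same involution, for
  that last block, gives \<open>e\<^sub>B \<and> e\<^sub>R = 0\<close> (\<open>e_set_wedge_not_dag\<close>). If it is, then \<open>R\<close> is the only term
  of the bracket \<open>R\<^sup>\<circ>\<close> that ends in this block, so \<open>e\<^sub>B \<and> e\<^sub>R = e\<^sub>B \<and> e\<^bsub>R\<^sup>\<circ>\<^esub>\<close>. A bracket is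
  annihilated by every \<open>T\<close> with at least two blocks (\<open>wedge_e_lin_dynkin_comp\<close>), so only the term \<open>(B)\<close>
  of \<open>e\<^sub>B\<close> acts on it and \<open>e\<^sub>B \<and> e\<^sub>R = e\<^bsub>R\<^sup>\<circ>\<^esub>\<close> (\<open>e_set_wedge_dag\<close>). Since \<open>e\<^sub>P\<close> is a join of
  elements \<open>e\<^sub>B\<close>, the product \<open>e\<^sub>P \<and> e\<^sub>R\<close> with \<open>R \<approx> Q\<close> is one of the claimed basis elements or \<open>0\<close>
  (\<open>e_comp_wedge_e_comp\<close>), and every claimed basis element arises. They are independent because the
  coefficient of the element with index \<open>(Q(1), \<dots>, Q(l))\<close> at \<open>R(1) \<or> \<dots> \<or> R(l)\<close> is \<open>1\<close> or \<open>0\<close>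
  according to whether the two indices agree (\<open>lookup_dag_elt\<close>). Counting the indices block by block of \<open>P\<close> gives
  \<open>(m\<^sub>1 - 1)! \<cdots> (m\<^sub>l - 1)!\<close>, since within each \<open>P\<^sub>j\<close> only the last block is prescribed.

  \<^bold>\<open>The Cartan invariant.\<close> Let \<open>N \<subset> N'\<close> be submodules of \<open>F\<Pi>\<^sub>A\<close> with simple quotient, and let \<open>X\<close> be a
  longest set composition that does not annihilate the quotient. For each \<open>T\<close>, the product \<open>X \<and> T\<close> is
  \<open>X\<close> or longer than \<open>X\<close>; hence the kernel of \<open>X\<close> on the quotient is a submodule, \<open>X\<close> is injective, and,
  being idempotent, the identity. It follows that \<open>T\<close> acts by the scalar \<open>\<chi>\<^sub>X(T)\<close>, which is \<open>1\<close> if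
  \<open>X \<preceq> T\<close> and \<open>0\<close> otherwise, and that the quotient is a line (\<open>simple_pair_char\<close>). The
  idempotent \<open>e\<^sub>P\<close> acts on it by \<open>1\<close> if \<open>X \<approx> P\<close> and by \<open>0\<close> otherwise (\<open>eps_e_comp_wedge\<close>). The module
  \<open>M\<^sub>P\<close> is such a line with \<open>X = P\<close>, because the functional on \<open>\<Lambda>\<^sub>P\<close> that sends every \<open>e\<^sub>R\<close>, \<open>R \<approx> P\<close>,
  to \<open>1\<close> has the unique maximal submodule as kernel (\<open>maximal_submodule_Lambda\<close>). So along a composition
  series of \<open>\<Lambda>\<^sub>Q\<close> the dimension of \<open>e\<^sub>P \<and> N\<^sub>i\<close> grows by \<open>1\<close> exactly at the factors isomorphic to \<open>M\<^sub>P\<close>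
  (\<open>basis_step\<close>), and their number is \<open>dim (e\<^sub>P \<and> \<Lambda>\<^sub>Q)\<close>, the size of the basis.
\<close>


section \<open>Linear extension\<close>

abbreviation coeff :: "('b \<Rightarrow>\<^sub>0 'f) \<Rightarrow> 'b \<Rightarrow> 'f::zero" where
  "coeff \<equiv> Poly_Mapping.lookup"

abbreviation terms :: "('b \<Rightarrow>\<^sub>0 'f::zero) \<Rightarrow> 'b set" where
  "terms \<equiv> Poly_Mapping.keys"

lemma lin_ext_eq_sum:
  assumes "finite S" "terms f \<subseteq> S"
  shows "lin_ext b f = (\<Sum>x\<in>S. scal (coeff f x) (b x))"
  unfolding lin_ext_def using assms
  by (intro sum.mono_neutral_left) (auto simp: in_keys_iff)

lemma lin_ext_0 [simp]: "lin_ext b 0 = 0"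
  by (simp add: lin_ext_def)

lemma lin_ext_add: "lin_ext b (f + g) = lin_ext b f + lin_ext b g"
proof -
  let ?S = "terms f \<union> terms g"
  have "lin_ext b (f + g) = (\<Sum>x\<in>?S. scal (coeff (f + g) x) (b x))"
    by (rule lin_ext_eq_sum) (use keys_add[of f g] in simp_all)
  moreover have "lin_ext b f = (\<Sum>x\<in>?S. scal (coeff f x) (b x))"
    by (rule lin_ext_eq_sum) auto
  moreover have "lin_ext b g = (\<Sum>x\<in>?S. scal (coeff g x) (b x))"
    by (rule lin_ext_eq_sum) auto
  ultimately show ?thesis
    by (simp add: lookup_add fpi.scale_left_distrib sum.distrib)
qed

lemma lin_ext_scal: "lin_ext b (scal c f) = scal c (lin_ext b f)"
proof -
  have "lin_ext b (scal c f) = (\<Sum>x\<in>terms f. scal (coeff (scal c f) x) (b x))"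
    by (rule lin_ext_eq_sum) (auto simp: in_keys_iff)
  then show ?thesis
    by (simp add: lin_ext_def fpi.scale_sum_right)
qed

lemma lin_ext_basis [simp]: "lin_ext b (Poly_Mapping.single x 1) = b x"
  by (simp add: lin_ext_def)

lemma lin_ext_uminus: "lin_ext b (- f) = - lin_ext b f"
  using lin_ext_add[of b f "- f"] by (simp add: eq_neg_iff_add_eq_0 add.commute)

lemma lin_ext_diff: "lin_ext b (f - g) = lin_ext b f - lin_ext b g"
  using lin_ext_add[of b f "- g"] by (simp add: lin_ext_uminus)

lemma lin_ext_sum: "lin_ext b (sum g I) = (\<Sum>i\<in>I. lin_ext b (g i))"
  by (induction I rule: infinite_finite_induct) (auto simp: lin_ext_add)

lemma lin_ext_fun_add: "lin_ext (\<lambda>x. b x + c x) f = lin_ext b f + lin_ext c f"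
  by (simp add: lin_ext_def fpi.scale_right_distrib sum.distrib)

lemma lin_ext_fun_scal: "lin_ext (\<lambda>x. scal a (b x)) f = scal a (lin_ext b f)"
  unfolding lin_ext_def fpi.scale_sum_right
  by (intro sum.cong refl) (simp add: mult.commute)

lemma lin_ext_fun_0 [simp]: "lin_ext (\<lambda>x. 0) f = 0"
  by (simp add: lin_ext_def)

lemma bilin_ext_add_left: "bilin_ext b (f + f') g = bilin_ext b f g + bilin_ext b f' g"
  and bilin_ext_add_right: "bilin_ext b f (g + g') = bilin_ext b f g + bilin_ext b f g'"
  and bilin_ext_scal_left: "bilin_ext b (scal c f) g = scal c (bilin_ext b f g)"
  and bilin_ext_scal_right: "bilin_ext b f (scal c g) = scal c (bilin_ext b f g)"
  and bilin_ext_0_left: "bilin_ext b 0 g = 0"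
  and bilin_ext_0_right: "bilin_ext b f 0 = 0"
  by (simp_all add: bilin_ext_def lin_ext_add lin_ext_fun_add lin_ext_scal lin_ext_fun_scal)

lemmas wedge_add_left = bilin_ext_add_left[of wedge_comp, folded wedge_def]
  and wedge_add_right = bilin_ext_add_right[of wedge_comp, folded wedge_def]
  and wedge_scal_left = bilin_ext_scal_left[of wedge_comp, folded wedge_def]
  and wedge_scal_right = bilin_ext_scal_right[of wedge_comp, folded wedge_def]
  and wedge_0_left [simp] = bilin_ext_0_left[of wedge_comp, folded wedge_def]
  and wedge_0_right [simp] = bilin_ext_0_right[of wedge_comp, folded wedge_def]

lemmas vee_add_left = bilin_ext_add_left[of vee_comp, folded vee_def]
  and vee_add_right = bilin_ext_add_right[of vee_comp, folded vee_def]
  and vee_scal_left = bilin_ext_scal_left[of vee_comp, folded vee_def]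
  and vee_scal_right = bilin_ext_scal_right[of vee_comp, folded vee_def]
  and vee_0_left [simp] = bilin_ext_0_left[of vee_comp, folded vee_def]
  and vee_0_right [simp] = bilin_ext_0_right[of vee_comp, folded vee_def]

lemma wedge_diff_right: "f \<^bold>\<and> (g - g') = f \<^bold>\<and> g - f \<^bold>\<and> g'"
  using wedge_add_right[of f "g - g'" g'] by (simp add: eq_diff_eq)

lemma wedge_sum_left: "sum h I \<^bold>\<and> g = (\<Sum>i\<in>I. h i \<^bold>\<and> g)"
  by (induction I rule: infinite_finite_induct) (auto simp: wedge_add_left)

lemma wedge_sum_right: "g \<^bold>\<and> sum h I = (\<Sum>i\<in>I. g \<^bold>\<and> h i)"
  by (induction I rule: infinite_finite_induct) (auto simp: wedge_add_right)

lemma vee_sum_left: "sum h I \<^bold>\<or> g = (\<Sum>i\<in>I. h i \<^bold>\<or> g)"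
  by (induction I rule: infinite_finite_induct) (auto simp: vee_add_left)

lemma vee_sum_right: "g \<^bold>\<or> sum h I = (\<Sum>i\<in>I. g \<^bold>\<or> h i)"
  by (induction I rule: infinite_finite_induct) (auto simp: vee_add_right)

lemma basis_expansion:
  "f = (\<Sum>x\<in>terms f. scal (coeff f x) (Poly_Mapping.single x 1))"
  by (rule poly_mapping_eqI)
    (auto simp: lookup_sum lookup_single when_def in_keys_iff if_distrib[of "\<lambda>z. _ * z"] cong: if_cong)

text \<open>
  Identities and memberships that are linear in \<open>f\<close> are proved by this induction; it replaces explicit
  manipulation of the double sums behind \<^const>\<open>lin_ext\<close>.
\<close>

lemma supported_induct [consumes 1, case_names basis zero add scal]:
  fixes f :: "'b \<Rightarrow>\<^sub>0 'f::field"
  assumes "terms f \<subseteq> S"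
    and basis: "\<And>x. x \<in> S \<Longrightarrow> P (Poly_Mapping.single x 1)"
    and zero: "P 0"
    and add: "\<And>f g. P f \<Longrightarrow> P g \<Longrightarrow> P (f + g)"
    and scal: "\<And>c f. P f \<Longrightarrow> P (scal c f)"
  shows "P f"
proof -
  have "P (\<Sum>x\<in>T. scal (coeff f x) (Poly_Mapping.single x 1))"
    if "finite T" "T \<subseteq> S" for T
    using that by (induction rule: finite_induct) (simp_all add: zero add scal basis)
  from this[OF finite_keys[of f] assms(1)] show ?thesis
    by (simp only: basis_expansion[of f, symmetric])
qed

lemma lin_ext_cong:
  assumes "\<And>x. x \<in> terms f \<Longrightarrow> b x = c x"
  shows "lin_ext b f = lin_ext c f"
  unfolding lin_ext_def using assms by (intro sum.cong) auto

lemma lin_ext_lin_ext: "lin_ext b (lin_ext c f) = lin_ext (\<lambda>x. lin_ext b (c x)) f"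
  unfolding lin_ext_def[of c] lin_ext_def[of "\<lambda>x. lin_ext b (c x)"]
  by (simp add: lin_ext_sum lin_ext_scal)

lemma wedge_lin_ext_right: "g \<^bold>\<and> lin_ext b f = lin_ext (\<lambda>x. g \<^bold>\<and> b x) f"
  by (simp add: lin_ext_def wedge_sum_right wedge_scal_right)

lemma subspace_FPi_on: "fpi.subspace (FPi_on A)"
proof (rule fpi.subspaceI)
  show "f + g \<in> FPi_on A" if "f \<in> FPi_on A" "g \<in> FPi_on A" for f g :: "'f::field fpi"
    using that keys_add[of f g] unfolding FPi_on_def by blast
  show "scal c f \<in> FPi_on A" if "f \<in> FPi_on A" for c and f :: "'f::field fpi"
    using that unfolding FPi_on_def by (auto simp: in_keys_iff)
qed (simp add: FPi_on_def)

lemma basis_in_FPi_on [simp]: "basis_elt P \<in> FPi_on A \<longleftrightarrow> P \<in> set_comps A"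
  by (auto simp: FPi_on_def)

lemma FPi_on_induct [consumes 1, case_names basis zero add scal]:
  fixes f :: "'f::field fpi"
  assumes "f \<in> FPi_on A"
    and "\<And>x. x \<in> set_comps A \<Longrightarrow> P (basis_elt x)"
    and "P 0"
    and "\<And>f g. P f \<Longrightarrow> P g \<Longrightarrow> P (f + g)"
    and "\<And>c f. P f \<Longrightarrow> P (scal c f)"
  shows "P f"
  using assms supported_induct[of f "set_comps A" P] by (auto simp: FPi_on_def)


section \<open>Set compositions\<close>

lemma set_comps_Nil [simp]: "[] \<in> set_comps A \<longleftrightarrow> A = {}"
  by (auto simp: set_comps_def)

lemma set_comps_Union: "P \<in> set_comps A \<Longrightarrow> \<Union>(set P) = A"
  by (simp add: set_comps_def)

lemma set_comps_empty [simp]: "set_comps {} = {[]}"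
proof -
  have "P = []" if "{} \<notin> set P" "\<Union>(set P) = {}" for P :: scomp
    using that by (cases P) auto
  then show ?thesis by (auto simp: set_comps_def)
qed

lemma disjnt_Union_right: "disjnt X (\<Union>S) \<longleftrightarrow> (\<forall>Y\<in>S. disjnt X Y)"
  by (auto simp: disjnt_def)

lemma set_comps_append:
  "P @ Q \<in> set_comps A \<longleftrightarrow>
     P \<in> set_comps (\<Union>(set P)) \<and> Q \<in> set_comps (\<Union>(set Q)) \<and>
     disjnt (\<Union>(set P)) (\<Union>(set Q)) \<and> A = \<Union>(set P) \<union> \<Union>(set Q)"
  by (auto simp: set_comps_def sorted_wrt_append disjnt_Union_right disjnt_sym)

lemma set_comps_appendI:
  assumes "P \<in> set_comps A" "Q \<in> set_comps B" "A \<inter> B = {}"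
  shows "P @ Q \<in> set_comps (A \<union> B)"
  using assms set_comps_Union[OF assms(1)] set_comps_Union[OF assms(2)]
  by (auto simp: set_comps_append disjnt_def)

lemma set_comps_Cons:
  "X # Q \<in> set_comps A \<longleftrightarrow>
     X \<noteq> {} \<and> Q \<in> set_comps (\<Union>(set Q)) \<and> disjnt X (\<Union>(set Q)) \<and> A = X \<union> \<Union>(set Q)"
  by (auto simp: set_comps_def disjnt_Union_right)

lemma set_comps_single [simp]: "[X] \<in> set_comps A \<longleftrightarrow> X \<noteq> {} \<and> X = A"
  by (auto simp: set_comps_def)

lemma set_comps_disjoint:
  assumes "P \<in> set_comps A" "X \<in> set P" "Y \<in> set P" "X \<noteq> Y"
  shows "X \<inter> Y = {}"
proof -
  have "sorted_wrt disjnt P" using assms by (simp add: set_comps_def)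
  then show ?thesis using assms(2-)
    by (induction P) (auto simp: disjnt_def)
qed

lemma set_comps_nonempty: "P \<in> set_comps A \<Longrightarrow> X \<in> set P \<Longrightarrow> X \<noteq> {}"
  by (auto simp: set_comps_def)

lemma set_comps_subset: "P \<in> set_comps A \<Longrightarrow> X \<in> set P \<Longrightarrow> X \<subseteq> A"
  by (auto simp: set_comps_def)

lemma set_comps_distinct:
  assumes "P \<in> set_comps A"
  shows "distinct P"
proof -
  have "sorted_wrt disjnt P" "{} \<notin> set P" using assms by (auto simp: set_comps_def)
  then show ?thesis
    by (induction P) (auto simp: disjnt_def)
qed

lemma set_comps_iff:
  "P \<in> set_comps A \<longleftrightarrow> distinct P \<and> {} \<notin> set P \<and> \<Union>(set P) = A \<and>
     (\<forall>X\<in>set P. \<forall>Y\<in>set P. X \<noteq> Y \<longrightarrow> X \<inter> Y = {})"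
proof (intro iffI)
  show "distinct P \<and> {} \<notin> set P \<and> \<Union>(set P) = A \<and>
     (\<forall>X\<in>set P. \<forall>Y\<in>set P. X \<noteq> Y \<longrightarrow> X \<inter> Y = {})" if "P \<in> set_comps A"
    using that set_comps_distinct[OF that] set_comps_disjoint[OF that] by (auto simp: set_comps_def)
next
  assume *: "distinct P \<and> {} \<notin> set P \<and> \<Union>(set P) = A \<and>
     (\<forall>X\<in>set P. \<forall>Y\<in>set P. X \<noteq> Y \<longrightarrow> X \<inter> Y = {})"
  then have "sorted_wrt disjnt P"
    by (induction P arbitrary: A) (auto simp: disjnt_def)
  with * show "P \<in> set_comps A" by (simp add: set_comps_def)
qed

lemma set_comps_perm:
  assumes "P \<in> set_comps A" "mset P' = mset P"
  shows "P' \<in> set_comps A"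
  using assms mset_eq_setD[OF assms(2)] mset_eq_imp_distinct_iff[OF assms(2)]
  by (simp add: set_comps_iff)

lemma set_comps_mset_eq_iff:
  assumes "P \<in> set_comps A" "P' \<in> set_comps B"
  shows "mset P = mset P' \<longleftrightarrow> set P = set P'"
  using assms by (auto simp: set_eq_iff_mset_eq_distinct set_comps_distinct dest: mset_eq_setD)

lemma finite_set_comps:
  assumes "finite A"
  shows "finite (set_comps A)"
proof (rule finite_subset)
  have "length P \<le> card (Pow A)" if "P \<in> set_comps A" for P
    using set_comps_distinct[OF that] set_comps_subset[OF that] assms
    by (metis PowI card_mono distinct_card finite_Pow_iff subsetI)
  then show "set_comps A \<subseteq> {P. set P \<subseteq> Pow A \<and> length P \<le> card (Pow A)}"
    using set_comps_subset by blast
  show "finite {P. set P \<subseteq> Pow A \<and> length P \<le> card (Pow A)}"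
    using assms by (intro finite_lists_length_le) simp
qed

lemma set_comps_length_le:
  assumes "finite A" "P \<in> set_comps A"
  shows "length P \<le> card (Pow A)"
  using set_comps_distinct[OF assms(2)] set_comps_subset[OF assms(2)] assms
  by (metis PowI card_mono distinct_card finite_Pow_iff subsetI)


section \<open>The face product\<close>

abbreviation nonempty :: "scomp \<Rightarrow> scomp" where
  "nonempty \<equiv> filter (\<lambda>X. X \<noteq> {})"

abbreviation inside :: "nat set \<Rightarrow> scomp \<Rightarrow> scomp" where
  "inside X \<equiv> filter (\<lambda>Y. Y \<subseteq> X)"

definition meet :: "scomp \<Rightarrow> scomp \<Rightarrow> scomp" where
  "meet P Q = nonempty (concat (map (\<lambda>X. map (\<lambda>Y. X \<inter> Y) Q) P))"

lemma meet_Nil [simp]: "meet [] Q = []"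
  by (simp add: meet_def)

lemma meet_Cons: "meet (X # P) Q = nonempty (map (\<lambda>Y. X \<inter> Y) Q) @ meet P Q"
  by (simp add: meet_def)

lemma meet_append_left: "meet (P @ P') Q = meet P Q @ meet P' Q"
  by (simp add: meet_def)

lemma set_meet: "set (meet P Q) = {X \<inter> Y |X Y. X \<in> set P \<and> Y \<in> set Q \<and> X \<inter> Y \<noteq> {}}"
  by (auto simp: meet_def)

lemma Union_meet: "\<Union>(set (meet P Q)) = \<Union>(set P) \<inter> \<Union>(set Q)"
  unfolding set_meet by blast

lemma meet_in_set_comps:
  assumes "P \<in> set_comps A" "Q \<in> set_comps A"
  shows "meet P Q \<in> set_comps A"
proof -
  have "sorted_wrt disjnt P" "sorted_wrt disjnt Q"
    using assms by (auto simp: set_comps_def)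
  then have "sorted_wrt disjnt (meet P Q)"
  proof (induction P)
    case (Cons X P)
    have "sorted_wrt disjnt (nonempty (map (\<lambda>Y. X \<inter> Y) Q))"
      using Cons.prems(2) by (induction Q) (auto simp: disjnt_def)
    moreover have "disjnt U V" if "U \<in> set (map (\<lambda>Y. X \<inter> Y) Q)" "V \<in> set (meet P Q)" for U V
      using that Cons.prems(1) by (force simp: set_meet disjnt_def)
    ultimately show ?case
      using Cons by (auto simp: meet_Cons sorted_wrt_append)
  qed simp
  moreover have "{} \<notin> set (meet P Q)" by (auto simp: set_meet)
  moreover have "\<Union>(set (meet P Q)) = A"
    using assms by (simp add: Union_meet set_comps_Union)
  ultimately show ?thesis by (simp add: set_comps_def)
qed

lemma meet_Cons_left: "meet (X # P) Q = meet [X] Q @ meet P Q"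
  by (simp add: meet_Cons)

lemma filter_map_Int_Int:
  "nonempty (map ((\<inter>) (X \<inter> Y)) R)
     = nonempty (map ((\<inter>) X) (nonempty (map ((\<inter>) Y) R)))"
  by (induction R) (auto simp: Int_assoc)

lemma meet_single_assoc: "meet (meet [X] Q) R = meet [X] (meet Q R)"
proof (induction Q)
  case (Cons Y Q)
  have "meet (meet [X] (Y # Q)) R = meet (nonempty [X \<inter> Y]) R @ meet (meet [X] Q) R"
    by (simp add: meet_Cons meet_append_left[symmetric])
  moreover have "meet (nonempty [X \<inter> Y]) R = nonempty (map ((\<inter>) (X \<inter> Y)) R)"
    by (auto simp: meet_Cons)
  moreover have "meet [X] (meet (Y # Q) R)
      = nonempty (map ((\<inter>) X) (nonempty (map ((\<inter>) Y) R))) @ meet [X] (meet Q R)"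
    by (simp add: meet_Cons)
  ultimately show ?case using Cons by (simp only: filter_map_Int_Int)
qed (simp add: meet_def)

lemma meet_assoc: "meet (meet P Q) R = meet P (meet Q R)"
proof (induction P)
  case (Cons X P)
  have "meet (meet (X # P) Q) R = meet (meet [X] Q) R @ meet (meet P Q) R"
    by (subst meet_Cons_left) (rule meet_append_left)
  with Cons show ?case
    by (simp add: meet_single_assoc) (metis meet_Cons_left)
qed simp

lemma wedge_basis:
  "basis_elt P \<^bold>\<and> basis_elt Q = (if \<Union>(set P) = \<Union>(set Q) then basis_elt (meet P Q) else 0)"
  by (simp add: wedge_def bilin_ext_def wedge_comp_def meet_def)

lemma wedge_basis_same:
  assumes "P \<in> set_comps A" "Q \<in> set_comps A"
  shows "basis_elt P \<^bold>\<and> basis_elt Q = basis_elt (meet P Q)"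
  using assms by (simp add: wedge_basis set_comps_Union)

lemma vee_basis:
  "basis_elt P \<^bold>\<or> basis_elt Q = (if \<Union>(set P) \<inter> \<Union>(set Q) = {} then basis_elt (P @ Q) else 0)"
  by (simp add: vee_def bilin_ext_def vee_comp_def)

lemma fpi_induct [case_names basis zero add scal]:
  fixes f :: "'f::field fpi"
  assumes "\<And>x. P (basis_elt x)" "P 0" "\<And>f g. P f \<Longrightarrow> P g \<Longrightarrow> P (f + g)" "\<And>c f. P f \<Longrightarrow> P (scal c f)"
  shows "P f"
  using supported_induct[of f UNIV P] assms by auto

lemma wedge_assoc: "(f \<^bold>\<and> g) \<^bold>\<and> h = f \<^bold>\<and> (g \<^bold>\<and> h)"
proof (induction f rule: fpi_induct)
  case f: (basis P)
  show ?case
  proof (induction g rule: fpi_induct)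
    case g: (basis Q)
    show ?case
    proof (induction h rule: fpi_induct)
      case (basis R)
      show ?case by (auto simp: wedge_basis Union_meet meet_assoc)
    qed (simp_all add: wedge_add_right wedge_scal_right)
  qed (simp_all add: wedge_add_left wedge_scal_left wedge_add_right wedge_scal_right)
qed (simp_all add: wedge_add_left wedge_scal_left)

lemma vee_assoc: "(f \<^bold>\<or> g) \<^bold>\<or> h = f \<^bold>\<or> (g \<^bold>\<or> h)"
proof (induction f rule: fpi_induct)
  case f: (basis P)
  show ?case
  proof (induction g rule: fpi_induct)
    case g: (basis Q)
    show ?case
    proof (induction h rule: fpi_induct)
      case (basis R)
      show ?case by (auto simp: vee_basis)
    qed (simp_all add: vee_add_right vee_scal_right)
  qed (simp_all add: vee_add_left vee_scal_left vee_add_right vee_scal_right)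
qed (simp_all add: vee_add_left vee_scal_left)

lemma vee_Nil_left [simp]: "basis_elt [] \<^bold>\<or> f = f"
  by (induction f rule: fpi_induct) (simp_all add: vee_basis vee_add_right vee_scal_right)

lemma vee_Nil_right [simp]: "f \<^bold>\<or> basis_elt [] = f"
  by (induction f rule: fpi_induct) (simp_all add: vee_basis vee_add_left vee_scal_left)

lemma vee_list_Nil [simp]: "vee_list [] = basis_elt []"
  and vee_list_Cons [simp]: "vee_list (f # fs) = f \<^bold>\<or> vee_list fs"
  by (simp_all add: vee_list_def)

lemma vee_list_append: "vee_list (fs @ gs) = vee_list fs \<^bold>\<or> vee_list gs"
  by (induction fs) (simp_all add: vee_assoc)

lemma wedge_in_FPi_on:
  assumes "f \<in> FPi_on A" "g \<in> FPi_on A"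
  shows "f \<^bold>\<and> g \<in> FPi_on A"
  using assms(1)
proof (induction f rule: FPi_on_induct)
  case f: (basis P)
  from assms(2) show ?case
    by (induction g rule: FPi_on_induct)
      (use f subspace_FPi_on[of A] in \<open>auto simp: wedge_basis_same meet_in_set_comps wedge_add_right
         wedge_scal_right fpi.subspace_def\<close>)
qed (use subspace_FPi_on[of A] in \<open>auto simp: wedge_add_left wedge_scal_left fpi.subspace_def\<close>)

lemma vee_in_FPi_on:
  assumes "f \<in> FPi_on A" "g \<in> FPi_on B" "A \<inter> B = {}"
  shows "f \<^bold>\<or> g \<in> FPi_on (A \<union> B)"
  using assms(1)
proof (induction f rule: FPi_on_induct)
  case f: (basis P)
  from assms(2) show ?case
    by (induction g rule: FPi_on_induct)
      (use f assms(3) subspace_FPi_on[of "A \<union> B"] set_comps_appendI[of _ A _ B]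
       in \<open>auto simp: vee_basis set_comps_Union vee_add_right vee_scal_right fpi.subspace_def\<close>)
qed (use subspace_FPi_on[of "A \<union> B"] in \<open>auto simp: vee_add_left vee_scal_left fpi.subspace_def\<close>)

text \<open>
  Every block of \<open>P\<close> meets exactly one block of \<open>Q\<close>, namely the one that contains it.
\<close>

lemma meet_eq_left:
  assumes "P \<in> set_comps A" "Q \<in> set_comps A" "P \<preceq> Q"
  shows "meet P Q = P"
proof -
  have single: "nonempty (map ((\<inter>) X) R) = [X]"
    if "X \<noteq> {}" "X \<subseteq> Y" "Y \<in> set R" "R \<in> set_comps B" for X Y R B
  proof -
    from that(3) obtain R1 R2 where R: "R = R1 @ Y # R2" by (meson split_list)
    have "X \<inter> Z = {}" if "Z \<in> set R1 \<union> set R2" for Z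
    proof -
      have "Z \<noteq> Y" using set_comps_distinct[OF \<open>R \<in> set_comps B\<close>] that R by auto
      then show ?thesis using set_comps_disjoint[OF \<open>R \<in> set_comps B\<close>, of Z Y] R that \<open>X \<subseteq> Y\<close> by auto
    qed
    then have "nonempty (map ((\<inter>) X) R1) = []" "nonempty (map ((\<inter>) X) R2) = []"
      by (auto simp: filter_empty_conv)
    then show ?thesis using R that by (simp add: Int_absorb2)
  qed
  have "meet R Q = R" if "set R \<subseteq> set P" for R
    using that
  proof (induction R)
    case (Cons X R)
    from Cons.prems assms(3) obtain Y where "Y \<in> set Q" "X \<subseteq> Y" by (auto simp: refines_def)
    then have "nonempty (map ((\<inter>) X) Q) = [X]"
      using single[of X Y Q A] assms set_comps_nonempty[OF assms(1)] Cons.prems by auto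
    then show ?case using Cons by (simp add: meet_Cons)
  qed simp
  then show ?thesis by blast
qed

text \<open>
  If \<open>Q\<close> is finer than \<open>P\<close>, its blocks are not cut: they are sorted stably by the block of \<open>P\<close> that
  contains them. In this form \<open>P\<close> acts on the orderings of a fixed set of blocks.
\<close>

lemma meet_eq_filter:
  assumes "P \<in> set_comps A" "Q \<in> set_comps A" "Q \<preceq> P"
  shows "meet P Q = concat (map (\<lambda>X. inside X Q) P)"
proof -
  have 1: "nonempty (map ((\<inter>) X) R) = inside X R"
    if "X \<in> set P" "set R \<subseteq> set Q" for X R
    using that(2)
  proof (induction R)
    case (Cons Y R)
    obtain Z where Z: "Z \<in> set P" "Y \<subseteq> Z" using Cons assms(3) by (auto simp: refines_def)
    have "Y \<noteq> {}" using set_comps_nonempty[OF assms(2)] Cons.prems by simp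
    have "X \<inter> Y = (if Y \<subseteq> X then Y else {})"
      using set_comps_disjoint[OF assms(1) that(1) Z(1)] Z(2) by (cases "X = Z") auto
    then show ?case using Cons \<open>Y \<noteq> {}\<close> by auto
  qed simp
  have "meet R Q = concat (map (\<lambda>X. inside X Q) R)" if "set R \<subseteq> set P" for R
    using that by (induction R) (simp_all add: meet_Cons 1)
  then show ?thesis by blast
qed

lemma set_meet_refines:
  assumes "P \<in> set_comps A" "Q \<in> set_comps A" "Q \<preceq> P"
  shows "set (meet P Q) = set Q"
  using assms by (auto simp: meet_eq_filter refines_def)

lemma mset_meet_refines:
  assumes "P \<in> set_comps A" "Q \<in> set_comps A" "Q \<preceq> P"
  shows "mset (meet P Q) = mset Q"
  using set_meet_refines[OF assms] assms meet_in_set_comps[OF assms(1,2)]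
  by (simp add: set_comps_mset_eq_iff)

text \<open>
  Sending a block of \<open>Q\<close> to the block of \<open>P\<close> around it is a surjection, and it is injective
  only if no block of \<open>P\<close> is subdivided.
\<close>

lemma refines_length:
  assumes "P \<in> set_comps A" "Q \<in> set_comps A" "Q \<preceq> P"
  shows "length P \<le> length Q" "length P = length Q \<Longrightarrow> set P = set Q"
proof -
  have "\<forall>Y\<in>set Q. \<exists>X. X \<in> set P \<and> Y \<subseteq> X"
    using assms(3) by (auto simp: refines_def)
  from bchoice[OF this] obtain h where h: "h Y \<in> set P \<and> Y \<subseteq> h Y" if "Y \<in> set Q" for Y
    by blast
  have surj: "set P \<subseteq> h ` set Q"
  proof
    fix X assume X: "X \<in> set P"
    then obtain a where a: "a \<in> X" using set_comps_nonempty[OF assms(1)] by blast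
    then obtain Y where Y: "Y \<in> set Q" "a \<in> Y"
      using X set_comps_subset[OF assms(1) X] set_comps_Union[OF assms(2)] by blast
    then have "h Y = X"
      using h[OF Y(1)] set_comps_disjoint[OF assms(1) _ X, of "h Y"] a by blast
    then show "X \<in> h ` set Q" using Y by blast
  qed
  have card: "card (set P) = length P" "card (set Q) = length Q"
    using assms by (auto simp: distinct_card set_comps_distinct)
  show "length P \<le> length Q"
    using surj_card_le[OF _ surj] card by simp
  assume eq: "length P = length Q"
  have im: "h ` set Q = set P" using surj h by blast
  then have inj: "inj_on h (set Q)"
    using eq card by (intro eq_card_imp_inj_on) auto
  have "h Y = Y" if Y: "Y \<in> set Q" for Y
  proof -
    have "h Y \<subseteq> Y"
    proof
      fix a assume a: "a \<in> h Y"
      then obtain Y' where Y': "Y' \<in> set Q" "a \<in> Y'"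
        using h[OF Y] set_comps_subset[OF assms(1), of "h Y"] set_comps_Union[OF assms(2)] by blast
      then have "h Y' = h Y"
        using h[OF Y] h[OF Y'(1)] a set_comps_disjoint[OF assms(1), of "h Y" "h Y'"] by blast
      with inj Y Y' show "a \<in> Y" by (auto dest: inj_onD)
    qed
    with h[OF Y] show ?thesis by blast
  qed
  then show "set P = set Q" using im by simp
qed

lemma meet_refines_left: "meet P Q \<preceq> P"
  by (auto simp: refines_def set_meet)

lemma meet_refines_right: "meet P Q \<preceq> Q"
  by (auto simp: refines_def set_meet)

lemma refines_trans: "P \<preceq> Q \<Longrightarrow> Q \<preceq> R \<Longrightarrow> P \<preceq> R"
  unfolding refines_def by (meson order_trans)

lemma refines_refl: "P \<preceq> P"
  by (auto simp: refines_def)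

text \<open>
  Supplies the maximality argument for simple modules: if \<open>P\<close> is a longest set composition acting on one
  as a nonzero map, then every \<open>Q\<close> that \<open>P\<close> does not refine satisfies \<open>P \<and> Q = 0\<close> there.
\<close>

lemma length_meet_greater:
  assumes "P \<in> set_comps A" "Q \<in> set_comps A" "\<not> P \<preceq> Q"
  shows "length (meet P Q) > length P"
proof -
  note m = meet_in_set_comps[OF assms(1,2)]
  have "length P \<le> length (meet P Q)"
    using refines_length(1)[OF assms(1) m meet_refines_left] .
  moreover have "length P \<noteq> length (meet P Q)"
    using refines_length(2)[OF assms(1) m meet_refines_left] assms(3) meet_refines_right[of P Q]
    by (auto simp: refines_def)
  ultimately show ?thesis by simp
qed


section \<open>The elements \<open>e_Q\<close>\<close>

text \<open>
  The index set of the sum that defines \<open>e\<^sub>B\<close>.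
\<close>

definition rooted :: "nat set \<Rightarrow> scomp set" where
  "rooted B = {R \<in> set_comps B. Min B \<in> hd R}"

definition sgn_comp :: "scomp \<Rightarrow> 'f::field" where
  "sgn_comp R = (- 1) ^ (length R - 1)"

lemma e_set_eq_sum: "e_set B = (\<Sum>R\<in>rooted B. scal (sgn_comp R) (basis_elt R))"
  by (simp add: e_set_def rooted_def sgn_comp_def)

lemma set_comps_split_block:
  assumes "X \<noteq> {}" "Z \<noteq> {}"
  shows "R' @ X # Z # R'' \<in> set_comps B \<longleftrightarrow> X \<inter> Z = {} \<and> R' @ (X \<union> Z) # R'' \<in> set_comps B"
  using assms by (auto simp: set_comps_append set_comps_Cons disjnt_def)

lemma rooted_split_block:
  assumes "X \<noteq> {}" "Z \<noteq> {}" "Min B \<notin> Z"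
  shows "R' @ X # Z # R'' \<in> rooted B \<longleftrightarrow> X \<inter> Z = {} \<and> R' @ (X \<union> Z) # R'' \<in> rooted B"
proof -
  have "Min B \<in> hd (R' @ X # Z # R'') \<longleftrightarrow> Min B \<in> hd (R' @ (X \<union> Z) # R'')"
    using assms(3) by (cases R') auto
  with set_comps_split_block[OF assms(1,2)] show ?thesis
    by (simp add: rooted_def)
qed

fun split_at :: "nat set \<Rightarrow> scomp \<Rightarrow> scomp" where
  "split_at C [] = []"
| "split_at C (X # R) = (if X \<inter> C = {} then X # split_at C R else (X - C) # (X \<inter> C) # R)"

fun merge_at :: "nat set \<Rightarrow> scomp \<Rightarrow> scomp" where
  "merge_at C [] = []"
| "merge_at C [X] = [X]"
| "merge_at C (Y # X # R) = (if X \<inter> C = {} then Y # merge_at C (X # R) else (Y \<union> X) # R)"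

lemma split_at_append:
  "\<forall>Y\<in>set R'. Y \<inter> C = {} \<Longrightarrow> X \<inter> C \<noteq> {} \<Longrightarrow> split_at C (R' @ X # R'') = R' @ (X - C) # (X \<inter> C) # R''"
  by (induction R') auto

lemma merge_at_append:
  "\<forall>Y\<in>set R'. Y \<inter> C = {} \<Longrightarrow> Y \<inter> C = {} \<Longrightarrow> X \<inter> C \<noteq> {} \<Longrightarrow>
     merge_at C (R' @ Y # X # R'') = R' @ (Y \<union> X) # R''"
proof (induction R')
  case (Cons Z R')
  then show ?case by (cases R') auto
qed simp

text \<open>
  The involution: take the first block \<open>X\<close> of \<open>R\<close> that meets \<open>C\<close>. If \<open>X\<close> is not inside \<open>C\<close>, split it into
  \<open>X - C\<close> followed by \<open>X \<inter> C\<close>; if it is, merge it with its predecessor. The predecessor exists because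
  the first block contains \<open>Min B\<close>, which is not in \<open>C\<close>, and for the same reason \<open>Min B\<close> stays in the
  first block. The length changes by one, so the terms cancel for every \<open>F\<close> that does not see the splitting.
\<close>

lemma sum_rooted_cancel:
  fixes F :: "scomp \<Rightarrow> ('c \<Rightarrow>\<^sub>0 'f::field)"
  assumes "finite B" "C \<subseteq> B" "C \<noteq> {}" "Min B \<notin> C"
    and F: "\<And>R' X R''. R' @ X # R'' \<in> rooted B \<Longrightarrow> \<forall>Y\<in>set R'. Y \<inter> C = {} \<Longrightarrow>
              X \<inter> C \<noteq> {} \<Longrightarrow> \<not> X \<subseteq> C \<Longrightarrow> F (R' @ (X - C) # (X \<inter> C) # R'') = F (R' @ X # R'')"
  shows "(\<Sum>R\<in>rooted B. scal (sgn_comp R) (F R)) = 0"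
proof -
  \<comment> \<open>The terms to be split and the terms to be merged.\<close>
  define Mix where "Mix = {R \<in> rooted B. \<exists>R' X R''. R = R' @ X # R'' \<and> (\<forall>Y\<in>set R'. Y \<inter> C = {}) \<and>
      X \<inter> C \<noteq> {} \<and> \<not> X \<subseteq> C}"
  define Pure where "Pure = {R \<in> rooted B. \<exists>R' Y X R''. R = R' @ Y # X # R'' \<and>
      (\<forall>Y\<in>set R'. Y \<inter> C = {}) \<and> Y \<inter> C = {} \<and> X \<noteq> {} \<and> X \<subseteq> C}"
  have fin: "finite (rooted B)"
    using finite_set_comps[OF assms(1)] by (simp add: rooted_def)
  have cover: "rooted B = Mix \<union> Pure"
  proof (intro equalityI subsetI)
    fix R assume R: "R \<in> rooted B"
    have "\<exists>X\<in>set R. X \<inter> C \<noteq> {}"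
      using R assms(2,3) set_comps_Union[of R B] by (auto simp: rooted_def)
    then obtain R' X R'' where *: "R = R' @ X # R''" "X \<inter> C \<noteq> {}" "\<forall>Y\<in>set R'. Y \<inter> C = {}"
      using split_list_first_prop[of R "\<lambda>X. X \<inter> C \<noteq> {}"] by auto
    show "R \<in> Mix \<union> Pure"
    proof (cases "X \<subseteq> C")
      case False
      with * R have "R \<in> Mix" unfolding Mix_def by blast
      then show ?thesis ..
    next
      case True
      have "R' \<noteq> []"
        using R * True assms(4) by (auto simp: rooted_def)
      then obtain R0 Y where "R' = R0 @ [Y]" by (meson rev_exhaust)
      then have "R = R0 @ Y # X # R''" "\<forall>Z\<in>set R0. Z \<inter> C = {}" "Y \<inter> C = {}" "X \<noteq> {}"
        using * by auto
      with R True have "R \<in> Pure" unfolding Pure_def by blast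
      then show ?thesis ..
    qed
  qed (auto simp: Mix_def Pure_def)
  have disj: "Mix \<inter> Pure = {}"
  proof -
    have False if "R \<in> Mix" "R \<in> Pure" for R
    proof -
      from that(1) obtain R1 X1 S1 where 1: "R = R1 @ X1 # S1" "\<forall>Y\<in>set R1. Y \<inter> C = {}"
        "X1 \<inter> C \<noteq> {}" "\<not> X1 \<subseteq> C" unfolding Mix_def by blast
      from that(2) obtain R2 Y2 X2 S2 where 2: "R = (R2 @ [Y2]) @ X2 # S2"
        "\<forall>Y\<in>set (R2 @ [Y2]). Y \<inter> C = {}" "X2 \<noteq> {}" "X2 \<subseteq> C" unfolding Pure_def by fastforce
      have "X1 = X2 \<or> X1 \<in> set (R2 @ [Y2]) \<or> X2 \<in> set R1"
        using 1(1) 2(1) by (auto simp: append_eq_append_conv2 append_eq_Cons_conv Cons_eq_append_conv)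
      then show False using 1 2 by auto
    qed
    then show ?thesis by blast
  qed
  let ?g = "\<lambda>R. scal (sgn_comp R) (F R) :: 'c \<Rightarrow>\<^sub>0 'f"
  have "(\<Sum>R\<in>Mix. - ?g R) = (\<Sum>R\<in>Pure. ?g R)"
  proof (rule sum.reindex_bij_witness[of Mix "merge_at C" "split_at C"])
    fix R assume "R \<in> Mix"
    then obtain R' X R'' where R: "R = R' @ X # R''" "\<forall>Y\<in>set R'. Y \<inter> C = {}" "X \<inter> C \<noteq> {}"
      "\<not> X \<subseteq> C" "R \<in> rooted B" unfolding Mix_def by blast
    have s: "split_at C R = R' @ (X - C) # (X \<inter> C) # R''"
      using R by (simp add: split_at_append)
    have U: "(X - C) \<union> (X \<inter> C) = X" by blast
    show "merge_at C (split_at C R) = R"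
      unfolding s using R by (subst merge_at_append) (auto simp: U)
    have "split_at C R \<in> rooted B"
      unfolding s using R assms(4) by (subst rooted_split_block) (auto simp: U)
    then show "split_at C R \<in> Pure"
      unfolding Pure_def using s R by blast
    have "F (split_at C R) = F R" unfolding s using F R by blast
    moreover have "length (split_at C R) - 1 = Suc (length R - 1)"
      unfolding s using R by simp
    ultimately show "?g (split_at C R) = - ?g R"
      by (simp add: sgn_comp_def fpi.scale_minus_left)
  next
    fix R assume "R \<in> Pure"
    then obtain R' Y X R'' where R: "R = R' @ Y # X # R''" "\<forall>Y\<in>set R'. Y \<inter> C = {}" "Y \<inter> C = {}"
      "X \<noteq> {}" "X \<subseteq> C" "R \<in> rooted B" unfolding Pure_def by blast
    have Y: "Y \<noteq> {}" using R(1,6) set_comps_nonempty[of R B Y] by (simp add: rooted_def)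
    have m: "merge_at C R = R' @ (Y \<union> X) # R''"
      using R by (subst R, subst merge_at_append) auto
    have "split_at C (merge_at C R) = R' @ ((Y \<union> X) - C) # ((Y \<union> X) \<inter> C) # R''"
      unfolding m using R by (subst split_at_append) auto
    moreover have "(Y \<union> X) - C = Y" "(Y \<union> X) \<inter> C = X" using R by auto
    ultimately show "split_at C (merge_at C R) = R" using R by simp
    have "R' @ (Y \<union> X) # R'' \<in> rooted B"
      using R Y assms(4) rooted_split_block[of Y X B R' R''] by auto
    moreover have "(Y \<union> X) \<inter> C \<noteq> {}" "\<not> Y \<union> X \<subseteq> C" using R Y by auto
    ultimately show "merge_at C R \<in> Mix"
      unfolding Mix_def m using R(2) by blast
  qed
  then have "(\<Sum>R\<in>Mix \<union> Pure. ?g R) = 0"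
    using fin cover disj by (subst sum.union_disjoint) (auto simp: sum_negf add_eq_0_iff)
  then show ?thesis using cover by simp
qed

lemma e_comp_Nil [simp]: "e_comp [] = basis_elt []"
  and e_comp_Cons: "e_comp (B # Q) = e_set B \<^bold>\<or> e_comp Q"
  and e_comp_append: "e_comp (Q @ R) = e_comp Q \<^bold>\<or> e_comp R"
  by (simp_all add: e_comp_def vee_list_append)

lemma e_set_in_FPi_on: "e_set B \<in> FPi_on B"
  unfolding e_set_eq_sum
  by (intro fpi.subspace_sum fpi.subspace_scale subspace_FPi_on) (simp add: rooted_def)

lemma e_comp_in_FPi_on:
  assumes "Q \<in> set_comps A"
  shows "(e_comp Q :: 'f::field fpi) \<in> FPi_on A"
  using assms
proof (induction Q arbitrary: A)
  case (Cons B Q)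
  then have "Q \<in> set_comps (\<Union>(set Q))" "B \<inter> \<Union>(set Q) = {}"
    by (auto simp: set_comps_Cons disjnt_def)
  then have "(e_set B \<^bold>\<or> e_comp Q :: 'f fpi) \<in> FPi_on (B \<union> \<Union>(set Q))"
    by (intro vee_in_FPi_on e_set_in_FPi_on Cons.IH)
  with Cons.prems show ?case by (simp add: e_comp_Cons set_comps_Cons)
qed simp

lemma rooted_in_set_comps: "R \<in> rooted B \<Longrightarrow> R \<in> set_comps B"
  by (simp add: rooted_def)

lemma concat_rooted_in_set_comps:
  assumes "Q \<in> set_comps A" "\<forall>b\<in>set Q. r b \<in> set_comps b"
  shows "concat (map r Q) \<in> set_comps A"
  using assms
proof (induction Q arbitrary: A)
  case (Cons b Q)
  then have "Q \<in> set_comps (\<Union>(set Q))" "b \<inter> \<Union>(set Q) = {}"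
    by (auto simp: set_comps_Cons disjnt_def)
  then have "r b @ concat (map r Q) \<in> set_comps (b \<union> \<Union>(set Q))"
    using Cons.prems(2) by (intro set_comps_appendI Cons.IH) auto
  with Cons.prems show ?case by (simp add: set_comps_Cons)
qed simp

text \<open>
  Indexing the terms by functions on the \<^emph>\<open>set\<close> of blocks makes the index set and the signs
  independent of the order of the blocks, so that \<open>e\<^sub>Q\<close> and \<open>e\<^sub>R\<close> with \<open>R \<approx> Q\<close> can be compared term by term.
\<close>

lemma e_comp_expand:
  assumes "finite A" "Q \<in> set_comps A"
  shows "(e_comp Q :: 'f::field fpi) = (\<Sum>r\<in>PiE (set Q) rooted.
           scal (\<Prod>b\<in>set Q. sgn_comp (r b)) (basis_elt (concat (map r Q))))"
  using assms
proof (induction Q arbitrary: A)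
  case (Cons b Q)
  let ?S = "PiE (set Q) rooted"
  let ?t = "\<lambda>Q r. scal (\<Prod>b\<in>set Q. sgn_comp (r b)) (basis_elt (concat (map r Q))) :: 'f fpi"
  have b: "b \<notin> set Q" "Q \<in> set_comps (\<Union>(set Q))" "b \<inter> \<Union>(set Q) = {}" "finite (\<Union>(set Q))"
    using Cons.prems set_comps_distinct[OF Cons.prems(2)] by (auto simp: set_comps_Cons disjnt_def)
  have "e_comp (b # Q) = (\<Sum>R\<in>rooted b. \<Sum>r\<in>?S. scal (sgn_comp R) (basis_elt R) \<^bold>\<or> ?t Q r)"
    unfolding e_comp_Cons Cons.IH[OF b(4,2)] e_set_eq_sum vee_sum_left vee_sum_right
    by (rule sum.swap)
  also have "\<dots> = (\<Sum>R\<in>rooted b. \<Sum>r\<in>?S. ?t (b # Q) (r(b := R)))"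
  proof (intro sum.cong refl)
    fix R r assume R: "R \<in> rooted b" and r: "r \<in> ?S"
    have "concat (map r Q) \<in> set_comps (\<Union>(set Q))"
      using r b by (intro concat_rooted_in_set_comps) (auto intro: rooted_in_set_comps)
    then have "basis_elt R \<^bold>\<or> basis_elt (concat (map r Q)) = (basis_elt (R @ concat (map r Q)) :: 'f fpi)"
      using b(3) by (simp add: vee_basis set_comps_Union[of _ "\<Union>(set Q)"]
          set_comps_Union[OF rooted_in_set_comps[OF R]] del: set_concat)
    moreover have "map (r(b := R)) Q = map r Q" using b(1) by auto
    moreover have "(\<Prod>c\<in>set Q. sgn_comp ((r(b := R)) c)) = (\<Prod>c\<in>set Q. sgn_comp (r c) :: 'f)"
      using b(1) by (intro prod.cong) auto
    ultimately show "scal (sgn_comp R) (basis_elt R) \<^bold>\<or> ?t Q r = ?t (b # Q) (r(b := R))"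
      using b(1) by (simp add: vee_scal_left vee_scal_right)
  qed
  also have "\<dots> = (\<Sum>(R, r)\<in>rooted b \<times> ?S. ?t (b # Q) (r(b := R)))"
    by (simp add: sum.cartesian_product)
  also have "\<dots> = (\<Sum>r\<in>(\<lambda>(R, r). r(b := R)) ` (rooted b \<times> ?S). ?t (b # Q) r)"
    using inj_combinator[OF b(1), of rooted]
    by (subst sum.reindex) (simp_all add: case_prod_unfold)
  also have "(\<lambda>(R, r). r(b := R)) ` (rooted b \<times> ?S) = PiE (set (b # Q)) rooted"
    by (simp add: PiE_insert_eq)
  finally show ?case .
qed simp

lemma meet_cong_right:
  assumes "\<And>Y. Y \<in> set P \<Longrightarrow> nonempty (map ((\<inter>) Y) W) = nonempty (map ((\<inter>) Y) W')"
  shows "meet P W = meet P W'"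
  using assms by (induction P) (simp_all add: meet_Cons)

lemma finite_comp_block: "finite A \<Longrightarrow> Q \<in> set_comps A \<Longrightarrow> b \<in> set Q \<Longrightarrow> finite b"
  by (metis set_comps_subset finite_subset)

text \<open>
  A block \<open>b\<close> of \<open>Q\<close> that is not contained in a block of \<open>P\<close> meets a block \<open>X\<close> of \<open>P\<close> that does not
  contain \<open>Min b\<close>. Multiplication by \<open>P\<close> separates \<open>X \<inter> b\<close> from the rest of \<open>b\<close> anyway, so it does not see
  whether a term of \<open>e\<^sub>b\<close> has been split along \<open>C = X \<inter> b\<close>, and the terms cancel in pairs.
\<close>

lemma wedge_e_comp_not_refines:
  assumes "finite A" "P \<in> set_comps A" "Q \<in> set_comps A" "\<not> Q \<preceq> P"
  shows "basis_elt P \<^bold>\<and> e_comp Q = (0 :: 'f::field fpi)"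
proof -
  obtain b where b: "b \<in> set Q" "\<forall>Y\<in>set P. \<not> b \<subseteq> Y" using assms(4) by (auto simp: refines_def)
  then obtain Q1 Q2 where Q: "Q = Q1 @ b # Q2" by (meson split_list)
  have fin: "finite b" using finite_comp_block assms b by blast
  have bne: "b \<noteq> {}" using set_comps_nonempty assms b by blast
  have bA: "b \<subseteq> A" using set_comps_subset assms b by blast
  \<comment> \<open>\<open>Y\<close> is the block of \<open>P\<close> with \<open>Min b\<close>, and \<open>X\<close> another one that meets \<open>b\<close>.\<close>
  obtain Y where Y: "Y \<in> set P" "Min b \<in> Y"
    using set_comps_Union[OF assms(2)] bA Min_in[OF fin bne] by blast
  obtain a where a: "a \<in> b" "a \<notin> Y" using b Y by blast
  obtain X where X: "X \<in> set P" "a \<in> X" using set_comps_Union[OF assms(2)] bA a by blast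
  have XY: "X \<inter> Y = {}" using set_comps_disjoint[OF assms(2) X(1) Y(1)] X a by blast
  define C where "C = X \<inter> b"
  have C: "C \<subseteq> b" "C \<noteq> {}" "Min b \<notin> C" using X a XY Y by (auto simp: C_def)
  have disj: "\<Union>(set Q1) \<inter> b = {}" "(\<Union>(set Q1) \<union> b) \<inter> \<Union>(set Q2) = {}"
    and Q12: "Q1 \<in> set_comps (\<Union>(set Q1))" "Q2 \<in> set_comps (\<Union>(set Q2))"
    and A: "A = \<Union>(set Q1) \<union> b \<union> \<Union>(set Q2)"
    using assms(3) by (auto simp: Q set_comps_append set_comps_Cons disjnt_def)
  have base: "basis_elt P \<^bold>\<and> (basis_elt U \<^bold>\<or> e_set b \<^bold>\<or> basis_elt V) = (0 :: 'f fpi)"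
    if UV: "U \<in> set_comps (\<Union>(set Q1))" "V \<in> set_comps (\<Union>(set Q2))" for U V
  proof -
    have "basis_elt P \<^bold>\<and> (basis_elt U \<^bold>\<or> e_set b \<^bold>\<or> basis_elt V)
        = (\<Sum>R\<in>rooted b. scal (sgn_comp R) (basis_elt P \<^bold>\<and> (basis_elt U \<^bold>\<or> basis_elt R \<^bold>\<or> basis_elt V)) :: 'f fpi)"
      by (simp add: e_set_eq_sum vee_sum_right vee_sum_left wedge_sum_right vee_scal_right vee_scal_left
          wedge_scal_right)
    also have "\<dots> = (\<Sum>R\<in>rooted b. scal (sgn_comp R) (basis_elt (meet P (U @ R @ V))))"
    proof (intro sum.cong refl arg_cong2[of _ _ _ _ scal])
      fix R assume "R \<in> rooted b"
      then have R: "R \<in> set_comps b" by (rule rooted_in_set_comps)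
      have UR: "U @ R \<in> set_comps (\<Union>(set Q1) \<union> b)"
        using UV(1) R disj(1) by (rule set_comps_appendI)
      have URV: "(U @ R) @ V \<in> set_comps A"
        unfolding A using UR UV(2) disj(2) by (rule set_comps_appendI)
      have 1: "basis_elt U \<^bold>\<or> basis_elt R = (basis_elt (U @ R) :: 'f fpi)"
        using disj(1) set_comps_Union[OF UV(1)] set_comps_Union[OF R] by (simp add: vee_basis)
      have 2: "basis_elt (U @ R) \<^bold>\<or> basis_elt V = (basis_elt ((U @ R) @ V) :: 'f fpi)"
        using disj(2) set_comps_Union[OF UR] set_comps_Union[OF UV(2)]
        by (simp add: vee_basis del: set_append append_assoc)
      show "basis_elt P \<^bold>\<and> (basis_elt U \<^bold>\<or> basis_elt R \<^bold>\<or> basis_elt V) = (basis_elt (meet P (U @ R @ V)) :: 'f fpi)"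
        using wedge_basis_same[OF assms(2) URV] by (simp only: 1 2 append_assoc)
    qed
    also have "\<dots> = 0"
    proof (rule sum_rooted_cancel[OF fin C])
      fix R' Z R'' assume "R' @ Z # R'' \<in> rooted b"
      then have Z: "Z \<subseteq> b" using set_comps_subset[OF rooted_in_set_comps] by fastforce
      have "meet P (U @ (R' @ (Z - C) # (Z \<inter> C) # R'') @ V) = meet P (U @ (R' @ Z # R'') @ V)"
      proof (rule meet_cong_right)
        fix Y assume Y: "Y \<in> set P"
        have "Y \<inter> (Z - C) = {} \<and> Y \<inter> (Z \<inter> C) = Y \<inter> Z \<or> Y \<inter> (Z - C) = Y \<inter> Z \<and> Y \<inter> (Z \<inter> C) = {}"
          using Z set_comps_disjoint[OF assms(2) Y X(1)] unfolding C_def by (cases "Y = X") auto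
        then show "nonempty (map ((\<inter>) Y) (U @ (R' @ (Z - C) # (Z \<inter> C) # R'') @ V)) =
          nonempty (map ((\<inter>) Y) (U @ (R' @ Z # R'') @ V))"
          by (elim disjE conjE) simp_all
      qed
      then show "basis_elt (meet P (U @ (R' @ (Z - C) # (Z \<inter> C) # R'') @ V)) =
         (basis_elt (meet P (U @ (R' @ Z # R'') @ V)) :: 'f fpi)" by simp
    qed
    finally show ?thesis .
  qed
  have "basis_elt P \<^bold>\<and> (f \<^bold>\<or> e_set b \<^bold>\<or> g) = (0 :: 'f fpi)"
    if "f \<in> FPi_on (\<Union>(set Q1))" "g \<in> FPi_on (\<Union>(set Q2))" for f g
    using that(1)
  proof (induction f rule: FPi_on_induct)
    case U: (basis U)
    from that(2) show ?case
      by (induction g rule: FPi_on_induct)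
        (simp_all add: base[OF U] vee_add_right vee_scal_right wedge_add_right wedge_scal_right)
  qed (simp_all add: vee_add_left vee_scal_left wedge_add_right wedge_scal_right)
  from this[OF e_comp_in_FPi_on[OF Q12(1)] e_comp_in_FPi_on[OF Q12(2)]]
  show ?thesis by (simp add: Q e_comp_append e_comp_Cons vee_assoc)
qed

lemma refines_concat:
  assumes "Q \<preceq> P" "\<forall>b\<in>set Q. r b \<in> set_comps b"
  shows "concat (map r Q) \<preceq> P"
  unfolding refines_def
proof
  fix X assume "X \<in> set (concat (map r Q))"
  then obtain b where "b \<in> set Q" "X \<in> set (r b)" by auto
  moreover from this assms(2) have "X \<subseteq> b" by (metis set_comps_subset)
  moreover obtain Y where "Y \<in> set P" "b \<subseteq> Y"
    using assms(1) \<open>b \<in> set Q\<close> unfolding refines_def by blast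
  ultimately show "\<exists>Y\<in>set P. X \<subseteq> Y" by blast
qed

text \<open>
  All terms of \<open>e\<^sub>Q\<close> are finer than \<open>Q\<close>, hence than \<open>P\<close>, and sorting by the blocks of \<open>P\<close> moves the pieces
  of one block of \<open>Q\<close> together.
\<close>

lemma wedge_e_comp_refines:
  assumes "finite A" "P \<in> set_comps A" "Q \<in> set_comps A" "Q \<preceq> P"
  shows "basis_elt P \<^bold>\<and> e_comp Q = (e_comp (meet P Q) :: 'f::field fpi)"
proof -
  have "basis_elt P \<^bold>\<and> e_comp Q = (\<Sum>r\<in>PiE (set Q) rooted.
           scal (\<Prod>b\<in>set Q. sgn_comp (r b)) (basis_elt P \<^bold>\<and> basis_elt (concat (map r Q))) :: 'f fpi)"
    by (simp add: e_comp_expand[OF assms(1,3)] wedge_sum_right wedge_scal_right)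
  also have "\<dots> = (\<Sum>r\<in>PiE (set Q) rooted.
           scal (\<Prod>b\<in>set Q. sgn_comp (r b)) (basis_elt (concat (map r (meet P Q)))))"
  proof (intro sum.cong refl arg_cong2[of _ _ _ _ scal])
    fix r assume "r \<in> PiE (set Q) rooted"
    then have r: "\<forall>b\<in>set Q. r b \<in> set_comps b" by (auto intro: rooted_in_set_comps)
    have c: "concat (map r Q) \<in> set_comps A"
      using assms(3) r by (rule concat_rooted_in_set_comps)
    have "inside X (concat (map r R)) = concat (map r (inside X R))"
      if X: "X \<in> set P" and "set R \<subseteq> set Q" for X R
      using that(2)
    proof (induction R)
      case (Cons b R)
      then have b: "b \<in> set Q" by simp
      obtain Z where Z: "Z \<in> set P" "b \<subseteq> Z" using b assms(4) by (auto simp: refines_def)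
      have "inside X (r b) = (if b \<subseteq> X then r b else [])"
      proof (cases "b \<subseteq> X")
        case True
        then show ?thesis using set_comps_subset[of "r b" b] r b by (auto simp: filter_id_conv)
      next
        case False
        then have "X \<inter> b = {}" using Z set_comps_disjoint[OF assms(2) X Z(1)] by blast
        then have "\<not> Y \<subseteq> X" if "Y \<in> set (r b)" for Y
          using that r b set_comps_subset[of "r b" b Y] set_comps_nonempty[of "r b" b Y] by blast
        with False show ?thesis by (simp add: filter_empty_conv)
      qed
      with Cons show ?case by simp
    qed simp
    then have "meet P (concat (map r Q)) = concat (map (\<lambda>X. concat (map r (inside X Q))) P)"
      unfolding meet_eq_filter[OF assms(2) c refines_concat[OF assms(4) r]]
      by (intro arg_cong[of _ _ concat] map_cong) auto
    also have "\<dots> = concat (map r (meet P Q))"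
      unfolding meet_eq_filter[OF assms(2-4)] by (induction P) simp_all
    finally show "basis_elt P \<^bold>\<and> basis_elt (concat (map r Q)) = (basis_elt (concat (map r (meet P Q))) :: 'f fpi)"
      by (simp add: wedge_basis_same[OF assms(2) c])
  qed
  also have "\<dots> = e_comp (meet P Q)"
    using set_meet_refines[OF assms(2-4)]
    by (simp add: e_comp_expand[OF assms(1) meet_in_set_comps[OF assms(2,3)]])
  finally show ?thesis .
qed

lemma length_concat_rooted:
  assumes "Q \<in> set_comps A" "\<forall>b\<in>set Q. r b \<in> set_comps b"
  shows "length Q \<le> length (concat (map r Q))"
    and "length (concat (map r Q)) \<le> length Q \<Longrightarrow> b \<in> set Q \<Longrightarrow> r b = [b]"
proof -
  have ge: "length (r b) \<ge> 1" if "b \<in> set Q" for b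
    using that assms set_comps_nonempty[OF assms(1) that] by (cases "r b") auto
  have 1: "length R \<le> length (concat (map r R))" if "set R \<subseteq> set Q" for R
    using that
  proof (induction R)
    case (Cons b R)
    with ge[of b] show ?case by auto
  qed simp
  then show "length Q \<le> length (concat (map r Q))" by blast
  assume le: "length (concat (map r Q)) \<le> length Q" and b: "b \<in> set Q"
  then obtain Q1 Q2 where Q: "Q = Q1 @ b # Q2" by (meson split_list)
  have "length Q1 \<le> length (concat (map r Q1))" "length Q2 \<le> length (concat (map r Q2))"
    by (rule 1, simp add: Q subset_iff)+
  then have "length (r b) \<le> 1" using le by (simp add: Q)
  with ge[OF b] obtain X where "r b = [X]" by (cases "r b") auto
  then show "r b = [b]" using assms(2) b by fastforce
qed

text \<open>
  The expansion of \<open>e\<^sub>Q\<close> is \<open>Q\<close> plus strictly longer set compositions.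
\<close>

lemma lookup_e_comp:
  assumes "finite A" "Q \<in> set_comps A" "length W \<le> length Q"
  shows "coeff (e_comp Q :: 'f::field fpi) W = (if W = Q then 1 else 0)"
proof -
  let ?t = "\<lambda>r. (\<Prod>b\<in>set Q. sgn_comp (r b)) * (if concat (map r Q) = W then 1 else 0) :: 'f"
  let ?r0 = "\<lambda>b\<in>set Q. [b]"
  have fin: "finite (PiE (set Q) rooted)"
  proof (intro finite_PiE)
    show "finite (rooted b)" if "b \<in> set Q" for b
      using finite_set_comps[OF finite_comp_block[OF assms(1,2) that]] by (simp add: rooted_def)
  qed simp
  have r0: "?r0 \<in> PiE (set Q) rooted"
    using set_comps_nonempty[OF assms(2)] finite_comp_block[OF assms(1,2)] Min_in
    by (auto simp: rooted_def)
  have "coeff (e_comp Q :: 'f fpi) W = (\<Sum>r\<in>PiE (set Q) rooted. ?t r)"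
    by (simp add: e_comp_expand[OF assms(1,2)] lookup_sum lookup_single when_def)
  also have "\<dots> = (\<Sum>r\<in>{?r0}. ?t r)"
  proof (rule sum.mono_neutral_right[OF fin])
    show "\<forall>r\<in>PiE (set Q) rooted - {?r0}. ?t r = 0"
    proof
      fix r assume r: "r \<in> PiE (set Q) rooted - {?r0}"
      then have rc: "\<forall>b\<in>set Q. r b \<in> set_comps b" by (auto intro: rooted_in_set_comps)
      have "concat (map r Q) \<noteq> W"
      proof
        assume "concat (map r Q) = W"
        with assms(3) have "\<forall>b\<in>set Q. r b = [b]"
          using length_concat_rooted(2)[OF assms(2) rc] by blast
        with r have "r = ?r0" by (intro PiE_ext[of r "set Q" rooted]) (use r0 in auto)
        with r show False by simp
      qed
      then show "?t r = 0" by simp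
    qed
  qed (use r0 in auto)
  also have "\<dots> = (if W = Q then 1 else 0)"
  proof -
    have "concat (map ?r0 Q) = Q" "(\<Prod>b\<in>set Q. sgn_comp (?r0 b)) = (1 :: 'f)"
    proof -
      have "map ?r0 Q = map (\<lambda>b. [b]) Q" by (rule map_cong) auto
      then show "concat (map ?r0 Q) = Q" by (simp only: concat_map_singleton list.map_ident)
      show "(\<Prod>b\<in>set Q. sgn_comp (?r0 b)) = (1 :: 'f)"
        by (intro prod.neutral) (simp add: sgn_comp_def)
    qed
    then show ?thesis by auto
  qed
  finally show ?thesis .
qed


section \<open>Products of the elements \<open>e_P\<close>\<close>

lemma set_comps_restrict:
  assumes "R \<in> set_comps A" "D \<subseteq> A" "\<And>Y. Y \<in> set R \<Longrightarrow> Y \<subseteq> D \<or> Y \<inter> D = {}"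
  shows "inside D R \<in> set_comps D"
proof -
  have "D \<subseteq> \<Union>(set (inside D R))"
  proof
    fix a assume "a \<in> D"
    moreover from this obtain Y where "Y \<in> set R" "a \<in> Y"
      using assms(2) set_comps_Union[OF assms(1)] by blast
    ultimately show "a \<in> \<Union>(set (inside D R))" using assms(3)[of Y] by auto
  qed
  moreover have "\<Union>(set (inside D R)) \<subseteq> D" by auto
  ultimately show ?thesis using assms(1) unfolding set_comps_iff by auto
qed

lemma set_comps_filter:
  assumes "R \<in> set_comps A" "P \<in> set_comps A" "R \<preceq> P" "X \<in> set P"
  shows "inside X R \<in> set_comps X"
proof (rule set_comps_restrict[OF assms(1) set_comps_subset[OF assms(2,4)]])
  fix Y assume "Y \<in> set R"
  then obtain Z where "Z \<in> set P" "Y \<subseteq> Z" using assms(3) by (auto simp: refines_def)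
  then show "Y \<subseteq> X \<or> Y \<inter> X = {}" using set_comps_disjoint[OF assms(2) _ assms(4), of Z] by blast
qed

lemma meet_filter_right:
  assumes "\<Union>(set P) \<subseteq> B" "\<And>Y. Y \<in> set R \<Longrightarrow> \<not> Y \<subseteq> B \<Longrightarrow> Y \<inter> B = {}"
  shows "meet P (inside B R) = meet P R"
proof (rule meet_cong_right)
  fix X assume "X \<in> set P"
  then have "X \<subseteq> B" using assms(1) by auto
  then show "nonempty (map ((\<inter>) X) (inside B R)) = nonempty (map ((\<inter>) X) R)"
    using assms(2)
  proof (induction R)
    case (Cons Y R)
    have "X \<inter> Y = {}" if "\<not> Y \<subseteq> B" using Cons.prems(1) Cons.prems(2)[of Y] that by auto
    with Cons show ?case by auto
  qed simp
qed

text \<open>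
  Multiplication by a set composition of the form \<open>S @ T\<close> puts the blocks inside \<open>B\<close> first, arranged by
  \<open>S\<close>, and then those inside \<open>C\<close>, arranged by \<open>T\<close>: the two parts do not interact.
\<close>

lemma vee_wedge_e_comp:
  fixes f g :: "'f::field fpi"
  assumes "finite (B \<union> C)" "B \<inter> C = {}" "f \<in> FPi_on B" "g \<in> FPi_on C"
    and R: "R \<in> set_comps (B \<union> C)" "\<And>Y. Y \<in> set R \<Longrightarrow> Y \<subseteq> B \<or> Y \<subseteq> C"
  shows "(f \<^bold>\<or> g) \<^bold>\<and> e_comp R =
    (f \<^bold>\<and> e_comp (inside B R)) \<^bold>\<or> (g \<^bold>\<and> e_comp (inside C R))"
proof -
  let ?RB = "inside B R" and ?RC = "inside C R"
  have ne: "Y \<noteq> {}" if "Y \<in> set R" for Y using set_comps_nonempty R(1) that by blast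
  have RB: "?RB \<in> set_comps B" and RC: "?RC \<in> set_comps C"
    using R(2) assms(2) by (auto intro!: set_comps_restrict[OF R(1)])
  have fin: "finite B" "finite C" using assms(1) by auto
  have base: "(basis_elt S \<^bold>\<or> basis_elt T) \<^bold>\<and> e_comp R =
      ((basis_elt S \<^bold>\<and> e_comp ?RB) \<^bold>\<or> (basis_elt T \<^bold>\<and> e_comp ?RC) :: 'f fpi)"
    if S: "S \<in> set_comps B" and T: "T \<in> set_comps C" for S T
  proof -
    have ST: "S @ T \<in> set_comps (B \<union> C)" using S T assms(2) by (rule set_comps_appendI)
    have vee: "basis_elt S \<^bold>\<or> basis_elt T = (basis_elt (S @ T) :: 'f fpi)"
      using assms(2) by (simp add: vee_basis set_comps_Union[OF S] set_comps_Union[OF T])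
    have ref: "R \<preceq> S @ T \<longleftrightarrow> ?RB \<preceq> S \<and> ?RC \<preceq> T"
    proof
      assume *: "R \<preceq> S @ T"
      have "\<exists>X\<in>set S. Y \<subseteq> X" if Y: "Y \<in> set R" "Y \<subseteq> B" for Y
      proof -
        obtain X where "X \<in> set S \<union> set T" "Y \<subseteq> X"
          using * Y(1) unfolding refines_def set_append by blast
        moreover have "X \<notin> set T"
          using set_comps_subset[OF T, of X] calculation(2) Y ne[OF Y(1)] assms(2) by blast
        ultimately show ?thesis by blast
      qed
      moreover have "\<exists>X\<in>set T. Y \<subseteq> X" if Y: "Y \<in> set R" "Y \<subseteq> C" for Y
      proof -
        obtain X where "X \<in> set S \<union> set T" "Y \<subseteq> X"
          using * Y(1) unfolding refines_def set_append by blast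
        moreover have "X \<notin> set S"
          using set_comps_subset[OF S, of X] calculation(2) Y ne[OF Y(1)] assms(2) by blast
        ultimately show ?thesis by blast
      qed
      ultimately show "?RB \<preceq> S \<and> ?RC \<preceq> T" by (auto simp: refines_def)
    next
      assume *: "?RB \<preceq> S \<and> ?RC \<preceq> T"
      show "R \<preceq> S @ T"
        unfolding refines_def
      proof
        fix Y assume "Y \<in> set R"
        with R(2)[of Y] * show "\<exists>X\<in>set (S @ T). Y \<subseteq> X"
          unfolding refines_def set_append set_filter by blast
      qed
    qed
    show ?thesis
    proof (cases "R \<preceq> S @ T")
      case True
      have "meet (S @ T) R = meet S ?RB @ meet T ?RC"
      proof -
        have "meet S ?RB = meet S R"
          using R(2) assms(2) by (intro meet_filter_right) (auto simp: set_comps_Union[OF S])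
        moreover have "meet T ?RC = meet T R"
          using R(2) assms(2) by (intro meet_filter_right) (auto simp: set_comps_Union[OF T])
        ultimately show ?thesis by (simp add: meet_append_left)
      qed
      with True ref show ?thesis
        by (simp add: vee wedge_e_comp_refines[OF assms(1) ST R(1)] wedge_e_comp_refines[OF fin(1) S RB]
            wedge_e_comp_refines[OF fin(2) T RC] e_comp_append)
    next
      case False
      with ref have "\<not> ?RB \<preceq> S \<or> \<not> ?RC \<preceq> T" by blast
      with False show ?thesis
        using wedge_e_comp_not_refines[OF fin(1) S RB, where 'f='f]
          wedge_e_comp_not_refines[OF fin(2) T RC, where 'f='f]
        by (auto simp: vee wedge_e_comp_not_refines[OF assms(1) ST R(1)])
    qed
  qed
  from assms(3) show ?thesis
  proof (induction f rule: FPi_on_induct)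
    case S: (basis S)
    from assms(4) show ?case
      by (induction g rule: FPi_on_induct)
        (simp_all add: base[OF S] vee_add_right vee_scal_right wedge_add_left wedge_scal_left)
  qed (simp_all add: vee_add_left vee_scal_left wedge_add_left wedge_scal_left)
qed

lemma filter_filter_subset:
  "X \<subseteq> C \<Longrightarrow> inside X (inside C R) = inside X R"
  by (auto intro!: filter_cong)

lemma e_comp_wedge_factor:
  assumes "finite A" "P \<in> set_comps A" "R \<in> set_comps A" "R \<preceq> P"
  shows "(e_comp P \<^bold>\<and> e_comp R :: 'f::field fpi)
    = vee_list (map (\<lambda>X. e_set X \<^bold>\<and> e_comp (inside X R)) P)"
  using assms
proof (induction P arbitrary: A R)
  case Nil
  then have "R = []" by simp
  then show ?case by (simp add: wedge_basis)
next
  case (Cons X P)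
  let ?C = "\<Union>(set P)"
  have *: "P \<in> set_comps ?C" "X \<inter> ?C = {}" "A = X \<union> ?C"
    using Cons.prems(2) by (auto simp: set_comps_Cons disjnt_def)
  have R: "Y \<subseteq> X \<or> Y \<subseteq> ?C" if "Y \<in> set R" for Y
    using that Cons.prems(4) by (auto simp: refines_def)
  let ?RC = "inside ?C R"
  have RC: "?RC \<in> set_comps ?C"
    using R *(2,3) by (intro set_comps_restrict[OF Cons.prems(3)]) auto
  have ref: "?RC \<preceq> P"
    unfolding refines_def
  proof
    fix Y assume Y: "Y \<in> set ?RC"
    then have "Y \<in> set R" by simp
    then obtain Z where Z: "Z \<in> set (X # P)" "Y \<subseteq> Z" using Cons.prems(4) unfolding refines_def by blast
    moreover have "Z \<noteq> X" using Z(2) Y *(2) set_comps_nonempty[OF RC Y] by auto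
    ultimately show "\<exists>Z\<in>set P. Y \<subseteq> Z" by auto
  qed
  have "e_comp (X # P) \<^bold>\<and> e_comp R = (e_set X \<^bold>\<or> e_comp P) \<^bold>\<and> (e_comp R :: 'f fpi)"
    by (simp add: e_comp_Cons)
  also have "\<dots> = (e_set X \<^bold>\<and> e_comp (inside X R)) \<^bold>\<or> (e_comp P \<^bold>\<and> e_comp ?RC)"
    using * Cons.prems R by (intro vee_wedge_e_comp e_set_in_FPi_on e_comp_in_FPi_on) simp_all
  also have "e_comp P \<^bold>\<and> e_comp ?RC
      = (vee_list (map (\<lambda>X. e_set X \<^bold>\<and> e_comp (inside X ?RC)) P) :: 'f fpi)"
    using * Cons.prems(1) RC ref by (intro Cons.IH) simp_all
  also have "map (\<lambda>X. e_set X \<^bold>\<and> e_comp (inside X ?RC)) P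
      = (map (\<lambda>X. e_set X \<^bold>\<and> e_comp (inside X R)) P :: 'f fpi list)"
    by (intro map_cong refl) (subst filter_filter_subset, auto)
  finally show ?case by simp
qed

text \<open>
  All terms of \<open>e\<^sub>P\<close> are finer than \<open>P\<close>, so \<open>R\<close> refines none of them.
\<close>

lemma e_comp_wedge_not_refines:
  assumes "finite A" "P \<in> set_comps A" "R \<in> set_comps A" "\<not> R \<preceq> P"
  shows "(e_comp P \<^bold>\<and> e_comp R :: 'f::field fpi) = 0"
proof -
  have "basis_elt (concat (map r P)) \<^bold>\<and> e_comp R = (0 :: 'f fpi)" if "r \<in> PiE (set P) rooted" for r
  proof -
    from that have r: "\<forall>b\<in>set P. r b \<in> set_comps b" by (auto intro: rooted_in_set_comps)
    have "concat (map r P) \<in> set_comps A" using assms(2) r by (rule concat_rooted_in_set_comps)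
    moreover have "\<not> R \<preceq> concat (map r P)"
      using assms(4) refines_trans[OF _ refines_concat[OF refines_refl r]] by blast
    ultimately show ?thesis using wedge_e_comp_not_refines assms by blast
  qed
  then show ?thesis
    by (simp add: e_comp_expand[OF assms(1,2)] wedge_sum_left wedge_scal_left)
qed


section \<open>The Dynkin mapping\<close>

lemma vee_disjoint_left:
  fixes g :: "'f::field fpi"
  assumes "\<And>W. W \<in> terms g \<Longrightarrow> a \<inter> \<Union>(set W) = {}"
  shows "basis_elt [a] \<^bold>\<or> g = lin_ext (\<lambda>W. basis_elt (a # W)) g"
    and "g \<^bold>\<or> basis_elt [a] = lin_ext (\<lambda>W. basis_elt (W @ [a])) g"
proof -
  have "terms g \<subseteq> {W. a \<inter> \<Union>(set W) = {}}" using assms by blast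
  then show "basis_elt [a] \<^bold>\<or> g = lin_ext (\<lambda>W. basis_elt (a # W)) g"
    by (induction g rule: supported_induct)
      (simp_all add: vee_basis vee_add_right vee_scal_right lin_ext_add lin_ext_scal)
  have "terms g \<subseteq> {W. a \<inter> \<Union>(set W) = {}}" using assms by blast
  then show "g \<^bold>\<or> basis_elt [a] = lin_ext (\<lambda>W. basis_elt (W @ [a])) g"
    by (induction g rule: supported_induct)
      (auto simp: vee_basis vee_add_left vee_scal_left lin_ext_add lin_ext_scal Int_commute)
qed

lemma lin_ext_fun_diff: "lin_ext (\<lambda>x. b x - c x) f = lin_ext b f - lin_ext c f"
  unfolding lin_ext_def by (simp add: fpi.scale_right_diff_distrib sum_subtractf)

lemma keys_lin_ext: "terms (lin_ext b f) \<subseteq> (\<Union>x\<in>terms f. terms (b x))"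
proof
  fix y assume "y \<in> terms (lin_ext b f)"
  then have "(\<Sum>x\<in>terms f. coeff f x * coeff (b x) y) \<noteq> 0"
    by (simp add: in_keys_iff lin_ext_def lookup_sum)
  then obtain x where "x \<in> terms f" "coeff (b x) y \<noteq> 0"
    by (metis (mono_tags, lifting) mult_zero_right sum.neutral)
  then show "y \<in> (\<Union>x\<in>terms f. terms (b x))" by (auto simp: in_keys_iff)
qed

text \<open>
  The two claims are proved together: the recursion for \<open>R\<close> needs that the blocks occurring in the inner bracket
  are disjoint from the first one, which is what the statement about keys provides.
\<close>

lemma dynkin_comp_keys_and_unfold:
  assumes "sorted_wrt disjnt R" "R \<noteq> []"
  shows "terms (dynkin_comp R :: 'f::field fpi) \<subseteq> {W. mset W = mset R}
    \<and> (tl R \<noteq> [] \<longrightarrow> (dynkin_comp R :: 'f fpi)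
         = lin_ext (\<lambda>W. basis_elt (hd R # W) - basis_elt (W @ [hd R])) (dynkin_comp (tl R)))"
  using assms
proof (induction R rule: dynkin_comp.induct)
  case (3 B C Q)
  let ?g = "dynkin_comp (C # Q) :: 'f fpi"
  have IH: "terms ?g \<subseteq> {W. mset W = mset (C # Q)}"
    using 3 by simp
  have disj: "B \<inter> \<Union>(set W) = {}" if "W \<in> terms ?g" for W
  proof -
    have "set W = set (C # Q)" using IH that mset_eq_setD by blast
    then show ?thesis using 3(2) by (auto simp: disjnt_def)
  qed
  have eq: "dynkin_comp (B # C # Q) = lin_ext (\<lambda>W. basis_elt (B # W) - basis_elt (W @ [B])) ?g"
    using vee_disjoint_left[of ?g B] disj by (simp add: circ_def lin_ext_fun_diff)
  have "mset V = mset (B # C # Q)" if "V \<in> terms (dynkin_comp (B # C # Q) :: 'f fpi)" for V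
  proof -
    from that obtain W where W: "W \<in> terms ?g"
      "V \<in> terms (basis_elt (B # W) - basis_elt (W @ [B]) :: 'f fpi)"
      using subsetD[OF keys_lin_ext, of V] unfolding eq by auto
    then have "V = B # W \<or> V = W @ [B]"
      by (auto simp: in_keys_iff lookup_minus lookup_single when_def split: if_splits)
    moreover have "mset W = mset (C # Q)" using IH W(1) by blast
    ultimately show ?thesis by auto
  qed
  with eq show ?case by auto
qed auto

lemmas keys_dynkin_comp = dynkin_comp_keys_and_unfold[THEN conjunct1]

lemma dynkin_comp_Cons:
  assumes "sorted_wrt disjnt (a # R)" "R \<noteq> []"
  shows "(dynkin_comp (a # R) :: 'f::field fpi) = lin_ext (\<lambda>W. basis_elt (a # W) - basis_elt (W @ [a])) (dynkin_comp R)"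
  using dynkin_comp_keys_and_unfold[of "a # R", where 'f='f] assms by simp

lemma lookup_lin_ext:
  "coeff (lin_ext b f) y = (\<Sum>x\<in>terms f. coeff f x * coeff (b x) y)"
  by (simp add: lin_ext_def lookup_sum)

text \<open>
  In a right-normed bracket each letter but the innermost one is put at the left or at the right of what is
  already there. The innermost letter stays last only if every other letter goes to the left.
\<close>

lemma lookup_dynkin_comp_last:
  assumes "p @ [d] \<in> set_comps B" "W \<noteq> []" "last W = d"
  shows "coeff (dynkin_comp (p @ [d]) :: 'f::field fpi) W = (if W = p @ [d] then 1 else 0)"
  using assms
proof (induction p arbitrary: W B)
  case Nil
  then show ?case by (auto simp: lookup_single when_def)
next
  case (Cons a p)
  let ?g = "dynkin_comp (p @ [d]) :: 'f fpi"
  have s: "sorted_wrt disjnt (a # p @ [d])" using Cons.prems by (simp add: set_comps_def)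
  have ad: "a \<noteq> d" using set_comps_distinct[OF Cons.prems(1)] by auto
  have keys: "terms ?g \<subseteq> {W. mset W = mset (p @ [d])}"
    using s by (intro keys_dynkin_comp) auto
  obtain w W' where W: "W = w # W'" using Cons.prems(2) by (cases W) auto
  have "coeff (dynkin_comp ((a # p) @ [d]) :: 'f fpi) W =
     (\<Sum>x\<in>terms ?g. coeff ?g x *
        coeff (basis_elt (a # x) - basis_elt (x @ [a])) W)"
    using dynkin_comp_Cons[OF s, where 'f='f] by (simp add: lookup_lin_ext)
  also have "\<dots> = (\<Sum>x\<in>terms ?g. if x = W' then (if a = w then coeff ?g x else 0) else 0)"
  proof (intro sum.cong refl)
    fix x
    have "x @ [a] \<noteq> W" using ad Cons.prems(3) by auto
    then show "coeff ?g x * coeff (basis_elt (a # x) - basis_elt (x @ [a])) W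
       = (if x = W' then (if a = w then coeff ?g x else 0) else 0)"
      by (auto simp: lookup_minus lookup_single when_def W)
  qed
  also have "\<dots> = (if a = w then coeff ?g W' else 0)"
    by (auto simp: in_keys_iff)
  also have "\<dots> = (if W = (a # p) @ [d] then 1 else 0)"
  proof (cases "W' = []")
    case True
    with W Cons.prems(3) ad show ?thesis by auto
  next
    case False
    have "p @ [d] \<in> set_comps (\<Union>(set (p @ [d])))"
      using Cons.prems(1) set_comps_Cons[of a "p @ [d]"] by simp
    from Cons.IH[OF this False] W Cons.prems(3) False show ?thesis by auto
  qed
  finally show ?case .
qed

text \<open>
  Separating the letters with property \<open>p\<close> from the others kills a bracket: in terms of the unshuffle
  coproduct, Lie elements are primitive. If both kinds occur in the inner bracket \<open>g\<close>, the image of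
  \<open>a \<or> g - g \<or> a\<close> is obtained from the image \<open>0\<close> of \<open>g\<close> by inserting \<open>a\<close>. Otherwise \<open>a\<close> is the only letter
  of its kind, and it commutes with \<open>g\<close> after the separation.
\<close>

lemma unshuffle_dynkin_comp:
  assumes "sorted_wrt disjnt R" "\<exists>X\<in>set R. p X" "\<exists>X\<in>set R. \<not> p X"
  shows "lin_ext (\<lambda>W. basis_elt (filter p W @ filter (\<lambda>X. \<not> p X) W)) (dynkin_comp R) = (0 :: 'f::field fpi)"
  using assms
proof (induction R)
  case (Cons a R)
  let ?g = "dynkin_comp R :: 'f fpi"
  define u where "u W = filter p W @ filter (\<lambda>X. \<not> p X) W" for W :: scomp
  have "R \<noteq> []" using Cons.prems by auto
  have dyn: "(dynkin_comp (a # R) :: 'f fpi) = lin_ext (\<lambda>W. basis_elt (a # W) - basis_elt (W @ [a])) ?g"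
    using Cons.prems \<open>R \<noteq> []\<close> by (intro dynkin_comp_Cons)
  have expand: "lin_ext (\<lambda>W. basis_elt (u W)) (dynkin_comp (a # R)) =
      (lin_ext (\<lambda>W. basis_elt (u (a # W)) - basis_elt (u (W @ [a]))) ?g :: 'f fpi)"
    unfolding dyn lin_ext_lin_ext by (simp add: lin_ext_diff)
  have keys: "set W = set R" if "W \<in> terms ?g" for W
    using keys_dynkin_comp[of R, where 'f='f] that Cons.prems \<open>R \<noteq> []\<close> by (auto dest: mset_eq_setD)
  show ?case
  proof (cases "(\<exists>X\<in>set R. p X) \<and> (\<exists>X\<in>set R. \<not> p X)")
    case True
    then have IH: "lin_ext (\<lambda>W. basis_elt (u W)) ?g = 0"
      using Cons unfolding u_def by simp
    have via: "lin_ext (\<lambda>W. basis_elt (h (u W))) ?g = (0 :: 'f fpi)" for h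
    proof -
      have "lin_ext (\<lambda>W. basis_elt (h (u W))) ?g
          = lin_ext (\<lambda>V. basis_elt (h V)) (lin_ext (\<lambda>W. basis_elt (u W)) ?g)"
        by (simp add: lin_ext_lin_ext)
      with IH show ?thesis by simp
    qed
    \<comment> \<open>Where \<open>a\<close> ends up after the separation can be described in terms of \<open>u W\<close>, so \<open>via\<close> applies.\<close>
    define ins where "ins V = filter p V @ a # filter (\<lambda>X. \<not> p X) V" for V
    have ff: "filter p (u W) = filter p W" "filter (\<lambda>X. \<not> p X) (u W) = filter (\<lambda>X. \<not> p X) W" for W
      by (auto simp: u_def filter_empty_conv)
    have "u (a # W) = (if p a then a # u W else ins (u W))" "u (W @ [a]) = (if p a then ins (u W) else u W @ [a])" for W
      unfolding ins_def ff by (simp_all add: u_def)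
    then have "lin_ext (\<lambda>W. basis_elt (u W)) (dynkin_comp (a # R)) = (0 :: 'f fpi)"
      unfolding expand lin_ext_fun_diff
      using via[of "\<lambda>V. a # V"] via[of ins] via[of "\<lambda>V. V @ [a]"] by (cases "p a") simp_all
    then show ?thesis unfolding u_def .
  next
    case False
    have "u (a # W) = u (W @ [a])" if "W \<in> terms ?g" for W
    proof -
      have "(p a \<and> (\<forall>X\<in>set W. \<not> p X)) \<or> (\<not> p a \<and> (\<forall>X\<in>set W. p X))"
        using False Cons.prems(2,3) keys[OF that] by auto
      then show ?thesis by (auto simp: u_def filter_empty_conv filter_id_conv)
    qed
    then have "lin_ext (\<lambda>W. basis_elt (u W)) (dynkin_comp (a # R)) = (lin_ext (\<lambda>W. 0) ?g :: 'f fpi)"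
      unfolding expand by (intro lin_ext_cong) simp
    then show ?thesis unfolding u_def by simp
  qed
qed simp

text \<open>
  Multiplication by \<open>T = (X, \<dots>)\<close> factors through separating the blocks inside \<open>X\<close> from the others,
  and both kinds occur because \<open>T\<close> has at least two blocks.
\<close>

lemma wedge_e_lin_dynkin_comp:
  assumes "finite B" "T \<in> set_comps B" "R \<in> set_comps B" "length T \<ge> 2"
  shows "basis_elt T \<^bold>\<and> e_lin (dynkin_comp R) = (0 :: 'f::field fpi)"
proof -
  have "R \<noteq> []" using assms by auto
  have sorted: "sorted_wrt disjnt R" using assms(3) by (simp add: set_comps_def)
  have keys: "mset W = mset R \<and> set W = set R \<and> W \<in> set_comps B"
    if "W \<in> terms (dynkin_comp R :: 'f fpi)" for W
  proof -
    have "mset W = mset R"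
      using keys_dynkin_comp[OF sorted \<open>R \<noteq> []\<close>, where 'f='f] that by blast
    then show ?thesis using set_comps_perm[OF assms(3)] mset_eq_setD by blast
  qed
  have lhs: "basis_elt T \<^bold>\<and> e_lin (dynkin_comp R) = (lin_ext (\<lambda>W. basis_elt T \<^bold>\<and> e_comp W) (dynkin_comp R) :: 'f fpi)"
    by (simp add: e_lin_def wedge_lin_ext_right)
  show ?thesis
  proof (cases "R \<preceq> T")
    case False
    have "lin_ext (\<lambda>W. basis_elt T \<^bold>\<and> e_comp W) (dynkin_comp R) = (lin_ext (\<lambda>W. 0) (dynkin_comp R) :: 'f fpi)"
    proof (rule lin_ext_cong)
      fix W assume W: "W \<in> terms (dynkin_comp R :: 'f fpi)"
      then have "\<not> W \<preceq> T" using False keys[OF W] by (simp add: refines_def)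
      then show "basis_elt T \<^bold>\<and> e_comp W = (0 :: 'f fpi)"
        using wedge_e_comp_not_refines[OF assms(1,2)] keys[OF W] by blast
    qed
    then show ?thesis unfolding lhs by simp
  next
    case True
    obtain X T' where T: "T = X # T'" "T' \<noteq> []" using assms(4) by (cases T; cases "tl T") auto
    let ?p = "\<lambda>Y. Y \<subseteq> X"
    define u where "u W = filter ?p W @ filter (\<lambda>Y. \<not> ?p Y) W" for W :: scomp
    have notin: "\<not> Y \<subseteq> X" if "Y \<subseteq> Z" "Z \<in> set T'" "Y \<noteq> {}" for Y Z
    proof -
      have "Z \<noteq> X" using set_comps_distinct[OF assms(2)] that(2) T by auto
      then have "Z \<inter> X = {}" using set_comps_disjoint[OF assms(2), of Z X] that(2) T by auto
      then show ?thesis using that by blast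
    qed
    have block: "\<exists>Y\<in>set R. Y \<subseteq> Z" if Z: "Z \<in> set T" for Z
    proof -
      obtain a where a: "a \<in> Z" using set_comps_nonempty[OF assms(2) Z] by blast
      obtain Y where Y: "Y \<in> set R" "a \<in> Y"
        using a set_comps_subset[OF assms(2) Z] set_comps_Union[OF assms(3)] by blast
      obtain Z' where Z': "Z' \<in> set T" "Y \<subseteq> Z'" using True Y by (auto simp: refines_def)
      then have "Z' = Z" using set_comps_disjoint[OF assms(2) Z'(1) Z] a Y by blast
      with Y Z' show ?thesis by blast
    qed
    have 1: "\<exists>Y\<in>set R. Y \<subseteq> X" using block[of X] T by simp
    have 2: "\<exists>Y\<in>set R. \<not> Y \<subseteq> X"
    proof -
      have hd: "hd T' \<in> set T'" using T(2) by simp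
      then obtain Y where Y: "Y \<in> set R" "Y \<subseteq> hd T'" using block[of "hd T'"] T by auto
      then show ?thesis using notin[OF Y(2) hd set_comps_nonempty[OF assms(3) Y(1)]] by blast
    qed
    have "lin_ext (\<lambda>W. basis_elt T \<^bold>\<and> e_comp W) (dynkin_comp R) = (lin_ext (\<lambda>W. e_comp (meet T (u W))) (dynkin_comp R) :: 'f fpi)"
    proof (rule lin_ext_cong)
      fix W assume "W \<in> terms (dynkin_comp R :: 'f fpi)"
      note W = keys[OF this]
      have "meet T (u W) = meet T W"
      proof -
        have "mset (u W) = mset W" by (simp add: u_def union_filter_mset_complement)
        then have uW: "u W \<in> set_comps B" using W set_comps_perm by blast
        have ref: "W \<preceq> T" "u W \<preceq> T" using True W by (auto simp: refines_def u_def)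
        have "inside Z (u W) = inside Z W" if "Z \<in> set T" for Z
        proof (cases "Z = X")
          case True
          then show ?thesis by (simp add: u_def)
        next
          case False
          with that T have "Z \<in> set T'" by simp
          then have "\<not> Y \<subseteq> X" if "Y \<in> set W" "Y \<subseteq> Z" for Y
            using notin[of Y Z] that set_comps_nonempty[of W B Y] W by blast
          then have a: "inside Z (inside X W) = []"
            and b: "inside Z (filter (\<lambda>Y. \<not> Y \<subseteq> X) W) = inside Z W"
            by (auto simp: filter_empty_conv intro!: filter_cong)
          show ?thesis by (simp only: u_def filter_append a b append_Nil)
        qed
        then show ?thesis
          unfolding meet_eq_filter[OF assms(2) uW ref(2)] meet_eq_filter[OF assms(2) conjunct2[OF conjunct2[OF W]] ref(1)]
          by (intro arg_cong[of _ _ concat] map_cong) auto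
      qed
      moreover have "W \<preceq> T" using True W by (simp add: refines_def)
      ultimately show "basis_elt T \<^bold>\<and> e_comp W = (e_comp (meet T (u W)) :: 'f fpi)"
        using W by (simp add: wedge_e_comp_refines[OF assms(1,2)])
    qed
    also have "\<dots> = lin_ext (\<lambda>V. e_comp (meet T V)) (lin_ext (\<lambda>W. basis_elt (u W)) (dynkin_comp R))"
      by (simp add: lin_ext_lin_ext)
    also have "lin_ext (\<lambda>W. basis_elt (u W)) (dynkin_comp R) = (0 :: 'f fpi)"
      unfolding u_def using sorted 1 2 by (rule unshuffle_dynkin_comp)
    finally show ?thesis using lhs by simp
  qed
qed


section \<open>The product \<open>e_B \<and> e_R\<close> for a single block\<close>

text \<open>
  Let \<open>C\<close> be the last block of \<open>R\<close>. If \<open>T\<close> is coarser than \<open>R\<close> and \<open>C\<close> lies in a larger block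
  of \<open>T\<close>, then \<open>C\<close> is last among the blocks of \<open>R\<close> collected there. Splitting it off therefore changes
  \<open>T\<close> but not \<open>T \<and> R\<close>, and the involution applies.
\<close>

lemma e_set_wedge_not_dag:
  assumes "finite B" "R \<in> set_comps B" "R \<noteq> []" "Min B \<notin> last R"
  shows "e_set B \<^bold>\<and> e_comp R = (0 :: 'f::field fpi)"
proof -
  obtain R0 C where R: "R = R0 @ [C]" using assms(3) by (meson rev_exhaust)
  have "C \<in> set R" by (simp add: R)
  then have C: "C \<subseteq> B" "C \<noteq> {}" "Min B \<notin> C"
    using set_comps_subset[OF assms(2)] set_comps_nonempty[OF assms(2)] assms(4) by (simp_all add: R)
  have disj: "Z \<inter> C = {}" "Z \<noteq> {}" if "Z \<in> set R0" for Z
    using set_comps_disjoint[OF assms(2), of Z C] set_comps_distinct[OF assms(2)]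
      set_comps_nonempty[OF assms(2), of Z] R that by auto
  have "e_set B \<^bold>\<and> e_comp R = (\<Sum>T\<in>rooted B. scal (sgn_comp T) (basis_elt T \<^bold>\<and> e_comp R) :: 'f fpi)"
    by (simp add: e_set_eq_sum wedge_sum_left wedge_scal_left)
  also have "\<dots> = 0"
  proof (rule sum_rooted_cancel[OF assms(1) C])
    fix T' X T'' assume T: "T' @ X # T'' \<in> rooted B" and nC: "\<forall>Y\<in>set T'. Y \<inter> C = {}"
      and XC: "X \<inter> C \<noteq> {}" "\<not> X \<subseteq> C"
    have U: "X - C \<union> X \<inter> C = X" by blast
    have Tc: "T' @ X # T'' \<in> set_comps B" using T by (rule rooted_in_set_comps)
    have Sc: "T' @ (X - C) # (X \<inter> C) # T'' \<in> set_comps B"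
      using XC Tc by (subst set_comps_split_block) (auto simp: U)
    have fine: "T' @ (X - C) # (X \<inter> C) # T'' \<preceq> T' @ X # T''" by (auto simp: refines_def)
    show "basis_elt (T' @ (X - C) # (X \<inter> C) # T'') \<^bold>\<and> e_comp R = (basis_elt (T' @ X # T'') \<^bold>\<and> e_comp R :: 'f fpi)"
    proof (cases "R \<preceq> T' @ X # T''")
      case False
      then have "\<not> R \<preceq> T' @ (X - C) # (X \<inter> C) # T''" using refines_trans[OF _ fine] by blast
      with False show ?thesis
        using wedge_e_comp_not_refines[OF assms(1) Tc assms(2), where 'f='f]
          wedge_e_comp_not_refines[OF assms(1) Sc assms(2), where 'f='f] by simp
    next
      case True
      have CX: "C \<subseteq> X"
      proof -
        obtain Z where Z: "Z \<in> set (T' @ X # T'')" "C \<subseteq> Z" using True R by (auto simp: refines_def)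
        then have "Z = X" using set_comps_disjoint[OF Tc Z(1), of X] XC(1) by auto
        with Z show ?thesis by simp
      qed
      have ref: "R \<preceq> T' @ (X - C) # (X \<inter> C) # T''"
        unfolding refines_def
      proof
        fix Y assume Y: "Y \<in> set R"
        show "\<exists>Z\<in>set (T' @ (X - C) # (X \<inter> C) # T''). Y \<subseteq> Z"
        proof (cases "Y = C")
          case True
          then show ?thesis using CX by auto
        next
          case False
          then have "Y \<inter> C = {}" using Y disj R by auto
          moreover obtain Z where "Z \<in> set (T' @ X # T'')" "Y \<subseteq> Z" using True Y by (auto simp: refines_def)
          ultimately show ?thesis by auto
        qed
      qed
      have "meet (T' @ (X - C) # (X \<inter> C) # T'') R = meet (T' @ X # T'') R"
      proof -
        have "nonempty (map ((\<inter>) (X - C)) R0) = nonempty (map ((\<inter>) X) R0)"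
          using disj(1)
        proof (induction R0)
          case (Cons Z R0)
          have "(X - C) \<inter> Z = X \<inter> Z" using Cons.prems[of Z] by auto
          with Cons show ?case by simp
        qed simp
        moreover have "nonempty (map ((\<inter>) C) R0) = []"
          using disj(1) by (auto simp: filter_empty_conv)
        moreover have "X \<inter> C = C" "(X - C) \<inter> C = {}" using CX by auto
        ultimately show ?thesis using C(2) by (simp add: meet_append_left meet_Cons R)
      qed
      then show ?thesis
        by (simp add: wedge_e_comp_refines[OF assms(1) Tc assms(2) True]
            wedge_e_comp_refines[OF assms(1) Sc assms(2) ref])
    qed
  qed
  finally show ?thesis .
qed

text \<open>
  Only the term \<open>(B)\<close> of \<open>e\<^sub>B\<close> does not annihilate the bracket, and it acts as the identity.
\<close>

lemma e_set_wedge_dynkin: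
  assumes "finite B" "B \<noteq> {}" "R \<in> set_comps B"
  shows "e_set B \<^bold>\<and> e_lin (dynkin_comp R) = (e_lin (dynkin_comp R) :: 'f::field fpi)"
proof -
  have "R \<noteq> []" using assms by auto
  have sorted: "sorted_wrt disjnt R" using assms(3) by (simp add: set_comps_def)
  let ?g = "e_lin (dynkin_comp R) :: 'f fpi"
  have B: "[B] \<in> rooted B" using assms by (simp add: rooted_def)
  have "length T \<ge> 2" if "T \<in> rooted B - {[B]}" for T
  proof (rule ccontr)
    assume "\<not> length T \<ge> 2"
    then have "T = [] \<or> (\<exists>X. T = [X])" by (cases T; cases "tl T") auto
    with that assms(2) show False by (auto simp: rooted_def)
  qed
  then have 0: "scal (sgn_comp T) (basis_elt T \<^bold>\<and> ?g) = 0" if "T \<in> rooted B - {[B]}" for T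
    using wedge_e_lin_dynkin_comp[OF assms(1) _ assms(3), of T, where 'f='f] that
    by (auto dest: rooted_in_set_comps)
  have fin: "finite (rooted B)"
    using finite_set_comps[OF assms(1)] by (simp add: rooted_def)
  have "e_set B \<^bold>\<and> ?g = (\<Sum>T\<in>rooted B. scal (sgn_comp T) (basis_elt T \<^bold>\<and> ?g))"
    by (simp add: e_set_eq_sum wedge_sum_left wedge_scal_left)
  also have "\<dots> = (\<Sum>T\<in>{[B]}. scal (sgn_comp T) (basis_elt T \<^bold>\<and> ?g))"
    using 0 B fin by (intro sum.mono_neutral_right) auto
  also have "\<dots> = basis_elt [B] \<^bold>\<and> ?g" by (simp add: sgn_comp_def)
  also have "\<dots> = lin_ext (\<lambda>W. basis_elt [B] \<^bold>\<and> e_comp W) (dynkin_comp R)"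
    by (simp add: e_lin_def wedge_lin_ext_right)
  also have "\<dots> = ?g"
    unfolding e_lin_def
  proof (rule lin_ext_cong)
    fix W assume "W \<in> terms (dynkin_comp R :: 'f fpi)"
    then have "mset W = mset R"
      using keys_dynkin_comp[OF sorted \<open>R \<noteq> []\<close>, where 'f='f] by blast
    then have W: "W \<in> set_comps B" using set_comps_perm[OF assms(3)] by blast
    have Bc: "[B] \<in> set_comps B" using assms by simp
    have sub: "Y \<subseteq> B" if "Y \<in> set W" for Y using set_comps_subset[OF W that] .
    then have ref: "W \<preceq> [B]" by (auto simp: refines_def)
    have "meet [B] W = W"
      using sub by (simp add: meet_eq_filter[OF Bc W ref] filter_id_conv)
    then show "basis_elt [B] \<^bold>\<and> e_comp W = (e_comp W :: 'f fpi)"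
      using wedge_e_comp_refines[OF assms(1) Bc W ref] by simp
  qed
  finally show ?thesis .
qed

text \<open>
  Expand \<open>e\<^sub>B \<and> e\<^bsub>R\<^sup>\<circ>\<^esub> = e\<^bsub>R\<^sup>\<circ>\<^esub>\<close> along the terms of \<open>R\<^sup>\<circ>\<close>: each term other than \<open>R\<close> ends in a
  block without \<open>Min B\<close> and is annihilated by \<open>e\<^sub>B\<close>.
\<close>

lemma e_set_wedge_dag:
  assumes "finite B" "B \<noteq> {}" "R \<in> set_comps_dag B"
  shows "e_set B \<^bold>\<and> e_comp R = (e_lin (dynkin_comp R) :: 'f::field fpi)"
proof -
  have R: "R \<in> set_comps B" "Min B \<in> last R" using assms(3) by (auto simp: set_comps_dag_def)
  have "R \<noteq> []" using R assms by auto
  define d where "d = last R"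
  have Rd: "butlast R @ [d] = R" using \<open>R \<noteq> []\<close> by (simp add: d_def)
  have sorted: "sorted_wrt disjnt R" using R by (simp add: set_comps_def)
  let ?f = "dynkin_comp R :: 'f fpi"
  have look: "coeff ?f W = (if W = R then 1 else 0)" if "W \<noteq> []" "last W = d" for W
    using lookup_dynkin_comp_last[of "butlast R" d B W, where 'f='f] R(1) that by (simp add: Rd)
  have "e_lin ?f = e_set B \<^bold>\<and> e_lin ?f"
    using e_set_wedge_dynkin[OF assms(1,2) R(1), where 'f='f] by simp
  also have "\<dots> = (\<Sum>W\<in>terms ?f. scal (coeff ?f W) (e_set B \<^bold>\<and> e_comp W))"
    by (simp add: e_lin_def lin_ext_def wedge_sum_right wedge_scal_right)
  also have "\<dots> = (\<Sum>W\<in>{R}. scal (coeff ?f W) (e_set B \<^bold>\<and> e_comp W))"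
  proof (rule sum.mono_neutral_right)
    show "{R} \<subseteq> terms ?f"
      using look[OF \<open>R \<noteq> []\<close>] by (simp add: d_def in_keys_iff)
    show "\<forall>W\<in>terms ?f - {R}. scal (coeff ?f W) (e_set B \<^bold>\<and> e_comp W) = 0"
    proof
      fix W assume W: "W \<in> terms ?f - {R}"
      then have m: "mset W = mset R"
        using keys_dynkin_comp[OF sorted \<open>R \<noteq> []\<close>, where 'f='f] by blast
      then have Wc: "W \<in> set_comps B" "W \<noteq> []" "set W = set R"
        using set_comps_perm[OF R(1)] \<open>R \<noteq> []\<close> mset_eq_setD[OF m] by auto
      have "last W \<noteq> d" using look[OF Wc(2)] W by (auto simp: in_keys_iff)
      moreover have "last W \<in> set R" "d \<in> set R"
        using Wc \<open>R \<noteq> []\<close> last_in_set[of W] by (auto simp: d_def)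
      ultimately have "Min B \<notin> last W"
        using set_comps_disjoint[OF R(1)] R(2) unfolding d_def by blast
      then show "scal (coeff ?f W) (e_set B \<^bold>\<and> e_comp W) = 0"
        using e_set_wedge_not_dag[OF assms(1) Wc(1,2), where 'f='f] by simp
    qed
  qed simp
  also have "\<dots> = e_set B \<^bold>\<and> e_comp R"
    using look[OF \<open>R \<noteq> []\<close>] by (simp add: d_def)
  finally show ?thesis by simp
qed

lemma dynkin_basis [simp]: "dynkin (basis_elt R) = dynkin_comp R"
  by (simp add: dynkin_def)

lemma vee_list_zero: "0 \<in> set fs \<Longrightarrow> vee_list fs = 0"
  by (induction fs) auto

lemma e_comp_wedge_e_comp:
  assumes "finite A" "P \<in> set_comps A" "R \<in> set_comps A" "R \<preceq> P"
  shows "(e_comp P \<^bold>\<and> e_comp R :: 'f::field fpi) =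
    (if \<forall>X\<in>set P. inside X R \<in> set_comps_dag X
     then dag_elt (map (\<lambda>X. inside X R) P) else 0)"
proof -
  let ?r = "\<lambda>X. inside X R"
  have fin: "finite X" "X \<noteq> {}" if "X \<in> set P" for X
    using that finite_comp_block[OF assms(1,2)] set_comps_nonempty[OF assms(2)] by auto
  show ?thesis
  proof (cases "\<forall>X\<in>set P. ?r X \<in> set_comps_dag X")
    case True
    then have "map (\<lambda>X. e_set X \<^bold>\<and> e_comp (?r X)) P = (map (\<lambda>X. e_lin (dynkin_comp (?r X))) P :: 'f fpi list)"
      using fin by (intro map_cong refl e_set_wedge_dag) auto
    with True show ?thesis
      by (simp add: e_comp_wedge_factor[OF assms] dag_elt_def comp_def cong: map_cong)
  next
    case False
    then obtain X where X: "X \<in> set P" "?r X \<notin> set_comps_dag X" by blast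
    have c: "?r X \<in> set_comps X" using set_comps_filter[OF assms(3,2,4) X(1)] .
    have "e_set X \<^bold>\<and> e_comp (?r X) = (0 :: 'f fpi)"
    proof (rule e_set_wedge_not_dag[OF fin(1)[OF X(1)] c])
      show "?r X \<noteq> []" using c fin(2)[OF X(1)] by auto
      show "Min X \<notin> last (?r X)" using X(2) c by (simp add: set_comps_dag_def)
    qed
    with X(1) have "0 \<in> set (map (\<lambda>X. e_set X \<^bold>\<and> e_comp (?r X)) P :: 'f fpi list)" by force
    then have "e_comp P \<^bold>\<and> e_comp R = (0 :: 'f fpi)"
      unfolding e_comp_wedge_factor[OF assms] by (rule vee_list_zero)
    with False show ?thesis by (simp only: if_False)
  qed
qed


section \<open>The basis of \<open>e_P \<and> F\<Pi>\<^sub>A \<and> e_Q\<close>\<close>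

lemma concat_in_set_comps:
  assumes "list_all2 (\<lambda>X S. S \<in> set_comps X) P Qs" "P \<in> set_comps A"
  shows "concat Qs \<in> set_comps A"
  using assms
proof (induction arbitrary: A rule: list_all2_induct)
  case (Cons X P S Qs)
  then have "P \<in> set_comps (\<Union>(set P))" "X \<inter> \<Union>(set P) = {}" "A = X \<union> \<Union>(set P)"
    by (auto simp: set_comps_Cons disjnt_def)
  with Cons show ?case using set_comps_appendI by fastforce
qed simp

text \<open>
  The parts of a tuple \<open>(Q(1), \<dots>, Q(l))\<close> can be read off from their concatenation.
\<close>

lemma map_filter_concat:
  assumes "list_all2 (\<lambda>X S. S \<in> set_comps X) P Qs" "P \<in> set_comps A"
  shows "map (\<lambda>X. inside X (concat Qs)) P = Qs"
  using assms
proof (induction arbitrary: A rule: list_all2_induct)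
  case (Cons X P S Qs)
  have P: "P \<in> set_comps (\<Union>(set P))" "X \<inter> \<Union>(set P) = {}"
    using Cons.prems by (auto simp: set_comps_Cons disjnt_def)
  have c: "concat Qs \<in> set_comps (\<Union>(set P))"
    using concat_in_set_comps[OF Cons.hyps(2) P(1)] .
  have S: "Y \<subseteq> X" "Y \<noteq> {}" if "Y \<in> set S" for Y
    using that set_comps_subset[OF Cons.hyps(1)] set_comps_nonempty[OF Cons.hyps(1)] by auto
  have Q: "Y \<subseteq> \<Union>(set P)" "Y \<noteq> {}" if "Y \<in> set (concat Qs)" for Y
    using that set_comps_subset[OF c] set_comps_nonempty[OF c] by auto
  have 1: "inside X S = S" using S by (simp add: filter_id_conv)
  have 2: "inside X (concat Qs) = []"
    unfolding filter_empty_conv using Q P(2) by blast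
  have 3: "inside Z S = []" if "Z \<in> set P" for Z
    unfolding filter_empty_conv using S P(2) that by blast
  have "map (\<lambda>Z. inside Z (S @ concat Qs)) P = map (\<lambda>Z. inside Z (concat Qs)) P"
    using 3 by (intro map_cong refl) (simp only: filter_append append_Nil)
  also have "\<dots> = Qs" using Cons.IH[OF P(1)] .
  finally show ?case using 1 2 by (simp del: filter_concat)
qed simp

text \<open>
  Indices of the basis correspond to those rearrangements \<open>R\<close> of \<open>Q\<close> for which \<open>e\<^sub>P \<and> e\<^sub>R\<close> does not vanish.
\<close>

lemma dag_tuples_iff:
  assumes "P \<in> set_comps A" "Q \<in> set_comps A" "Q \<preceq> P"
  shows "Qs \<in> dag_tuples P Q \<longleftrightarrow>
    (\<exists>R. mset R = mset Q \<and> (\<forall>X\<in>set P. inside X R \<in> set_comps_dag X) \<and>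
         Qs = map (\<lambda>X. inside X R) P)"
proof
  assume "Qs \<in> dag_tuples P Q"
  then have Qs: "list_all2 (\<lambda>X S. S \<in> set_comps_dag X) P Qs" "mset (concat Qs) = mset Q"
    by (auto simp: dag_tuples_def rearrangement_def list_all2_conv_all_nth)
  then have "list_all2 (\<lambda>X S. S \<in> set_comps X) P Qs"
    by (auto simp: set_comps_dag_def elim!: list_all2_mono)
  then have eq: "map (\<lambda>X. inside X (concat Qs)) P = Qs"
    using assms(1) by (rule map_filter_concat)
  have "inside X (concat Qs) \<in> set_comps_dag X" if "X \<in> set P" for X
  proof -
    obtain i where i: "i < length P" "P ! i = X" using \<open>X \<in> set P\<close> by (auto simp: in_set_conv_nth)
    then have "Qs ! i = inside X (concat Qs)" by (subst eq[symmetric]) simp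
    then show ?thesis using list_all2_nthD[OF Qs(1) i(1)] i by simp
  qed
  with Qs(2) eq show "\<exists>R. mset R = mset Q \<and> (\<forall>X\<in>set P. inside X R \<in> set_comps_dag X) \<and>
         Qs = map (\<lambda>X. inside X R) P" by metis
next
  assume "\<exists>R. mset R = mset Q \<and> (\<forall>X\<in>set P. inside X R \<in> set_comps_dag X) \<and>
         Qs = map (\<lambda>X. inside X R) P"
  then obtain R where R: "mset R = mset Q" "\<forall>X\<in>set P. inside X R \<in> set_comps_dag X"
    "Qs = map (\<lambda>X. inside X R) P" by blast
  have Rc: "R \<in> set_comps A" "R \<preceq> P"
    using set_comps_perm[OF assms(2) R(1)] assms(3) mset_eq_setD[OF R(1)] by (simp_all add: refines_def)
  have "concat Qs = meet P R" unfolding R(3) meet_eq_filter[OF assms(1) Rc] ..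
  then have "mset (concat Qs) = mset Q" using mset_meet_refines[OF assms(1) Rc] R(1) by simp
  with R show "Qs \<in> dag_tuples P Q" by (simp add: dag_tuples_def rearrangement_def del: mset_concat)
qed

lemma dag_elt_in_image:
  assumes "finite A" "P \<in> set_comps A" "Q \<in> set_comps A" "Q \<preceq> P" "mset R = mset Q"
  shows "(e_comp P \<^bold>\<and> e_comp R :: 'f::field fpi) \<in> insert 0 (dag_elt ` dag_tuples P Q)"
proof -
  have Rc: "R \<in> set_comps A" "R \<preceq> P"
    using set_comps_perm[OF assms(3,5)] assms(4) mset_eq_setD[OF assms(5)] by (simp_all add: refines_def)
  show ?thesis
  proof (cases "\<forall>X\<in>set P. inside X R \<in> set_comps_dag X")
    case True
    with assms(5) have "map (\<lambda>X. inside X R) P \<in> dag_tuples P Q"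
      unfolding dag_tuples_iff[OF assms(2-4)] by blast
    with True show ?thesis by (simp add: e_comp_wedge_e_comp[OF assms(1,2) Rc])
  next
    case False
    then show ?thesis unfolding e_comp_wedge_e_comp[OF assms(1,2) Rc] by auto
  qed
qed

lemma dag_elt_eq_wedge:
  assumes "finite A" "P \<in> set_comps A" "Q \<in> set_comps A" "Q \<preceq> P" "Qs \<in> dag_tuples P Q"
  obtains R where "mset R = mset Q" "(dag_elt Qs :: 'f::field fpi) = e_comp P \<^bold>\<and> e_comp R"
proof -
  from assms(5) obtain R where R: "mset R = mset Q" "\<forall>X\<in>set P. inside X R \<in> set_comps_dag X"
    "Qs = map (\<lambda>X. inside X R) P" unfolding dag_tuples_iff[OF assms(2-4)] by blast
  have Rc: "R \<in> set_comps A" "R \<preceq> P"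
    using set_comps_perm[OF assms(3) R(1)] assms(4) mset_eq_setD[OF R(1)] by (simp_all add: refines_def)
  show thesis
    using that[OF R(1)] e_comp_wedge_e_comp[OF assms(1,2) Rc, where 'f='f] R by simp
qed

lemma basis_wedge_e_comp_perm:
  assumes "finite A" "Q \<in> set_comps A" "mset R = mset Q"
  shows "basis_elt R \<^bold>\<and> e_comp Q = (e_comp R :: 'f::field fpi)"
proof -
  have R: "R \<in> set_comps A" "Q \<preceq> R" "R \<preceq> Q"
    using set_comps_perm[OF assms(2,3)] mset_eq_setD[OF assms(3)] by (auto simp: refines_def)
  then show ?thesis
    using assms by (simp add: wedge_e_comp_refines meet_eq_left)
qed

lemma basis_wedge_e_comp_cases:
  assumes "finite A" "Q \<in> set_comps A" "T \<in> set_comps A"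
  shows "basis_elt T \<^bold>\<and> e_comp Q = (0 :: 'f::field fpi) \<or>
    (\<exists>R. mset R = mset Q \<and> basis_elt T \<^bold>\<and> e_comp Q = (e_comp R :: 'f fpi))"
  using wedge_e_comp_refines[OF assms(1,3,2), where 'f='f] wedge_e_comp_not_refines[OF assms(1,3,2), where 'f='f]
    mset_meet_refines[OF assms(3,2)]
  by blast

lemma span_dag_elt:
  assumes "finite A" "P \<in> set_comps A" "Q \<in> set_comps A" "Q \<preceq> P"
  shows "fpi.span (dag_elt ` dag_tuples P Q :: 'f::field fpi set)
    = {e_comp P \<^bold>\<and> f \<^bold>\<and> e_comp Q |f. f \<in> FPi_on A}" (is "fpi.span ?D = ?E")
proof
  have "?D \<subseteq> ?E"
  proof
    fix x assume "x \<in> ?D"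
    then obtain Qs where Qs: "Qs \<in> dag_tuples P Q" "x = dag_elt Qs" by blast
    then obtain R where R: "mset R = mset Q" "x = e_comp P \<^bold>\<and> e_comp R"
      using dag_elt_eq_wedge[OF assms] by metis
    have "x = e_comp P \<^bold>\<and> basis_elt R \<^bold>\<and> e_comp Q"
      using basis_wedge_e_comp_perm[OF assms(1,3) R(1), where 'f='f] R by (simp add: wedge_assoc)
    moreover have "(basis_elt R :: 'f fpi) \<in> FPi_on A" using set_comps_perm[OF assms(3) R(1)] by simp
    ultimately show "x \<in> ?E" by blast
  qed
  moreover have "fpi.subspace ?E"
  proof (rule fpi.subspaceI)
    show "0 \<in> ?E"
      using fpi.subspace_0[OF subspace_FPi_on[of A]] by (auto intro!: exI[of _ 0])
    show "x + y \<in> ?E" if xy: "x \<in> ?E" "y \<in> ?E" for x y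
    proof -
      from xy obtain f g where "f \<in> FPi_on A" "x = e_comp P \<^bold>\<and> f \<^bold>\<and> e_comp Q"
        "g \<in> FPi_on A" "y = e_comp P \<^bold>\<and> g \<^bold>\<and> e_comp Q" by blast
      then show ?thesis using fpi.subspace_add[OF subspace_FPi_on[of A], of f g]
        by (auto intro!: exI[of _ "f + g"] simp: wedge_add_left wedge_add_right)
    qed
    show "scal c x \<in> ?E" if x: "x \<in> ?E" for c x
    proof -
      from x obtain f where "f \<in> FPi_on A" "x = e_comp P \<^bold>\<and> f \<^bold>\<and> e_comp Q" by blast
      then show ?thesis using fpi.subspace_scale[OF subspace_FPi_on[of A], of f c]
        by (auto intro!: exI[of _ "scal c f"] simp: wedge_scal_left wedge_scal_right)
    qed
  qed
  ultimately show "fpi.span ?D \<subseteq> ?E" by (rule fpi.span_minimal)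
  show "?E \<subseteq> fpi.span ?D"
  proof
    fix x assume "x \<in> ?E"
    then obtain f where f: "f \<in> FPi_on A" and x: "x = e_comp P \<^bold>\<and> f \<^bold>\<and> e_comp Q" by blast
    from f have "e_comp P \<^bold>\<and> f \<^bold>\<and> e_comp Q \<in> fpi.span ?D"
    proof (induction f rule: FPi_on_induct)
      case (basis T)
      from basis_wedge_e_comp_cases[OF assms(1,3) basis, where 'f='f]
      have "e_comp P \<^bold>\<and> (basis_elt T \<^bold>\<and> e_comp Q) \<in> insert 0 ?D"
      proof
        assume "\<exists>R. mset R = mset Q \<and> basis_elt T \<^bold>\<and> e_comp Q = (e_comp R :: 'f fpi)"
        then obtain R where "mset R = mset Q" "basis_elt T \<^bold>\<and> e_comp Q = (e_comp R :: 'f fpi)" by blast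
        then show ?thesis using dag_elt_in_image[OF assms, of R, where 'f='f] by simp
      qed simp
      then show ?case by (auto simp: wedge_assoc intro: fpi.span_base fpi.span_zero)
    qed (auto simp: wedge_add_left wedge_add_right wedge_scal_left wedge_scal_right
        intro: fpi.span_zero fpi.span_add fpi.span_scale)
    then show "x \<in> fpi.span ?D" using x by simp
  qed
qed

text \<open>
  A concatenation determines its two parts, since their blocks lie in disjoint sets.
\<close>

lemma lookup_vee:
  fixes f g :: "'f::field fpi"
  assumes "f \<in> FPi_on B" "g \<in> FPi_on C" "B \<inter> C = {}" "U \<in> set_comps B" "V \<in> set_comps C"
  shows "coeff (f \<^bold>\<or> g) (U @ V) = coeff f U * coeff g V"
  using assms(1)
proof (induction f rule: FPi_on_induct)
  case S: (basis S)
  from assms(2) show ?case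
  proof (induction g rule: FPi_on_induct)
    case T: (basis T)
    have proj: "inside B (S @ T) = S" if "S \<in> set_comps B" "T \<in> set_comps C" for S T
    proof -
      have "inside B S = S"
        using set_comps_subset[OF that(1)] by (simp add: filter_id_conv)
      moreover have "inside B T = []"
        unfolding filter_empty_conv
        using set_comps_subset[OF that(2)] set_comps_nonempty[OF that(2)] assms(3) by blast
      ultimately show ?thesis by simp
    qed
    have "S @ T = U @ V \<longleftrightarrow> S = U \<and> T = V"
      using proj[OF S T] proj[OF assms(4,5)] by (metis same_append_eq)
    then show ?case
      using assms(3) by (simp add: vee_basis set_comps_Union[OF S] set_comps_Union[OF T] lookup_single when_def)
  qed (simp_all add: vee_add_right vee_scal_right lookup_add algebra_simps)
qed (simp_all add: vee_add_left vee_scal_left lookup_add algebra_simps)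

lemma e_lin_dynkin_in_FPi_on:
  assumes "R \<in> set_comps B"
  shows "(e_lin (dynkin_comp R) :: 'f::field fpi) \<in> FPi_on B"
proof (cases "R = []")
  case True
  with assms show ?thesis by (simp add: e_lin_def)
next
  case False
  have "W \<in> set_comps B" if "W \<in> terms (dynkin_comp R :: 'f fpi)" for W
  proof -
    have "sorted_wrt disjnt R" using assms by (simp add: set_comps_def)
    from keys_dynkin_comp[OF this False, where 'f='f] that set_comps_perm[OF assms] show ?thesis by blast
  qed
  then show ?thesis
    unfolding e_lin_def lin_ext_def
    by (intro fpi.subspace_sum fpi.subspace_scale subspace_FPi_on e_comp_in_FPi_on)
qed

text \<open>
  Passing from \<open>R\<^sup>\<circ>\<close> to \<open>e\<^bsub>R\<^sup>\<circ>\<^esub>\<close> only adds longer terms, and \<open>R'\<close> ends in the same block as \<open>R\<close>,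
  namely the one that contains \<open>Min B\<close>.
\<close>

lemma lookup_e_lin_dynkin_comp:
  assumes "finite B" "B \<noteq> {}" "R \<in> set_comps_dag B" "R' \<in> set_comps_dag B" "mset R = mset R'"
  shows "coeff (e_lin (dynkin_comp R) :: 'f::field fpi) R' = (if R = R' then 1 else 0)"
proof -
  let ?f = "dynkin_comp R :: 'f fpi"
  have R: "R \<in> set_comps B" "Min B \<in> last R" "R' \<in> set_comps B" "Min B \<in> last R'"
    using assms by (auto simp: set_comps_dag_def)
  then have ne: "R \<noteq> []" "R' \<noteq> []" using assms(2) by auto
  have sorted: "sorted_wrt disjnt R" using R by (simp add: set_comps_def)
  have last: "last R' = last R"
  proof -
    have "last R' \<in> set R" using ne mset_eq_setD[OF assms(5)] by simp
    then show ?thesis using set_comps_disjoint[OF R(1), of "last R'" "last R"] ne R by auto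
  qed
  have "coeff (e_lin ?f) R' =
     (\<Sum>W\<in>terms ?f. if W = R' then coeff ?f W else 0)"
    unfolding e_lin_def lookup_lin_ext
  proof (intro sum.cong refl)
    fix W assume "W \<in> terms ?f"
    then have m: "mset W = mset R" using keys_dynkin_comp[OF sorted ne(1), where 'f='f] by blast
    then have "W \<in> set_comps B" "length R' \<le> length W"
      using set_comps_perm[OF R(1)] assms(5) mset_eq_length[of W R] mset_eq_length[of R R'] by auto
    then show "coeff ?f W * coeff (e_comp W) R'
       = (if W = R' then coeff ?f W else 0)"
      using lookup_e_comp[OF assms(1), of W R', where 'f='f] by auto
  qed
  also have "\<dots> = coeff ?f R'" by (auto simp: in_keys_iff)
  also have "\<dots> = (if R = R' then 1 else 0)"
    using lookup_dynkin_comp_last[of "butlast R" "last R" B R', where 'f='f] ne R(1) last by auto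
  finally show ?thesis .
qed

lemma dag_elt_in_FPi_on_and_lookup:
  assumes "list_all2 (\<lambda>X S. S \<in> set_comps_dag X) P Qs" "list_all2 (\<lambda>X S. S \<in> set_comps_dag X) P Rs"
    and "map mset Qs = map mset Rs" "P \<in> set_comps A" "finite A"
  shows "(dag_elt Qs :: 'f::field fpi) \<in> FPi_on A \<and>
    coeff (dag_elt Qs :: 'f fpi) (concat Rs) = (if Qs = Rs then 1 else 0)"
  using assms
proof (induction arbitrary: A Rs rule: list_all2_induct)
  case (Cons X P S Qs)
  then obtain S' Rs' where Rs: "Rs = S' # Rs'" "S' \<in> set_comps_dag X"
    "list_all2 (\<lambda>X S. S \<in> set_comps_dag X) P Rs'" by (auto simp: list_all2_Cons1)
  have P: "P \<in> set_comps (\<Union>(set P))" "X \<inter> \<Union>(set P) = {}" "A = X \<union> \<Union>(set P)" "X \<noteq> {}"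
    using Cons.prems by (auto simp: set_comps_Cons disjnt_def)
  have fin: "finite X" "finite (\<Union>(set P))" using Cons.prems(4) P(3) by (metis finite_Un)+
  have m: "mset S = mset S'" "map mset Qs = map mset Rs'" using Cons.prems(2) Rs by auto
  have S: "S \<in> set_comps X" "S' \<in> set_comps X" using Cons.hyps(1) Rs(2) by (auto simp: set_comps_dag_def)
  have "list_all2 (\<lambda>X S. S \<in> set_comps X) P Rs'"
    using Rs(3) by (auto simp: set_comps_dag_def elim!: list_all2_mono)
  then have c: "concat Rs' \<in> set_comps (\<Union>(set P))" using P(1) by (rule concat_in_set_comps)
  let ?f = "e_lin (dynkin_comp S) :: 'f fpi" and ?g = "dag_elt Qs :: 'f fpi"
  have f: "?f \<in> FPi_on X" using S(1) by (rule e_lin_dynkin_in_FPi_on)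
  have IH: "?g \<in> FPi_on (\<Union>(set P)) \<and> coeff ?g (concat Rs') = (if Qs = Rs' then 1 else 0)"
    using Rs(3) m(2) P(1) fin(2) by (rule Cons.IH)
  then have g: "?g \<in> FPi_on (\<Union>(set P))" by blast
  have eq: "dag_elt (S # Qs) = ?f \<^bold>\<or> ?g" by (simp add: dag_elt_def)
  have "?f \<^bold>\<or> ?g \<in> FPi_on A" unfolding P(3) using f g P(2) by (rule vee_in_FPi_on)
  moreover have "coeff (?f \<^bold>\<or> ?g) (S' @ concat Rs')
      = (if S = S' then 1 else 0) * (if Qs = Rs' then 1 else 0)"
    using lookup_vee[OF f g P(2) S(2) c] IH lookup_e_lin_dynkin_comp[OF fin(1) P(4) Cons.hyps(1) Rs(2) m(1), where 'f='f]
    by simp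
  ultimately show ?case using Rs(1) unfolding eq by simp
qed (simp add: dag_elt_def)

lemma dag_tuples_list_all2:
  assumes "Qs \<in> dag_tuples P Q"
  shows "list_all2 (\<lambda>X S. S \<in> set_comps_dag X) P Qs"
  using assms by (auto simp: dag_tuples_def list_all2_conv_all_nth)

lemma lookup_dag_elt:
  assumes "finite A" "P \<in> set_comps A" "Q \<in> set_comps A" "Q \<preceq> P"
    and "Qs \<in> dag_tuples P Q" "Rs \<in> dag_tuples P Q"
  shows "coeff (dag_elt Qs :: 'f::field fpi) (concat Rs) = (if Qs = Rs then 1 else 0)"
proof -
  have "map mset Ts = map (\<lambda>X. filter_mset (\<lambda>Y. Y \<subseteq> X) (mset Q)) P" if T: "Ts \<in> dag_tuples P Q" for Ts
    using that unfolding dag_tuples_iff[OF assms(2-4)] by (auto simp: comp_def)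
  then have "map mset Qs = map mset Rs" using assms(5,6) by metis
  then show ?thesis
    using dag_elt_in_FPi_on_and_lookup[OF dag_tuples_list_all2[OF assms(5)] dag_tuples_list_all2[OF assms(6)] _ assms(2,1)]
    by blast
qed

lemma finite_dag_tuples:
  assumes "finite A" "P \<in> set_comps A" "Q \<in> set_comps A" "Q \<preceq> P"
  shows "finite (dag_tuples P Q)"
proof (rule finite_subset)
  show "dag_tuples P Q \<subseteq> (\<lambda>R. map (\<lambda>X. inside X R) P) ` set_comps A"
    using set_comps_perm[OF assms(3)] by (auto simp: dag_tuples_iff[OF assms(2-4)] intro!: imageI)
  show "finite ((\<lambda>R. map (\<lambda>X. inside X R) P) ` set_comps A)"
    using finite_set_comps[OF assms(1)] by simp
qed

lemma inj_on_dag_elt: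
  assumes "finite A" "P \<in> set_comps A" "Q \<in> set_comps A" "Q \<preceq> P"
  shows "inj_on (dag_elt :: scomp list \<Rightarrow> 'f::field fpi) (dag_tuples P Q)"
proof (rule inj_onI)
  fix Qs Rs assume *: "Qs \<in> dag_tuples P Q" "Rs \<in> dag_tuples P Q" "dag_elt Qs = (dag_elt Rs :: 'f fpi)"
  have "(if Qs = Rs then 1 else 0 :: 'f) = (if Rs = Rs then 1 else 0)"
    using lookup_dag_elt[OF assms *(1,2), where 'f='f] lookup_dag_elt[OF assms *(2,2), where 'f='f] *(3) by simp
  then show "Qs = Rs" by (simp split: if_splits)
qed

lemma independent_dag_elt:
  assumes "finite A" "P \<in> set_comps A" "Q \<in> set_comps A" "Q \<preceq> P"
  shows "fpi.independent (dag_elt ` dag_tuples P Q :: 'f::field fpi set)"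
proof (rule fpi.independent_if_scalars_zero)
  let ?T = "dag_tuples P Q"
  show "finite (dag_elt ` ?T :: 'f fpi set)" using finite_dag_tuples[OF assms] by simp
  fix c :: "'f fpi \<Rightarrow> 'f" and x :: "'f fpi"
  assume 0: "(\<Sum>x\<in>dag_elt ` ?T. scal (c x) x) = 0" and "x \<in> dag_elt ` ?T"
  then obtain Rs where Rs: "Rs \<in> ?T" "x = dag_elt Rs" by blast
  have "0 = coeff (\<Sum>Qs\<in>?T. scal (c (dag_elt Qs)) (dag_elt Qs)) (concat Rs)"
    using 0 by (simp add: sum.reindex[OF inj_on_dag_elt[OF assms]])
  also have "\<dots> = (\<Sum>Qs\<in>?T. if Qs = Rs then c (dag_elt Qs) else 0)"
    unfolding lookup_sum lookup_scal
    by (intro sum.cong refl) (simp add: lookup_dag_elt[OF assms _ Rs(1)])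
  also have "\<dots> = c x" using Rs finite_dag_tuples[OF assms] by simp
  finally show "c x = 0" by simp
qed


section \<open>The number of basis elements\<close>

lemma card_list_all2:
  assumes "\<And>X. X \<in> set P \<Longrightarrow> finite (E X)"
  shows "card {Qs. list_all2 (\<lambda>X S. S \<in> E X) P Qs} = (\<Prod>X\<leftarrow>P. card (E X))
    \<and> finite {Qs. list_all2 (\<lambda>X S. S \<in> E X) P Qs}"
  using assms
proof (induction P)
  case Nil
  have "{Qs. list_all2 (\<lambda>X S. S \<in> E X) [] Qs} = {[]}" by auto
  then show ?case by simp
next
  case (Cons X P)
  let ?L = "\<lambda>P. {Qs. list_all2 (\<lambda>X S. S \<in> E X) P Qs}"
  have eq: "?L (X # P) = (\<lambda>(S, Qs). S # Qs) ` (E X \<times> ?L P)"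
    by (auto simp: list_all2_Cons1 image_iff)
  have "inj_on (\<lambda>(S, Qs). S # Qs) (E X \<times> ?L P)" by (auto simp: inj_on_def)
  with Cons show ?case unfolding eq by (simp add: card_image)
qed

lemma card_distinct_lists:
  assumes "finite E"
  shows "card {p. distinct p \<and> set p = E} = fact (card E)"
proof -
  have "{p. distinct p \<and> set p = E} = {p. length p = card E \<and> distinct p \<and> set p \<subseteq> E}"
  proof (intro Collect_cong iffI)
    fix p assume "length p = card E \<and> distinct p \<and> set p \<subseteq> E"
    then show "distinct p \<and> set p = E" using card_subset_eq[OF assms, of "set p"] by (simp add: distinct_card)
  qed (auto simp: distinct_card)
  then show ?thesis
    using card_lists_distinct_length_eq[OF assms, of "card E"] by (simp add: fact_prod)
qed

text \<open>
  The block with \<open>Min X\<close> has to come last, the others may be ordered freely.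
\<close>

lemma card_dag_perms:
  assumes "D \<in> set_comps X" "finite X" "X \<noteq> {}"
  shows "card {S \<in> set_comps_dag X. mset S = mset D} = fact (length D - 1)"
proof -
  obtain d where d: "d \<in> set D" "Min X \<in> d"
    using set_comps_Union[OF assms(1)] Min_in[OF assms(2,3)] by blast
  have "{S \<in> set_comps_dag X. mset S = mset D} = (\<lambda>p. p @ [d]) ` {p. distinct p \<and> set p = set D - {d}}"
  proof (intro equalityI subsetI)
    fix S assume "S \<in> {S \<in> set_comps_dag X. mset S = mset D}"
    then have S: "S \<in> set_comps X" "Min X \<in> last S" "set S = set D"
      using mset_eq_setD by (auto simp: set_comps_dag_def)
    then have "S \<noteq> []" using d by auto
    then have "last S = d"
      using set_comps_disjoint[OF S(1), of "last S" d] S(2,3) d last_in_set[of S] by blast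
    then have Sd: "S = butlast S @ [d]" using \<open>S \<noteq> []\<close> append_butlast_last_id[of S] by simp
    have "distinct (butlast S @ [d])" using set_comps_distinct[OF S(1)] Sd by simp
    moreover have "set (butlast S) \<union> {d} = set D" using S(3) by (subst (asm) Sd) simp
    ultimately have "butlast S \<in> {p. distinct p \<and> set p = set D - {d}}"
      by auto
    with Sd show "S \<in> (\<lambda>p. p @ [d]) ` {p. distinct p \<and> set p = set D - {d}}" by blast
  next
    fix S assume "S \<in> (\<lambda>p. p @ [d]) ` {p. distinct p \<and> set p = set D - {d}}"
    then obtain p where p: "S = p @ [d]" "set p = set D - {d}" "distinct p"
      by auto
    then have "set S = set D" "distinct S" using d by auto
    then have "mset S = mset D"
      using set_comps_distinct[OF assms(1)] by (simp add: set_eq_iff_mset_eq_distinct)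
    with set_comps_perm[OF assms(1)] p d show "S \<in> {S \<in> set_comps_dag X. mset S = mset D}"
      by (auto simp: set_comps_dag_def)
  qed
  moreover have "inj_on (\<lambda>p. p @ [d]) ({p. distinct p \<and> set p = set D - {d}})" by (simp add: inj_on_def)
  ultimately show ?thesis
    using d set_comps_distinct[OF assms(1)] by (simp add: card_image card_distinct_lists distinct_card)
qed

text \<open>
  The condition on \<open>concat Qs\<close> amounts to prescribing the blocks of each entry, so the tuples form a
  product of sets.
\<close>

lemma card_dag_tuples:
  assumes "finite A" "P \<in> set_comps A" "Q \<in> set_comps A" "Q \<preceq> P"
  shows "card (dag_tuples P Q) = (\<Prod>j<length P. fact (card {i. i < length Q \<and> Q ! i \<subseteq> P ! j} - 1))"
proof -
  define E where "E X = {S \<in> set_comps_dag X. mset S = mset (inside X Q)}" for X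
  have D: "inside X Q \<in> set_comps X" if "X \<in> set P" for X
    using set_comps_filter[OF assms(3,2,4) that] .
  have fin: "finite X" "X \<noteq> {}" if "X \<in> set P" for X
    using that finite_comp_block[OF assms(1,2)] set_comps_nonempty[OF assms(2)] by auto
  have "dag_tuples P Q = {Qs. list_all2 (\<lambda>X S. S \<in> E X) P Qs}"
  proof (intro equalityI subsetI)
    fix Qs assume Qs: "Qs \<in> dag_tuples P Q"
    then obtain R where R: "mset R = mset Q" "Qs = map (\<lambda>X. inside X R) P"
      unfolding dag_tuples_iff[OF assms(2-4)] by blast
    have "list_all2 (\<lambda>X S. S \<in> set_comps_dag X) P Qs" using Qs by (rule dag_tuples_list_all2)
    then show "Qs \<in> {Qs. list_all2 (\<lambda>X S. S \<in> E X) P Qs}"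
      using R by (auto simp: list_all2_conv_all_nth E_def)
  next
    fix Qs assume "Qs \<in> {Qs. list_all2 (\<lambda>X S. S \<in> E X) P Qs}"
    then have Qs: "list_all2 (\<lambda>X S. S \<in> E X) P Qs" by simp
    then have "mset (concat Qs) = mset (concat (map (\<lambda>X. inside X Q) P))"
      by (induction rule: list_all2_induct) (auto simp: E_def)
    then have "mset (concat Qs) = mset Q"
      using mset_meet_refines[OF assms(2-4)] meet_eq_filter[OF assms(2-4)] by simp
    with Qs show "Qs \<in> dag_tuples P Q"
      by (simp add: dag_tuples_def rearrangement_def list_all2_conv_all_nth E_def del: mset_concat)
  qed
  moreover have cE: "card (E X) = fact (length (inside X Q) - 1)" if "X \<in> set P" for X
    unfolding E_def using card_dag_perms[OF D[OF that] fin[OF that]] .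
  moreover have "finite (E X)" if "X \<in> set P" for X
  proof -
    have "E X \<subseteq> set_comps X" by (auto simp: E_def set_comps_dag_def)
    then show ?thesis using finite_set_comps[OF fin(1)[OF that]] by (rule finite_subset)
  qed
  ultimately have "card (dag_tuples P Q) = (\<Prod>X\<leftarrow>P. card (E X))"
    using card_list_all2[of P E] by simp
  also have "\<dots> = (\<Prod>j<length P. card (E (P ! j)))"
    by (simp add: prod.list_conv_set_nth atLeast0LessThan)
  also have "\<dots> = (\<Prod>j<length P. fact (card {i. i < length Q \<and> Q ! i \<subseteq> P ! j} - 1))"
    by (intro prod.cong refl) (simp add: cE length_filter_conv_card)
  finally show ?thesis .
qed


section \<open>Submodules and their quotients\<close>

text \<open>
  The subsets of \<open>F\<Pi>\<^sub>A\<close> with this property are its left ideals. Closure under scalars is demanded explicitly here; for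
  \<^const>\<open>submodule\<close> it is a consequence of the action of the identity of \<open>F\<Pi>\<^sub>A\<close>.
\<close>

definition left_stable :: "nat set \<Rightarrow> 'f::field fpi set \<Rightarrow> bool" where
  "left_stable A N \<longleftrightarrow> fpi.subspace N \<and> (\<forall>T\<in>set_comps A. \<forall>v\<in>N. basis_elt T \<^bold>\<and> v \<in> N)"

definition sub_module :: "'f::field fpi set \<Rightarrow> ('f fpi, 'f fpi) module" where
  "sub_module V = \<lparr>carrier = V, mult = undefined, one = undefined, zero = 0, add = (+), smult = wedge\<rparr>"

definition coset :: "'f::field fpi set \<Rightarrow> 'f fpi \<Rightarrow> 'f fpi set" where
  "coset N v = (\<lambda>n. n + v) ` N"

lemma sub_module_simps [simp]:
  "carrier (sub_module V) = V" "zero (sub_module V) = 0" "add (sub_module V) = (+)"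
  "smult (sub_module V) = wedge"
  by (simp_all add: sub_module_def)

lemma restr_sub_module: "restr_module (sub_module V) N = sub_module N"
  by (simp add: restr_module_def sub_module_def)

lemma FPi_ring_carrier [simp]: "carrier (FPi_ring A) = FPi_on A"
  by (simp add: FPi_ring_def)

lemma left_stable_wedge:
  assumes "left_stable A N" "f \<in> FPi_on A" "v \<in> N"
  shows "f \<^bold>\<and> v \<in> N"
proof -
  have sub: "fpi.subspace N" using assms(1) by (simp add: left_stable_def)
  from assms(2) show ?thesis
    by (induction f rule: FPi_on_induct)
      (use assms sub in \<open>auto simp: left_stable_def wedge_add_left wedge_scal_left
        intro: fpi.subspace_0 fpi.subspace_add fpi.subspace_scale\<close>)
qed

lemma wedge_unit:
  obtains T where "T \<in> set_comps A" "\<And>v::'f::field fpi. v \<in> FPi_on A \<Longrightarrow> basis_elt T \<^bold>\<and> v = v"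
proof -
  define T where "T = (if A = {} then [] else [A])"
  have T: "T \<in> set_comps A" by (simp add: T_def)
  have unit: "meet T W = W" if W: "W \<in> set_comps A" for W
  proof (cases "A = {}")
    case True
    with W show ?thesis by (simp add: T_def)
  next
    case False
    have "W \<preceq> T"
      using set_comps_subset[OF W] False by (auto simp: refines_def T_def)
    then show ?thesis
      using set_comps_subset[OF W] False
      by (simp add: meet_eq_filter[OF T W]) (simp add: T_def filter_id_conv)
  qed
  have "basis_elt T \<^bold>\<and> v = v" if "v \<in> FPi_on A" for v :: "'f fpi"
    using that by (induction v rule: FPi_on_induct)
      (simp_all add: wedge_basis_same[OF T] unit wedge_add_right wedge_scal_right)
  with T that show thesis by blast
qed

lemma coset_iff:
  assumes "fpi.subspace N"
  shows "w \<in> coset N v \<longleftrightarrow> w - v \<in> N"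
  unfolding coset_def by (auto intro: image_eqI[of _ _ "w - v"])

lemma coset_eq_iff:
  assumes "fpi.subspace N"
  shows "coset N v = coset N w \<longleftrightarrow> v - w \<in> N"
proof
  assume "coset N v = coset N w"
  moreover have "v \<in> coset N v" using fpi.subspace_0[OF assms] by (simp add: coset_iff[OF assms])
  ultimately show "v - w \<in> N" by (simp add: coset_iff[OF assms])
next
  assume vw: "v - w \<in> N"
  have "x - v \<in> N \<longleftrightarrow> x - w \<in> N" for x
    using fpi.subspace_add[OF assms _ vw, of "x - v"] fpi.subspace_diff[OF assms _ vw, of "x - w"] by auto
  then show "coset N v = coset N w" by (auto simp: coset_iff[OF assms])
qed

lemma coset_0: "coset N 0 = N"
  by (simp add: coset_def)

lemma coset_eq_self_iff:
  assumes "fpi.subspace N"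
  shows "coset N v = N \<longleftrightarrow> v \<in> N"
  using coset_eq_iff[OF assms, of v 0] by (simp add: coset_0)

lemma quot_carrier: "carrier (quot_module (sub_module V) N) = coset N ` V"
  by (auto simp: quot_module_def A_RCOSETS_def RCOSETS_def r_coset_def coset_def)

lemma quot_zero: "zero (quot_module (sub_module V) N) = N"
  by (simp add: quot_module_def)

lemma quot_add:
  assumes "fpi.subspace N"
  shows "add (quot_module (sub_module V) N) (coset N v) (coset N w) = coset N (v + w)"
proof -
  have "add (quot_module (sub_module V) N) (coset N v) (coset N w)
      = (\<Union>x\<in>coset N v. \<Union>y\<in>coset N w. {x + y})"
    by (simp add: quot_module_def set_add_def set_mult_def)
  also have "\<dots> = coset N (v + w)"
  proof (intro equalityI subsetI)
    fix z assume "z \<in> (\<Union>x\<in>coset N v. \<Union>y\<in>coset N w. {x + y})"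
    then obtain x y where "x - v \<in> N" "y - w \<in> N" "z = x + y" by (auto simp: coset_iff[OF assms])
    then show "z \<in> coset N (v + w)"
      using fpi.subspace_add[OF assms, of "x - v" "y - w"] by (simp add: coset_iff[OF assms] algebra_simps)
  next
    fix z assume "z \<in> coset N (v + w)"
    then have "z - w \<in> coset N v" "w \<in> coset N w"
      using fpi.subspace_0[OF assms] by (simp_all add: coset_iff[OF assms] algebra_simps)
    then show "z \<in> (\<Union>x\<in>coset N v. \<Union>y\<in>coset N w. {x + y})" by force
  qed
  finally show ?thesis .
qed

lemma quot_smult:
  assumes "left_stable A N" "r \<in> FPi_on A"
  shows "smult (quot_module (sub_module V) N) r (coset N v) = coset N (r \<^bold>\<and> v)"
proof -
  have sub: "fpi.subspace N" using assms(1) by (simp add: left_stable_def)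
  have "smult (quot_module (sub_module V) N) r (coset N v) = (\<Union>x\<in>coset N v. coset N (r \<^bold>\<and> x))"
    by (simp add: quot_module_def a_r_coset_def r_coset_def coset_def image_def) blast
  also have "\<dots> = (\<Union>x\<in>coset N v. coset N (r \<^bold>\<and> v))"
  proof (intro SUP_cong refl)
    fix x assume "x \<in> coset N v"
    then show "coset N (r \<^bold>\<and> x) = coset N (r \<^bold>\<and> v)"
      using left_stable_wedge[OF assms, of "x - v"]
      by (simp add: coset_iff[OF sub] coset_eq_iff[OF sub] wedge_diff_right)
  qed
  also have "\<dots> = coset N (r \<^bold>\<and> v)"
    using fpi.subspace_0[OF sub] coset_iff[OF sub, of v v] by auto
  finally show ?thesis .
qed

lemma left_stable_subspace: "left_stable A N \<Longrightarrow> fpi.subspace N"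
  by (simp add: left_stable_def)

lemma submodule_sub_module_iff:
  assumes "left_stable A V" "V \<subseteq> FPi_on A"
  shows "submodule N (FPi_ring A) (sub_module V) \<longleftrightarrow> N \<subseteq> V \<and> left_stable A N"
proof
  assume "submodule N (FPi_ring A) (sub_module V)"
  then interpret submodule N "FPi_ring A" "sub_module V" .
  have NV: "N \<subseteq> V" using subset by simp
  have act: "r \<^bold>\<and> x \<in> N" if "r \<in> FPi_on A" "x \<in> N" for r x
    using smult_closed[of r x] that by simp
  obtain T where T: "T \<in> set_comps A" "\<And>v::'a fpi. v \<in> FPi_on A \<Longrightarrow> basis_elt T \<^bold>\<and> v = v"
    using wedge_unit by blast
  have "fpi.subspace N"
  proof (rule fpi.subspaceI)
    show "0 \<in> N" using one_closed by simp
    show "x + y \<in> N" if "x \<in> N" "y \<in> N" for x y using m_closed[of x y] that by simp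
    show "scal c x \<in> N" if "x \<in> N" for c x
    proof -
      have "scal c (basis_elt T) \<^bold>\<and> x \<in> N"
        using that T(1) subspace_FPi_on by (intro act fpi.subspace_scale) simp_all
      moreover have "x \<in> FPi_on A" using that NV assms(2) by blast
      ultimately show ?thesis using T(2) by (simp add: wedge_scal_left)
    qed
  qed
  then show "N \<subseteq> V \<and> left_stable A N" using NV act by (simp add: left_stable_def)
next
  assume N: "N \<subseteq> V \<and> left_stable A N"
  then have sub: "fpi.subspace N" and subV: "fpi.subspace V" using assms by (auto simp: left_stable_def)
  show "submodule N (FPi_ring A) (sub_module V)"
  proof (intro submodule.intro subgroup.intro submodule_axioms.intro)
    fix x assume x: "x \<in> N"
    have "inv\<^bsub>add_monoid (sub_module V)\<^esub> x = - x"
      unfolding m_inv_def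
    proof (rule the_equality)
      show "- x \<in> carrier (add_monoid (sub_module V)) \<and>
        x \<otimes>\<^bsub>add_monoid (sub_module V)\<^esub> - x = \<one>\<^bsub>add_monoid (sub_module V)\<^esub> \<and>
        - x \<otimes>\<^bsub>add_monoid (sub_module V)\<^esub> x = \<one>\<^bsub>add_monoid (sub_module V)\<^esub>"
        using x N fpi.subspace_neg[OF subV, of x] by auto
    qed (simp add: eq_neg_iff_add_eq_0 add.commute)
    then show "inv\<^bsub>add_monoid (sub_module V)\<^esub> x \<in> N"
      using fpi.subspace_neg[OF sub x] by simp
  qed (use N sub left_stable_wedge[of A N] in \<open>auto intro: fpi.subspace_0 fpi.subspace_add\<close>)
qed

definition simple_pair :: "nat set \<Rightarrow> 'f::field fpi set \<Rightarrow> 'f fpi set \<Rightarrow> bool" where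
  "simple_pair A N N' \<longleftrightarrow> left_stable A N \<and> left_stable A N' \<and> N \<subset> N' \<and> N' \<subseteq> FPi_on A \<and>
     (\<forall>K. left_stable A K \<longrightarrow> N \<subseteq> K \<longrightarrow> K \<subseteq> N' \<longrightarrow> K = N \<or> K = N')"

text \<open>
  The correspondence between submodules of the quotient and intermediate submodules. It turns questions about
  composition series into questions about chains of subspaces.
\<close>

lemma irreducible_quot_iff:
  fixes N N' :: "'f::field fpi set"
  assumes "left_stable A N" "left_stable A N'" "N \<subseteq> N'" "N' \<subseteq> FPi_on A"
  shows "irreducible_module (FPi_ring A) (quot_module (sub_module N') N) \<longleftrightarrow> simple_pair A N N'"
proof -
  let ?q = "quot_module (sub_module N') N"
  have sub: "fpi.subspace N" and sub': "fpi.subspace N'" using assms by (auto simp: left_stable_def)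
  have nontriv: "carrier ?q \<noteq> {zero ?q} \<longleftrightarrow> N \<noteq> N'"
    unfolding quot_carrier quot_zero
    using fpi.subspace_0[OF sub'] coset_eq_self_iff[OF sub] assms(3) by (auto simp: image_def)
  have up: "submodule (coset N ` K) (FPi_ring A) ?q" if K: "left_stable A K" "K \<subseteq> N'" for K
  proof (intro submodule.intro subgroup.intro submodule_axioms.intro)
    note subK = left_stable_subspace[OF K(1)]
    show "coset N ` K \<subseteq> carrier (add_monoid ?q)" using K(2) by (auto simp: quot_carrier)
    show "x \<otimes>\<^bsub>add_monoid ?q\<^esub> y \<in> coset N ` K" if "x \<in> coset N ` K" "y \<in> coset N ` K" for x y
      using that by (auto simp: quot_add[OF sub] intro: fpi.subspace_add[OF subK])
    show "\<one>\<^bsub>add_monoid ?q\<^esub> \<in> coset N ` K"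
      using fpi.subspace_0[OF subK] coset_0[of N] by (force simp: quot_zero)
    show "r \<odot>\<^bsub>?q\<^esub> x \<in> coset N ` K" if "r \<in> carrier (FPi_ring A)" "x \<in> coset N ` K" for r x
      using that left_stable_wedge[OF K(1)] by (auto simp: quot_smult[OF assms(1)])
    fix X assume "X \<in> coset N ` K"
    then obtain v where v: "v \<in> K" "X = coset N v" by blast
    have "inv\<^bsub>add_monoid ?q\<^esub> X = coset N (- v)"
      unfolding m_inv_def
    proof (rule the_equality)
      have "- v \<in> N'" using fpi.subspace_neg[OF sub'] v K(2) by blast
      then show "coset N (- v) \<in> carrier (add_monoid ?q) \<and>
        X \<otimes>\<^bsub>add_monoid ?q\<^esub> coset N (- v) = \<one>\<^bsub>add_monoid ?q\<^esub> \<and>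
        coset N (- v) \<otimes>\<^bsub>add_monoid ?q\<^esub> X = \<one>\<^bsub>add_monoid ?q\<^esub>"
        by (simp add: v quot_add[OF sub] quot_zero quot_carrier coset_0)
      fix Y assume Y: "Y \<in> carrier (add_monoid ?q) \<and>
        X \<otimes>\<^bsub>add_monoid ?q\<^esub> Y = \<one>\<^bsub>add_monoid ?q\<^esub> \<and>
        Y \<otimes>\<^bsub>add_monoid ?q\<^esub> X = \<one>\<^bsub>add_monoid ?q\<^esub>"
      then obtain w where w: "Y = coset N w" by (auto simp: quot_carrier)
      then have "w + v \<in> N"
        using Y by (simp add: v quot_add[OF sub] quot_zero coset_eq_self_iff[OF sub])
      then show "Y = coset N (- v)" by (simp add: w coset_eq_iff[OF sub])
    qed
    then show "inv\<^bsub>add_monoid ?q\<^esub> X \<in> coset N ` K"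
      using fpi.subspace_neg[OF subK v(1)] by simp
  qed
  have down: "\<exists>K. left_stable A K \<and> N \<subseteq> K \<and> K \<subseteq> N' \<and> \<K> = coset N ` K" if "submodule \<K> (FPi_ring A) ?q" for \<K>
  proof -
    from that interpret submodule \<K> "FPi_ring A" ?q .
    define K where "K = {v \<in> N'. coset N v \<in> \<K>}"
    have \<K>: "\<K> \<subseteq> coset N ` N'" using subset by (simp add: quot_carrier)
    have zero: "N \<in> \<K>" using one_closed by (simp add: quot_zero)
    have act: "r \<^bold>\<and> v \<in> K" if "r \<in> FPi_on A" "v \<in> K" for r v
      using smult_closed[of r "coset N v"] that left_stable_wedge[OF assms(2), of r v]
      by (simp add: K_def quot_smult[OF assms(1)])
    obtain T where T: "T \<in> set_comps A" "\<And>v::'f fpi. v \<in> FPi_on A \<Longrightarrow> basis_elt T \<^bold>\<and> v = v"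
      using wedge_unit by blast
    have "fpi.subspace K"
    proof (rule fpi.subspaceI)
      show "0 \<in> K" using zero fpi.subspace_0[OF sub'] by (simp add: K_def coset_0)
      show "x + y \<in> K" if "x \<in> K" "y \<in> K" for x y
        using m_closed[of "coset N x" "coset N y"] that fpi.subspace_add[OF sub', of x y]
        by (simp add: K_def quot_add[OF sub])
      show "scal c x \<in> K" if "x \<in> K" for c x
      proof -
        have "scal c (basis_elt T) \<^bold>\<and> x \<in> K"
          using that T(1) subspace_FPi_on by (intro act fpi.subspace_scale) simp_all
        moreover have "x \<in> FPi_on A" using that assms(4) by (auto simp: K_def)
        ultimately show ?thesis using T(2) by (simp add: wedge_scal_left)
      qed
    qed
    then have "left_stable A K" using act by (simp add: left_stable_def)
    moreover have "N \<subseteq> K"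
    proof
      fix x assume "x \<in> N"
      then show "x \<in> K" using zero assms(3) coset_eq_self_iff[OF sub, of x] by (auto simp: K_def)
    qed
    moreover have "\<K> = coset N ` K" using \<K> unfolding K_def by blast
    moreover have "K \<subseteq> N'" unfolding K_def by blast
    ultimately show ?thesis by blast
  qed
  have inj: "K = K'" if "coset N ` K = coset N ` K'" "left_stable A K" "left_stable A K'" "N \<subseteq> K" "N \<subseteq> K'" for K K'
  proof -
    have "K \<subseteq> K'" if eq: "coset N ` K = coset N ` K'" and sub'': "fpi.subspace K'" and NK: "N \<subseteq> K'" for K K'
    proof
      fix v assume "v \<in> K"
      then obtain w where "w \<in> K'" "coset N v = coset N w" using eq by blast
      then have "v - w \<in> K'" using NK by (auto simp: coset_eq_iff[OF sub])
      then show "v \<in> K'" using fpi.subspace_add[OF sub'' _ \<open>w \<in> K'\<close>, of "v - w"] by simp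
    qed
    with that show ?thesis by (simp add: left_stable_def subset_antisym)
  qed
  have image_N: "coset N ` N = {N}"
    using coset_eq_self_iff[OF sub] fpi.subspace_0[OF sub] by auto
  show ?thesis
  proof
    assume irr: "irreducible_module (FPi_ring A) ?q"
    have "K = N \<or> K = N'" if K: "left_stable A K" "N \<subseteq> K" "K \<subseteq> N'" for K
    proof -
      from irr up[OF K(1,3)] have "coset N ` K = {N} \<or> coset N ` K = coset N ` N'"
        by (simp add: irreducible_module_def quot_zero quot_carrier)
      then show ?thesis using inj[of K N] inj[of K N'] K assms image_N by auto
    qed
    moreover have "N \<noteq> N'" using irr nontriv by (simp add: irreducible_module_def)
    ultimately show "simple_pair A N N'" using assms by (auto simp: simple_pair_def)
  next
    assume sp: "simple_pair A N N'"
    have "\<K> = {N} \<or> \<K> = coset N ` N'" if "submodule \<K> (FPi_ring A) ?q" for \<K>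
    proof -
      from down[OF that] obtain K where "left_stable A K" "N \<subseteq> K" "K \<subseteq> N'" "\<K> = coset N ` K" by blast
      moreover from this sp have "K = N \<or> K = N'" unfolding simple_pair_def by blast
      ultimately show ?thesis using image_N by metis
    qed
    moreover have "N \<noteq> N'" using sp by (auto simp: simple_pair_def)
    ultimately show "irreducible_module (FPi_ring A) ?q"
      using nontriv by (simp add: irreducible_module_def quot_zero quot_carrier)
  qed
qed


section \<open>Characters\<close>

definition chi :: "scomp \<Rightarrow> scomp \<Rightarrow> 'f::field" where
  "chi X T = (if X \<preceq> T then 1 else 0)"

text \<open>
  The quotient \<open>N' / N\<close> is the line spanned by \<open>v0 + N\<close>, on which \<open>T\<close> acts as \<open>chi X T\<close>. Stating this by
  congruences modulo \<open>N\<close> avoids computing with cosets.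
\<close>

definition char_pair :: "nat set \<Rightarrow> scomp \<Rightarrow> 'f::field fpi set \<Rightarrow> 'f fpi set \<Rightarrow> 'f fpi \<Rightarrow> bool" where
  "char_pair A X N N' v0 \<longleftrightarrow> X \<in> set_comps A \<and> left_stable A N \<and> left_stable A N' \<and> N \<subseteq> N' \<and> v0 \<in> N' \<and> v0 \<notin> N \<and>
     (\<forall>v\<in>N'. \<exists>c. v - scal c v0 \<in> N) \<and>
     (\<forall>T\<in>set_comps A. \<forall>v\<in>N'. basis_elt T \<^bold>\<and> v - scal (chi X T) v \<in> N)"

text \<open>
  Choose \<open>X\<close> of maximal length among the set compositions acting on \<open>N' / N\<close> as a nonzero map. By
  maximality \<open>X \<and> T\<close> acts as \<open>chi X T\<close> times \<open>X\<close>, so the kernel of \<open>X\<close> is a submodule and thus zero. Since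
  \<open>X \<and> (X \<and> v - v) = 0\<close>, the action of \<open>X\<close> is the identity, and \<open>T\<close> acts by the scalar \<open>chi X T\<close>. Then every line
  is a submodule, so the quotient is one.
\<close>

lemma simple_pair_char:
  fixes N N' :: "'f::field fpi set"
  assumes "finite A" "simple_pair A N N'"
  shows "\<exists>X v0. char_pair A X N N' v0"
proof -
  have st: "left_stable A N" "left_stable A N'" "N \<subset> N'" "N' \<subseteq> FPi_on A"
    and simple: "\<And>K. left_stable A K \<Longrightarrow> N \<subseteq> K \<Longrightarrow> K \<subseteq> N' \<Longrightarrow> K = N \<or> K = N'"
    using assms(2) by (auto simp: simple_pair_def)
  note sub = left_stable_subspace[OF st(1)] and sub' = left_stable_subspace[OF st(2)]
  obtain u where u: "u \<in> N'" "u \<notin> N" using st(3) by blast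
  define act where "act X \<longleftrightarrow> X \<in> set_comps A \<and> (\<exists>v\<in>N'. basis_elt X \<^bold>\<and> v \<notin> N)" for X
  obtain T where T: "T \<in> set_comps A" "\<And>v::'f fpi. v \<in> FPi_on A \<Longrightarrow> basis_elt T \<^bold>\<and> v = v"
    using wedge_unit by blast
  have "basis_elt T \<^bold>\<and> u = u" using T(2) u(1) st(4) by blast
  with T(1) u have "act T" unfolding act_def by (auto intro!: bexI[of _ u])
  moreover have "\<forall>X. act X \<longrightarrow> length X < Suc (card (Pow A))"
    using set_comps_length_le[OF assms(1)] by (auto simp: act_def less_Suc_eq_le)
  ultimately obtain X where X: "act X" "\<And>Y. act Y \<Longrightarrow> length Y \<le> length X"
    using ex_has_greatest_nat[of act T length "Suc (card (Pow A))"] by (metis less_imp_le)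
  have Xc: "X \<in> set_comps A" using X(1) by (simp add: act_def)
  have XT: "basis_elt X \<^bold>\<and> (basis_elt T \<^bold>\<and> v) - scal (chi X T) (basis_elt X \<^bold>\<and> v) \<in> N"
    if T: "T \<in> set_comps A" and v: "v \<in> N'" for T v
  proof (cases "X \<preceq> T")
    case True
    then show ?thesis
      using meet_eq_left[OF Xc T] fpi.subspace_0[OF sub]
      by (simp add: wedge_assoc[symmetric] wedge_basis_same[OF Xc T] chi_def)
  next
    case False
    then have "\<not> act (meet X T)"
      using X(2)[of "meet X T"] length_meet_greater[OF Xc T] by linarith
    then have "basis_elt (meet X T) \<^bold>\<and> v \<in> N"
      using v meet_in_set_comps[OF Xc T] by (auto simp: act_def)
    then show ?thesis using False
      by (simp add: wedge_assoc[symmetric] wedge_basis_same[OF Xc T] chi_def)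
  qed
  \<comment> \<open>The kernel of \<open>X\<close> on the quotient.\<close>
  define K where "K = {v \<in> N'. basis_elt X \<^bold>\<and> v \<in> N}"
  have "left_stable A K"
    unfolding left_stable_def
  proof (intro conjI ballI fpi.subspaceI)
    show "0 \<in> K" using fpi.subspace_0[OF sub] fpi.subspace_0[OF sub'] by (simp add: K_def)
    show "x + y \<in> K" if "x \<in> K" "y \<in> K" for x y
      using that fpi.subspace_add[OF sub] fpi.subspace_add[OF sub'] by (simp add: K_def wedge_add_right)
    show "scal c x \<in> K" if "x \<in> K" for c x
      using that fpi.subspace_scale[OF sub] fpi.subspace_scale[OF sub'] by (simp add: K_def wedge_scal_right)
    fix T v assume T: "T \<in> set_comps A" and v: "v \<in> K"
    have "basis_elt T \<^bold>\<and> v \<in> N'" using T v st(2) by (simp add: K_def left_stable_def)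
    moreover have "basis_elt X \<^bold>\<and> (basis_elt T \<^bold>\<and> v) \<in> N"
      using fpi.subspace_add[OF sub XT[OF T, of v] fpi.subspace_scale[OF sub, of "basis_elt X \<^bold>\<and> v" "chi X T"]] v
      by (simp add: K_def)
    ultimately show "basis_elt T \<^bold>\<and> v \<in> K" by (simp add: K_def)
  qed
  moreover have "N \<subseteq> K" using st Xc by (auto simp: K_def left_stable_def)
  moreover have "K \<subseteq> N'" by (auto simp: K_def)
  moreover have "K \<noteq> N'" using X(1) by (auto simp: K_def act_def)
  ultimately have KN: "K = N" using simple by blast
  have Xv: "basis_elt X \<^bold>\<and> v - v \<in> N" if v: "v \<in> N'" for v
  proof -
    have Xv': "basis_elt X \<^bold>\<and> v \<in> N'" using v Xc st(2) by (simp add: left_stable_def)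
    have "basis_elt X \<^bold>\<and> (basis_elt X \<^bold>\<and> v - v) = 0"
      by (simp add: wedge_diff_right wedge_assoc[symmetric] wedge_basis_same[OF Xc Xc]
          meet_eq_left[OF Xc Xc refines_refl])
    then have "basis_elt X \<^bold>\<and> v - v \<in> K"
      using fpi.subspace_diff[OF sub' Xv' v] fpi.subspace_0[OF sub] by (simp add: K_def)
    then show ?thesis by (simp add: KN)
  qed
  have char: "basis_elt T \<^bold>\<and> v - scal (chi X T) v \<in> N" if T: "T \<in> set_comps A" and v: "v \<in> N'" for T v
  proof -
    have Tv: "basis_elt T \<^bold>\<and> v \<in> N'" using T v st(2) by (simp add: left_stable_def)
    have "basis_elt X \<^bold>\<and> (basis_elt T \<^bold>\<and> v - scal (chi X T) v) \<in> N"
      using XT[OF T v] by (simp add: wedge_diff_right wedge_scal_right)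
    then have "basis_elt T \<^bold>\<and> v - scal (chi X T) v \<in> K"
      using fpi.subspace_diff[OF sub' Tv fpi.subspace_scale[OF sub' v]] by (simp add: K_def)
    then show ?thesis by (simp add: KN)
  qed
  \<comment> \<open>The preimage of the line spanned by \<open>u\<close>; it is a submodule because all \<open>T\<close> act as scalars.\<close>
  define K' where "K' = {v \<in> N'. \<exists>c. v - scal c u \<in> N}"
  have "left_stable A K'"
    unfolding left_stable_def
  proof (intro conjI ballI fpi.subspaceI)
    show "0 \<in> K'"
      using fpi.subspace_0[OF sub] fpi.subspace_0[OF sub'] by (auto simp: K'_def intro!: exI[of _ 0])
    show "x + y \<in> K'" if xy: "x \<in> K'" "y \<in> K'" for x y
    proof -
      from xy obtain a b where "x \<in> N'" "y \<in> N'" "x - scal a u \<in> N" "y - scal b u \<in> N" by (auto simp: K'_def)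
      moreover from this have "(x + y) - scal (a + b) u \<in> N"
        using fpi.subspace_add[OF sub, of "x - scal a u" "y - scal b u"]
        by (simp add: fpi.scale_left_distrib algebra_simps)
      ultimately show ?thesis using fpi.subspace_add[OF sub'] by (auto simp: K'_def)
    qed
    show sc: "scal d x \<in> K'" if x: "x \<in> K'" for d x
    proof -
      from x obtain a where "x \<in> N'" "x - scal a u \<in> N" by (auto simp: K'_def)
      moreover from this have "scal d x - scal (d * a) u \<in> N"
        using fpi.subspace_scale[OF sub, of "x - scal a u" d] by (simp add: fpi.scale_right_diff_distrib)
      ultimately show ?thesis using fpi.subspace_scale[OF sub'] by (auto simp: K'_def)
    qed
    fix T v assume T: "T \<in> set_comps A" and v: "v \<in> K'"
    then obtain c where c: "v \<in> N'" "v - scal c u \<in> N" by (auto simp: K'_def)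
    have "basis_elt T \<^bold>\<and> v - scal (chi X T * c) u \<in> N"
      using fpi.subspace_add[OF sub char[OF T c(1)] fpi.subspace_scale[OF sub c(2), of "chi X T"]]
      by (simp add: fpi.scale_right_diff_distrib)
    moreover have "basis_elt T \<^bold>\<and> v \<in> N'" using T c st(2) by (simp add: left_stable_def)
    ultimately show "basis_elt T \<^bold>\<and> v \<in> K'" by (auto simp: K'_def)
  qed
  moreover have "N \<subseteq> K'" using st(3) by (auto simp: K'_def intro!: exI[of _ 0])
  moreover have "K' \<subseteq> N'" by (auto simp: K'_def)
  moreover have "u \<in> K'" using u fpi.subspace_0[OF sub] by (auto simp: K'_def intro!: exI[of _ 1])
  ultimately have "K' = N'" using simple u by blast
  then have "\<forall>v\<in>N'. \<exists>c. v - scal c u \<in> N" by (auto simp: K'_def)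
  then have "char_pair A X N N' u"
    using Xc st u char by (simp add: char_pair_def psubset_imp_subset)
  then show ?thesis by blast
qed

lemma char_pair_coord_unique:
  fixes c d :: "'f::field"
  assumes "char_pair A X N N' v0" "v - scal c v0 \<in> N" "w - scal d v0 \<in> N" "v - w \<in> N"
  shows "c = d"
proof (rule ccontr)
  assume "c \<noteq> d"
  have sub: "fpi.subspace N" using assms(1) by (simp add: char_pair_def left_stable_def)
  have "(v - w) - (v - scal c v0) + (w - scal d v0) \<in> N"
    by (rule fpi.subspace_add[OF sub fpi.subspace_diff[OF sub assms(4,2)] assms(3)])
  then have "scal (c - d) v0 \<in> N" by (simp add: fpi.scale_left_diff_distrib algebra_simps)
  then have "scal (inverse (c - d)) (scal (c - d) v0) \<in> N" by (rule fpi.subspace_scale[OF sub])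
  then show False using assms(1) \<open>c \<noteq> d\<close> by (simp add: char_pair_def)
qed

lemma chi_cong: "set X = set X' \<Longrightarrow> chi X T = chi X' T"
  by (simp add: chi_def refines_def)

lemma char_pair_cong:
  assumes "char_pair A X N N' v0" "X' \<in> set_comps A" "set X = set X'"
  shows "char_pair A X' N N' v0"
  using assms by (simp add: char_pair_def chi_cong[OF assms(3)])

text \<open>
  Coordinates with respect to \<open>v0\<close> and \<open>w0\<close> identify both quotients with the same line.
\<close>

lemma char_pair_iso:
  fixes N N' M M' :: "'f::field fpi set"
  assumes N: "char_pair A X N N' v0" and M: "char_pair A X M M' w0"
  shows "module_iso (FPi_ring A) (quot_module (sub_module N') N) (quot_module (sub_module M') M)"
proof -
  let ?q = "quot_module (sub_module N') N" and ?p = "quot_module (sub_module M') M"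
  have subN: "fpi.subspace N" "fpi.subspace N'" and subM: "fpi.subspace M" "fpi.subspace M'"
    and stN: "left_stable A N" "left_stable A N'" and stM: "left_stable A M" "left_stable A M'"
    and v0: "v0 \<in> N'" and w0: "w0 \<in> M'"
    using N M by (auto simp: char_pair_def left_stable_def)
  have "\<forall>v\<in>N'. \<exists>c. v - scal c v0 \<in> N" using N by (simp add: char_pair_def)
  from bchoice[OF this] obtain crd where crd: "v - scal (crd v) v0 \<in> N" if "v \<in> N'" for v by blast
  have crd_eq: "crd v = c" if "v \<in> N'" "v - scal c v0 \<in> N" for v c
    using char_pair_coord_unique[OF N crd[OF that(1)] that(2)] fpi.subspace_0[OF subN(1)] by simp
  define h where "h X = (let v = (SOME v. v \<in> N' \<and> X = coset N v) in coset M (scal (crd v) w0))" for X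
  have h: "h (coset N v) = coset M (scal (crd v) w0)" if v: "v \<in> N'" for v
  proof -
    define w where "w = (SOME w. w \<in> N' \<and> coset N v = coset N w)"
    have "w \<in> N' \<and> coset N v = coset N w"
      unfolding w_def by (rule someI[of _ v]) (simp add: v)
    then have "crd v = crd w"
      using char_pair_coord_unique[OF N crd crd] v by (simp add: coset_eq_iff[OF subN(1)])
    then show ?thesis by (simp add: h_def w_def)
  qed
  have scw: "scal c w0 \<in> M'" for c using w0 fpi.subspace_scale[OF subM(2)] by blast
  have inj: "inj_on h (coset N ` N')"
  proof (rule inj_onI)
    fix X Y assume "X \<in> coset N ` N'" "Y \<in> coset N ` N'" "h X = h Y"
    then obtain v w where vw: "v \<in> N'" "w \<in> N'" "X = coset N v" "Y = coset N w"
      "scal (crd v) w0 - scal (crd w) w0 \<in> M" by (auto simp: h coset_eq_iff[OF subM(1)])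
    have "crd v = crd w"
      using char_pair_coord_unique[OF M, of "scal (crd v) w0" "crd v" "scal (crd w) w0" "crd w"] vw(5)
        fpi.subspace_0[OF subM(1)] by simp
    then have "v - w \<in> N"
      using fpi.subspace_diff[OF subN(1) crd[OF vw(1)] crd[OF vw(2)]] by simp
    then show "X = Y" by (simp add: vw coset_eq_iff[OF subN(1)])
  qed
  have surj: "h ` coset N ` N' = coset M ` M'"
  proof (intro equalityI subsetI)
    fix Y assume "Y \<in> coset M ` M'"
    then obtain w where w: "w \<in> M'" "Y = coset M w" by blast
    then obtain c where c: "w - scal c w0 \<in> M" using M by (auto simp: char_pair_def)
    have sv: "scal c v0 \<in> N'" using v0 fpi.subspace_scale[OF subN(2)] by blast
    then have "crd (scal c v0) = c" using fpi.subspace_0[OF subN(1)] by (intro crd_eq) simp_all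
    then have "h (coset N (scal c v0)) = Y"
      using c by (simp add: h[OF sv] w coset_eq_iff[OF subM(1)] fpi.subspace_diff[OF subM(1)])
        (metis coset_eq_iff[OF subM(1)])
    with sv show "Y \<in> h ` coset N ` N'" by blast
  qed (auto simp: h scw)
  have add: "h (coset N (v + w)) = add ?p (h (coset N v)) (h (coset N w))" if vw: "v \<in> N'" "w \<in> N'" for v w
  proof -
    have vw': "v + w \<in> N'" using vw fpi.subspace_add[OF subN(2)] by blast
    have "(v - scal (crd v) v0) + (w - scal (crd w) v0) \<in> N"
      using crd[OF vw(1)] crd[OF vw(2)] by (rule fpi.subspace_add[OF subN(1)])
    then have "crd (v + w) = crd v + crd w"
      using vw' by (intro crd_eq) (simp_all add: fpi.scale_left_distrib algebra_simps)
    then show ?thesis by (simp add: h vw vw' quot_add[OF subM(1)] fpi.scale_left_distrib)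
  qed
  have smult: "h (coset N (r \<^bold>\<and> v)) = coset M (r \<^bold>\<and> scal (crd v) w0)" if r: "r \<in> FPi_on A" and v: "v \<in> N'" for r v
  proof -
    have rv: "r \<^bold>\<and> v \<in> N'" using left_stable_wedge[OF stN(2) r v] .
    have "\<exists>c. r \<^bold>\<and> v - scal c v \<in> N \<and> (\<forall>w\<in>M'. r \<^bold>\<and> w - scal c w \<in> M)"
      using r
    proof (induction r rule: FPi_on_induct)
      case (basis T)
      then show ?case using N M v by (intro exI[of _ "chi X T"]) (simp add: char_pair_def)
    next
      case zero
      then show ?case using fpi.subspace_0[OF subN(1)] fpi.subspace_0[OF subM(1)]
        by (intro exI[of _ 0]) simp
    next
      case (add f g)
      then obtain a b where ab: "f \<^bold>\<and> v - scal a v \<in> N" "\<forall>w\<in>M'. f \<^bold>\<and> w - scal a w \<in> M"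
        "g \<^bold>\<and> v - scal b v \<in> N" "\<forall>w\<in>M'. g \<^bold>\<and> w - scal b w \<in> M" by blast
      have eq: "(f + g) \<^bold>\<and> w - scal (a + b) w = (f \<^bold>\<and> w - scal a w) + (g \<^bold>\<and> w - scal b w)" for w :: "'f fpi"
        by (simp add: wedge_add_left fpi.scale_left_distrib)
      show ?case
        using ab fpi.subspace_add[OF subN(1)] fpi.subspace_add[OF subM(1)]
        by (intro exI[of _ "a + b"]) (simp add: eq)
    next
      case (scal d f)
      then obtain a where a: "f \<^bold>\<and> v - scal a v \<in> N" "\<forall>w\<in>M'. f \<^bold>\<and> w - scal a w \<in> M" by blast
      have eq: "scal d f \<^bold>\<and> w - scal (d * a) w = scal d (f \<^bold>\<and> w - scal a w)" for w :: "'f fpi"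
        by (simp add: wedge_scal_left fpi.scale_right_diff_distrib)
      show ?case
        using a fpi.subspace_scale[OF subN(1)] fpi.subspace_scale[OF subM(1)]
        by (intro exI[of _ "d * a"]) (simp add: eq)
    qed
    then obtain c where c: "r \<^bold>\<and> v - scal c v \<in> N" "\<forall>w\<in>M'. r \<^bold>\<and> w - scal c w \<in> M" by blast
    have "(r \<^bold>\<and> v - scal c v) + scal c (v - scal (crd v) v0) \<in> N"
      using c(1) crd[OF v] by (intro fpi.subspace_add[OF subN(1)] fpi.subspace_scale[OF subN(1)])
    then have "crd (r \<^bold>\<and> v) = c * crd v"
      using rv by (intro crd_eq) (simp_all add: fpi.scale_right_diff_distrib)
    moreover have "r \<^bold>\<and> scal (crd v) w0 - scal c (scal (crd v) w0) \<in> M" using c(2) scw by blast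
    ultimately show ?thesis
      by (simp add: h[OF rv] coset_eq_iff[OF subM(1), of "r \<^bold>\<and> scal (crd v) w0", symmetric] eq_commute)
  qed
  have "h \<in> iso (add_monoid ?q) (add_monoid ?p)"
    unfolding iso_def hom_def bij_betw_def
    using inj surj add by (auto simp: quot_carrier quot_add[OF subN(1)])
  moreover have "h (r \<odot>\<^bsub>?q\<^esub> x) = r \<odot>\<^bsub>?p\<^esub> h x" if "r \<in> carrier (FPi_ring A)" "x \<in> carrier ?q" for r x
    using that smult by (auto simp: quot_carrier quot_smult[OF stN(1)] quot_smult[OF stM(1)] h)
  ultimately show ?thesis unfolding module_iso_def by blast
qed

text \<open>
  An isomorphism preserves the scalars by which set compositions act, and \<open>chi X\<close> determines
  the blocks of \<open>X\<close>: the characters of \<open>X\<close> and \<open>Y\<close> agree at \<open>X\<close> and at \<open>Y\<close> only if these refine each other.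
\<close>

lemma char_pair_iso_imp:
  fixes N N' M M' :: "'f::field fpi set"
  assumes N: "char_pair A X N N' v0" and M: "char_pair A Y M M' w0"
    and iso: "module_iso (FPi_ring A) (quot_module (sub_module N') N) (quot_module (sub_module M') M)"
  shows "set X = set Y"
proof -
  let ?q = "quot_module (sub_module N') N" and ?p = "quot_module (sub_module M') M"
  have subN: "fpi.subspace N" "fpi.subspace N'" and subM: "fpi.subspace M" "fpi.subspace M'"
    and stN: "left_stable A N" "left_stable A N'" and stM: "left_stable A M" "left_stable A M'"
    and v0: "v0 \<in> N'" "v0 \<notin> N" and XY: "X \<in> set_comps A" "Y \<in> set_comps A"
    using N M by (auto simp: char_pair_def left_stable_def)
  from iso obtain h where h: "h \<in> iso (add_monoid ?q) (add_monoid ?p)"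
    "\<And>r x. r \<in> FPi_on A \<Longrightarrow> x \<in> carrier ?q \<Longrightarrow> h (r \<odot>\<^bsub>?q\<^esub> x) = r \<odot>\<^bsub>?p\<^esub> h x"
    unfolding module_iso_def by auto
  have hom: "h (add ?q x y) = add ?p (h x) (h y)" if "x \<in> carrier ?q" "y \<in> carrier ?q" for x y
    using h(1) that by (simp add: iso_def hom_def)
  have into: "h x \<in> carrier ?p" if "x \<in> carrier ?q" for x
    using h(1) that by (auto simp: iso_def hom_def)
  have inj: "inj_on h (carrier ?q)" using h(1) by (simp add: iso_def bij_betw_def)
  have Nq: "N \<in> carrier ?q"
    using fpi.subspace_0[OF subN(2)] coset_0[of N] by (force simp: quot_carrier)
  have hN: "h N = M"
  proof -
    obtain w where w: "h N = coset M w" using into[OF Nq] by (auto simp: quot_carrier)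
    have "add ?q N N = N" using quot_add[OF subN(1), of N' 0 0] by (simp add: coset_0)
    then have "coset M w = coset M (w + w)"
      using hom[OF Nq Nq] w by (simp add: quot_add[OF subM(1)])
    then have "w \<in> M" using fpi.subspace_neg[OF subM(1), of "- w"] by (simp add: coset_eq_iff[OF subM(1)])
    then show ?thesis using w coset_eq_self_iff[OF subM(1)] by simp
  qed
  have v0q: "coset N v0 \<in> carrier ?q" using v0 by (simp add: quot_carrier)
  obtain w where w: "w \<in> M'" "h (coset N v0) = coset M w"
    using into[OF v0q] by (auto simp: quot_carrier)
  have "coset N v0 \<noteq> N" using v0 coset_eq_self_iff[OF subN(1)] by blast
  then have "coset M w \<noteq> M" using inj_onD[OF inj _ v0q Nq] w hN by auto
  then have wM: "w \<notin> M" using coset_eq_self_iff[OF subM(1)] by blast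
  have eq: "(chi X T :: 'f) = chi Y T" if T: "T \<in> set_comps A" for T
  proof -
    have bT: "(basis_elt T :: 'f fpi) \<in> FPi_on A" using T by simp
    have hT: "h (coset N (basis_elt T \<^bold>\<and> v0)) = coset M (basis_elt T \<^bold>\<and> w)"
      using h(2)[OF bT v0q] w by (simp add: quot_smult[OF stN(1) bT] quot_smult[OF stM(1) bT])
    have NT: "basis_elt T \<^bold>\<and> v0 - scal (chi X T) v0 \<in> N" using N T v0 by (simp add: char_pair_def)
    have MT: "basis_elt T \<^bold>\<and> w - scal (chi Y T) w \<in> M" using M T w by (simp add: char_pair_def)
    have "basis_elt T \<^bold>\<and> w - scal (chi X T) w \<in> M"
    proof (cases "X \<preceq> T")
      case True
      then have "coset N (basis_elt T \<^bold>\<and> v0) = coset N v0"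
        using NT by (simp add: chi_def coset_eq_iff[OF subN(1)])
      with hT w True show ?thesis by (simp add: chi_def coset_eq_iff[OF subM(1), symmetric])
    next
      case False
      then have "coset N (basis_elt T \<^bold>\<and> v0) = N"
        using NT by (simp add: chi_def coset_eq_self_iff[OF subN(1)])
      then have "coset M (basis_elt T \<^bold>\<and> w) = M" using hT hN by simp
      with False show ?thesis by (simp add: chi_def coset_eq_self_iff[OF subM(1)])
    qed
    with MT have "scal (chi X T) w - scal (chi Y T) w \<in> M"
      using fpi.subspace_diff[OF subM(1) MT, of "basis_elt T \<^bold>\<and> w - scal (chi X T) w"] by simp
    then show ?thesis
      using wM fpi.subspace_neg[OF subM(1), of "- w"] by (auto simp: chi_def split: if_splits)
  qed
  have "X \<preceq> Y" "Y \<preceq> X"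
    using eq[OF XY(1)] eq[OF XY(2)] refines_refl[of X] refines_refl[of Y]
    by (auto simp: chi_def split: if_splits)
  then show ?thesis
    using refines_length[OF XY] refines_length[OF XY(2,1)] by simp
qed


section \<open>The action of \<open>e_P\<close> on a one-dimensional quotient\<close>

text \<open>
  On \<open>\<Lambda>\<^sub>X\<close> this is the functional that takes the value \<open>1\<close> at all \<open>e\<^sub>R\<close> with \<open>R \<approx> X\<close>: the terms of \<open>e\<^sub>R\<close>
  that are longer than \<open>R\<close> do not contribute.
\<close>

definition eps :: "scomp \<Rightarrow> 'f::field fpi \<Rightarrow> 'f" where
  "eps X g = (\<Sum>W | mset W = mset X. coeff g W)"

lemma eps_0 [simp]: "eps X 0 = 0"
  and eps_add: "eps X (f + g) = eps X f + eps X g"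
  and eps_scal: "eps X (scal c f) = c * eps X f"
  by (simp_all add: eps_def lookup_add sum.distrib sum_distrib_left)

lemma finite_perms: "finite {W. mset W = mset X}"
proof (rule finite_subset)
  show "{W. mset W = mset X} \<subseteq> {W. set W \<subseteq> set X \<and> length W = length X}"
    by (auto dest: mset_eq_setD mset_eq_length)
qed (simp add: finite_lists_length_eq)

lemma eps_e_comp:
  assumes "finite A" "R \<in> set_comps A" "mset R = mset X"
  shows "eps X (e_comp R :: 'f::field fpi) = 1"
proof -
  have "eps X (e_comp R :: 'f fpi) = (\<Sum>W | mset W = mset X. if W = R then 1 else 0)"
    unfolding eps_def
  proof (intro sum.cong refl)
    fix W assume "W \<in> {W. mset W = mset X}"
    then have "length W \<le> length R" using mset_eq_length[of W R] assms(3) by simp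
    then show "coeff (e_comp R :: 'f fpi) W = (if W = R then 1 else 0)"
      using lookup_e_comp[OF assms(1,2)] by blast
  qed
  then show ?thesis using assms(3) by (simp add: finite_perms)
qed

text \<open>
  This computes the linear extension of \<open>chi X\<close>: its value at \<open>f\<close> is \<open>eps X (f \<and> e\<^sub>R)\<close> for any
  \<open>R \<approx> X\<close>. The freedom in the choice of \<open>R\<close> is what makes the evaluation at \<open>e\<^sub>P\<close> easy.
\<close>

lemma eps_basis_wedge:
  assumes "finite A" "X \<in> set_comps A" "mset R = mset X" "T \<in> set_comps A"
  shows "eps X (basis_elt T \<^bold>\<and> e_comp R :: 'f::field fpi) = chi X T"
proof -
  have R: "R \<in> set_comps A" using set_comps_perm[OF assms(2,3)] .
  have ref: "R \<preceq> T \<longleftrightarrow> X \<preceq> T" using mset_eq_setD[OF assms(3)] by (simp add: refines_def)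
  show ?thesis
  proof (cases "R \<preceq> T")
    case True
    have "eps X (e_comp (meet T R) :: 'f fpi) = 1"
      using mset_meet_refines[OF assms(4) R True] assms
      by (intro eps_e_comp[OF assms(1) meet_in_set_comps[OF assms(4) R]]) simp
    with True ref show ?thesis by (simp add: wedge_e_comp_refines[OF assms(1,4) R True] chi_def)
  next
    case False
    with ref show ?thesis by (simp add: wedge_e_comp_not_refines[OF assms(1,4) R False] chi_def)
  qed
qed

lemma eps_wedge_perm:
  fixes f :: "'f::field fpi"
  assumes "finite A" "X \<in> set_comps A" "mset R = mset X" "f \<in> FPi_on A"
  shows "eps X (f \<^bold>\<and> e_comp R) = eps X (f \<^bold>\<and> e_comp X)"
  using assms(4)
  by (induction f rule: FPi_on_induct)
    (simp_all add: eps_basis_wedge[OF assms(1,2)] assms(3) wedge_add_left wedge_scal_left eps_add eps_scal)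

lemma char_pair_act:
  fixes f v :: "'f::field fpi"
  assumes "finite A" "char_pair A X N N' v0" "v \<in> N'" "f \<in> FPi_on A"
  shows "f \<^bold>\<and> v - scal (eps X (f \<^bold>\<and> e_comp X)) v \<in> N"
proof -
  have sub: "fpi.subspace N" and X: "X \<in> set_comps A"
    using assms(2) by (auto simp: char_pair_def left_stable_def)
  from assms(4) show ?thesis
  proof (induction f rule: FPi_on_induct)
    case (basis T)
    then show ?case
      using assms(2,3) by (simp add: char_pair_def eps_basis_wedge[OF assms(1) X refl basis])
  next
    case zero
    then show ?case using fpi.subspace_0[OF sub] by simp
  next
    case (add f g)
    have "(f + g) \<^bold>\<and> v - scal (eps X ((f + g) \<^bold>\<and> e_comp X)) v
       = (f \<^bold>\<and> v - scal (eps X (f \<^bold>\<and> e_comp X)) v) + (g \<^bold>\<and> v - scal (eps X (g \<^bold>\<and> e_comp X)) v)"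
      by (simp add: wedge_add_left eps_add fpi.scale_left_distrib)
    with add show ?case using fpi.subspace_add[OF sub] by simp
  next
    case (scal c f)
    have "scal c f \<^bold>\<and> v - scal (eps X (scal c f \<^bold>\<and> e_comp X)) v
       = scal c (f \<^bold>\<and> v - scal (eps X (f \<^bold>\<and> e_comp X)) v)"
      by (simp add: wedge_scal_left eps_scal fpi.scale_right_diff_distrib)
    with scal show ?case using fpi.subspace_scale[OF sub] by simp
  qed
qed

lemma set_comps_whole_block:
  assumes "D \<in> set_comps b" "b \<in> set D"
  shows "D = [b]"
proof -
  have "Y = b" if "Y \<in> set D" for Y
    using set_comps_disjoint[OF assms(1) that assms(2)] set_comps_subset[OF assms(1) that]
      set_comps_nonempty[OF assms(1) that] by blast
  then have "set D = {b}" using assms(2) by blast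
  then have "length D = 1"
    using distinct_card[OF set_comps_distinct[OF assms(1)]] by simp
  then obtain Y where "D = [Y]" by (cases D) auto
  with assms(2) show ?thesis by simp
qed

text \<open>
  Each bracket has just one entry here. For \<open>R = P\<close> this says that \<open>e\<^sub>P\<close> is idempotent.
\<close>

lemma e_comp_wedge_perm:
  assumes "finite A" "P \<in> set_comps A" "mset R = mset P"
  shows "e_comp P \<^bold>\<and> e_comp R = (e_comp P :: 'f::field fpi)"
proof -
  have R: "R \<in> set_comps A" "set R = set P" "R \<preceq> P"
    using set_comps_perm[OF assms(2,3)] mset_eq_setD[OF assms(3)] by (auto simp: refines_def)
  have fil: "inside b R = [b]" if "b \<in> set P" for b
    using set_comps_filter[OF R(1) assms(2) R(3) that] R(2) that by (intro set_comps_whole_block) simp_all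
  have "[b] \<in> set_comps_dag b" if "b \<in> set P" for b
    using set_comps_nonempty[OF assms(2) that] finite_comp_block[OF assms(1,2) that]
    by (simp add: set_comps_dag_def)
  then have "e_comp P \<^bold>\<and> e_comp R = (dag_elt (map (\<lambda>b. inside b R) P) :: 'f fpi)"
    unfolding e_comp_wedge_e_comp[OF assms(1,2) R(1,3)] by (simp add: fil)
  also have "map (\<lambda>b. inside b R) P = map (\<lambda>b. [b]) P" using fil by (intro map_cong) auto
  also have "(dag_elt (map (\<lambda>b. [b]) P) :: 'f fpi) = e_comp P"
    by (simp add: dag_elt_def e_comp_def comp_def e_lin_def)
  finally show ?thesis .
qed

text \<open>
  Suppose that \<open>X\<close> properly refines \<open>P\<close>, and let \<open>b\<close> be a block of \<open>P\<close> that contains at least two blocks of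
  \<open>X\<close>. Moving to the end of \<open>X\<close> a block inside \<open>b\<close> that does not contain \<open>Min b\<close> gives a rearrangement \<open>X'\<close> with
  \<open>e\<^sub>P \<and> e\<^bsub>X'\<^esub> = 0\<close>, and \<open>eps X\<close> takes the same value at \<open>e\<^sub>P \<and> e\<^sub>X\<close> and at \<open>e\<^sub>P \<and> e\<^bsub>X'\<^esub>\<close>.
\<close>

lemma eps_e_comp_wedge:
  assumes "finite A" "P \<in> set_comps A" "X \<in> set_comps A"
  shows "eps X (e_comp P \<^bold>\<and> e_comp X :: 'f::field fpi) = (if set X = set P then 1 else 0)"
proof (cases "set X = set P")
  case True
  then have "mset X = mset P" using set_comps_mset_eq_iff[OF assms(3,2)] by blast
  then show ?thesis
    using e_comp_wedge_perm[OF assms(1,2), of X, where 'f='f] eps_e_comp[OF assms(1,2), of X, where 'f='f] True by simp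
next
  case False
  show ?thesis
  proof (cases "X \<preceq> P")
    case nref: False
    with False show ?thesis by (simp add: e_comp_wedge_not_refines[OF assms nref])
  next
    case True
    obtain b where b: "b \<in> set P" "b \<notin> set X"
    proof -
      have "\<exists>b\<in>set P. b \<notin> set X"
      proof (rule ccontr)
        assume "\<not> ?thesis"
        then have PX: "set P \<subseteq> set X" by blast
        have "Y \<in> set P" if Y: "Y \<in> set X" for Y
        proof -
          obtain b where "b \<in> set P" "Y \<subseteq> b" using True Y by (auto simp: refines_def)
          then show ?thesis
            using set_comps_disjoint[OF assms(3) Y, of b] set_comps_nonempty[OF assms(3) Y] PX by blast
        qed
        with PX False show False by blast
      qed
      with that show thesis by blast
    qed
    have bne: "b \<noteq> {}" "finite b"
      using set_comps_nonempty[OF assms(2) b(1)] finite_comp_block[OF assms(1,2) b(1)] .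
    let ?D = "inside b X"
    have D: "?D \<in> set_comps b" using set_comps_filter[OF assms(3,2) True b(1)] .
    obtain d where d: "d \<in> set ?D" "Min b \<in> d"
      using set_comps_Union[OF D] Min_in[OF bne(2,1)] by blast
    have "d \<noteq> b" "d \<subseteq> b" using d(1) b(2) by auto
    then obtain a where a: "a \<in> b" "a \<notin> d" by blast
    obtain Y where Y: "Y \<in> set ?D" "a \<in> Y" using set_comps_Union[OF D] a(1) by blast
    have minY: "Min b \<notin> Y"
      using set_comps_disjoint[OF D Y(1) d(1)] a d Y by blast
    \<comment> \<open>\<open>Y\<close> is a block of \<open>X\<close> inside \<open>b\<close> other than the one with \<open>Min b\<close>.\<close>
    define X' where "X' = filter (\<lambda>Z. Z \<noteq> Y) X @ [Y]"
    have "set X' = set X" "distinct X'"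
      using Y(1) set_comps_distinct[OF assms(3)] by (auto simp: X'_def)
    then have m: "mset X' = mset X"
      using set_comps_distinct[OF assms(3)] by (simp add: set_eq_iff_mset_eq_distinct)
    have X': "X' \<in> set_comps A" "X' \<preceq> P"
      using set_comps_perm[OF assms(3) m] True \<open>set X' = set X\<close> by (simp_all add: refines_def)
    have "last (inside b X') = Y" using Y(1) by (simp add: X'_def)
    then have "inside b X' \<notin> set_comps_dag b" using minY by (simp add: set_comps_dag_def)
    then have "e_comp P \<^bold>\<and> e_comp X' = (0 :: 'f fpi)"
      unfolding e_comp_wedge_e_comp[OF assms(1,2) X'] using b(1) by auto
    then show ?thesis
      using eps_wedge_perm[OF assms(1,3) m e_comp_in_FPi_on[OF assms(2)], where 'f='f] False by simp
  qed
qed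

lemma char_pair_e_comp:
  fixes v :: "'f::field fpi"
  assumes "finite A" "P \<in> set_comps A" "char_pair A X N N' v0" "v \<in> N'"
  shows "set X = set P \<Longrightarrow> e_comp P \<^bold>\<and> v - v \<in> N" and "set X \<noteq> set P \<Longrightarrow> e_comp P \<^bold>\<and> v \<in> N"
proof -
  have X: "X \<in> set_comps A" using assms(3) by (simp add: char_pair_def)
  have *: "e_comp P \<^bold>\<and> v - scal (if set X = set P then 1 else 0) v \<in> N"
    using char_pair_act[OF assms(1,3,4) e_comp_in_FPi_on[OF assms(2)]]
    by (simp only: eps_e_comp_wedge[OF assms(1,2) X])
  show "set X = set P \<Longrightarrow> e_comp P \<^bold>\<and> v - v \<in> N" "set X \<noteq> set P \<Longrightarrow> e_comp P \<^bold>\<and> v \<in> N"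
    using * by simp_all
qed


section \<open>The irreducible modules \<open>M_P\<close>\<close>

definition Lam :: "nat set \<Rightarrow> scomp \<Rightarrow> 'f::field fpi set" where
  "Lam A Q = (\<lambda>f. f \<^bold>\<and> e_comp Q) ` FPi_on A"

lemma Lambda_eq_Lam: "Lambda A Q = sub_module (Lam A Q)"
  by (simp add: Lambda_def sub_module_def Lam_def)

lemma Lam_subset: "Q \<in> set_comps A \<Longrightarrow> Lam A Q \<subseteq> FPi_on A"
  by (auto simp: Lam_def intro: wedge_in_FPi_on e_comp_in_FPi_on)

lemma left_stable_Lam: "left_stable A (Lam A Q)"
  unfolding left_stable_def
proof (intro conjI ballI fpi.subspaceI)
  show "0 \<in> Lam A Q"
    using fpi.subspace_0[OF subspace_FPi_on] by (force simp: Lam_def intro!: image_eqI[of _ _ 0])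
  show "x + y \<in> Lam A Q" if "x \<in> Lam A Q" "y \<in> Lam A Q" for x y
    using that fpi.subspace_add[OF subspace_FPi_on] by (force simp: Lam_def wedge_add_left[symmetric])
  show "scal c x \<in> Lam A Q" if "x \<in> Lam A Q" for c x
    using that fpi.subspace_scale[OF subspace_FPi_on] by (force simp: Lam_def wedge_scal_left[symmetric])
  show "basis_elt T \<^bold>\<and> v \<in> Lam A Q" if "T \<in> set_comps A" "v \<in> Lam A Q" for T v
    using that wedge_in_FPi_on[of "basis_elt T" A] by (force simp: Lam_def wedge_assoc[symmetric])
qed

lemma e_comp_in_Lam:
  assumes "finite A" "P \<in> set_comps A"
  shows "e_comp P \<in> Lam A P"
  unfolding Lam_def using assms(2)
  by (intro image_eqI[of _ _ "basis_elt P"]) (simp_all add: basis_wedge_e_comp_perm[OF assms refl])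

definition Lam_kernel :: "nat set \<Rightarrow> scomp \<Rightarrow> 'f::field fpi set" where
  "Lam_kernel A P = {v \<in> Lam A P. eps P v = 0}"

text \<open>
  The functional \<open>eps P\<close> is a homomorphism from \<open>\<Lambda>\<^sub>P\<close> onto the line with character \<open>chi P\<close>, so its
  kernel is a submodule with one-dimensional quotient.
\<close>

lemma char_pair_Lam:
  assumes "finite A" "P \<in> set_comps A"
  shows "char_pair A P (Lam_kernel A P) (Lam A P) (e_comp P :: 'f::field fpi)"
proof -
  let ?K = "Lam_kernel A P :: 'f fpi set" and ?L = "Lam A P :: 'f fpi set"
  have subL: "fpi.subspace ?L" using left_stable_Lam by (rule left_stable_subspace)
  have act: "eps P (basis_elt T \<^bold>\<and> v) = chi P T * eps P v" if T: "T \<in> set_comps A" and v: "v \<in> ?L" for T v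
  proof -
    obtain f where f: "f \<in> FPi_on A" "v = f \<^bold>\<and> e_comp P" using v by (auto simp: Lam_def)
    from f(1) have "eps P (basis_elt T \<^bold>\<and> (f \<^bold>\<and> e_comp P)) = chi P T * eps P (f \<^bold>\<and> e_comp P)"
    proof (induction f rule: FPi_on_induct)
      case (basis S)
      from basis_wedge_e_comp_cases[OF assms basis, where 'f='f] show ?case
      proof
        assume "\<exists>R. mset R = mset P \<and> basis_elt S \<^bold>\<and> e_comp P = (e_comp R :: 'f fpi)"
        then obtain R where R: "mset R = mset P" "basis_elt S \<^bold>\<and> e_comp P = (e_comp R :: 'f fpi)" by blast
        show ?thesis
          unfolding R(2) using eps_basis_wedge[OF assms R(1) T, where 'f='f]
            eps_e_comp[OF assms(1) set_comps_perm[OF assms(2) R(1)] R(1), where 'f='f] by simp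
      qed simp
    qed (simp_all add: wedge_add_left wedge_add_right wedge_scal_left wedge_scal_right eps_add eps_scal algebra_simps)
    with f show ?thesis by simp
  qed
  have eP: "e_comp P \<in> ?L" using assms by (rule e_comp_in_Lam)
  have eps1: "eps P (e_comp P :: 'f fpi) = 1" using eps_e_comp[OF assms refl] .
  have eps_diff: "eps P (x - y) = eps P x - eps P y" for x y :: "'f fpi"
    using eps_add[of P "x - y" y] by simp
  have subK: "fpi.subspace ?K"
    using subL by (auto simp: fpi.subspace_def Lam_kernel_def eps_add eps_scal)
  have TL: "basis_elt T \<^bold>\<and> v \<in> ?L" if "T \<in> set_comps A" "v \<in> ?L" for T v
    using left_stable_Lam[of A P, where 'a='f] that by (simp add: left_stable_def)
  have "left_stable A ?K"
    using subK TL act by (auto simp: left_stable_def Lam_kernel_def)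
  moreover have "v - scal (eps P v) (e_comp P) \<in> ?K" if "v \<in> ?L" for v
    using that eP fpi.subspace_diff[OF subL that fpi.subspace_scale[OF subL eP]]
    by (simp add: Lam_kernel_def eps_diff eps_scal eps1)
  moreover have "basis_elt T \<^bold>\<and> v - scal (chi P T) v \<in> ?K" if T: "T \<in> set_comps A" and v: "v \<in> ?L" for T v
    using fpi.subspace_diff[OF subL TL[OF T v] fpi.subspace_scale[OF subL v]] act[OF T v]
    by (simp add: Lam_kernel_def eps_diff eps_scal)
  moreover have "?K \<subseteq> ?L" "e_comp P \<notin> ?K" using eps1 by (auto simp: Lam_kernel_def)
  ultimately show ?thesis
    using assms(2) left_stable_Lam eP by (auto simp: char_pair_def)
qed

lemma Lam_subset_if_e_comp:
  assumes "left_stable A N" "e_comp P \<in> N"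
  shows "Lam A P \<subseteq> N"
  using left_stable_wedge[OF assms(1) _ assms(2)] by (auto simp: Lam_def)

text \<open>
  A maximal submodule \<open>N\<close> does not contain the generator \<open>e\<^sub>P\<close>. As \<open>e\<^sub>P\<close> fixes itself, it acts as a nonzero map
  on the simple quotient, whose character therefore is \<open>chi P\<close>. Hence \<open>f \<and> e\<^sub>P\<close> is congruent to
  \<open>eps P (f \<and> e\<^sub>P)\<close> times \<open>e\<^sub>P\<close> modulo \<open>N\<close>, and \<open>N\<close> contains the kernel of \<open>eps P\<close>.
\<close>

lemma maximal_submodule_Lambda:
  fixes N :: "'f::field fpi set"
  assumes "finite A" "P \<in> set_comps A"
  shows "maximal_submodule (FPi_ring A) (Lambda A P) N \<longleftrightarrow> N = Lam_kernel A P"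
proof -
  let ?K = "Lam_kernel A P :: 'f fpi set" and ?L = "Lam A P :: 'f fpi set"
  note cp = char_pair_Lam[OF assms, where 'f='f]
  have K: "left_stable A ?K" "?K \<subseteq> ?L" "e_comp P \<notin> ?K" using cp by (auto simp: char_pair_def)
  have eL: "e_comp P \<in> ?L" using assms by (rule e_comp_in_Lam)
  have subm: "submodule M (FPi_ring A) (Lambda A P) \<longleftrightarrow> M \<subseteq> ?L \<and> left_stable A M" for M
    unfolding Lambda_eq_Lam using left_stable_Lam Lam_subset[OF assms(2)] by (rule submodule_sub_module_iff)
  have carr: "carrier (Lambda A P) = ?L" by (simp add: Lambda_eq_Lam)
  have Kmax: "M = ?K \<or> M = ?L" if M: "M \<subseteq> ?L" "left_stable A M" "?K \<subseteq> M" for M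
  proof (cases "M \<subseteq> ?K")
    case True
    with M show ?thesis by blast
  next
    case False
    then obtain v where v: "v \<in> M" "v \<notin> ?K" by blast
    note subM = left_stable_subspace[OF M(2)]
    obtain c where c: "v - scal c (e_comp P) \<in> ?K" using cp v M(1) unfolding char_pair_def by blast
    then have "c \<noteq> 0" using v(2) by auto
    have "scal c (e_comp P) \<in> M"
      using fpi.subspace_diff[OF subM v(1), of "v - scal c (e_comp P)"] c M(3) by auto
    then have "scal (inverse c) (scal c (e_comp P)) \<in> M" by (rule fpi.subspace_scale[OF subM])
    then have "e_comp P \<in> M" using \<open>c \<noteq> 0\<close> by simp
    then show ?thesis using Lam_subset_if_e_comp[OF M(2)] M(1) by blast
  qed
  show ?thesis
  proof
    assume "maximal_submodule (FPi_ring A) (Lambda A P) N"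
    then have N: "N \<subseteq> ?L" "left_stable A N" "N \<noteq> ?L"
      and max: "\<And>M. M \<subseteq> ?L \<Longrightarrow> left_stable A M \<Longrightarrow> N \<subseteq> M \<Longrightarrow> M = N \<or> M = ?L"
      unfolding maximal_submodule_def subm carr by auto
    have "simple_pair A N ?L"
      using N max left_stable_Lam Lam_subset[OF assms(2)] unfolding simple_pair_def by blast
    then obtain X v0 where X: "char_pair A X N ?L v0" using simple_pair_char[OF assms(1)] by blast
    have eN: "e_comp P \<notin> N" using Lam_subset_if_e_comp[OF N(2)] N(1,3) by blast
    have "set X = set P"
      using char_pair_e_comp(2)[OF assms X eL] eN e_comp_wedge_perm[OF assms refl, where 'f='f] by auto
    then have X': "char_pair A P N ?L v0" using char_pair_cong[OF X assms(2)] by blast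
    have "?K \<subseteq> N"
    proof
      fix v assume v: "v \<in> ?K"
      then obtain f where f: "f \<in> FPi_on A" "v = f \<^bold>\<and> e_comp P" by (auto simp: Lam_kernel_def Lam_def)
      have "eps P (f \<^bold>\<and> e_comp P) = 0" using v f by (simp add: Lam_kernel_def)
      then show "v \<in> N" using char_pair_act[OF assms(1) X' eL f(1)] f(2) by simp
    qed
    then show "N = ?K" using Kmax[OF N(1,2)] N(3) by blast
  next
    assume "N = ?K"
    then show "maximal_submodule (FPi_ring A) (Lambda A P) N"
      unfolding maximal_submodule_def subm carr using K eL Kmax by blast
  qed
qed

lemma irr_M_eq:
  assumes "finite A" "P \<in> set_comps A"
  shows "(irr_M A P :: ('f::field fpi, 'f fpi set) module) = quot_module (sub_module (Lam A P)) (Lam_kernel A P)"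
proof -
  have "{N :: 'f fpi set. maximal_submodule (FPi_ring A) (Lambda A P) N} = {Lam_kernel A P}"
    using maximal_submodule_Lambda[OF assms, where 'f='f] by blast
  then have "module_rad (FPi_ring A) (Lambda A P :: ('f fpi, 'f fpi) module) = Lam_kernel A P"
    by (auto simp: module_rad_def Lambda_eq_Lam Lam_kernel_def)
  then show ?thesis by (simp add: irr_M_def Lambda_eq_Lam)
qed


section \<open>Composition series\<close>

lemma char_pair_iso_irr_M:
  fixes N N' :: "'f::field fpi set"
  assumes "finite A" "P \<in> set_comps A" "char_pair A X N N' v0"
  shows "module_iso (FPi_ring A) (quot_module (sub_module N') N) (irr_M A P :: ('f fpi, 'f fpi set) module)
    \<longleftrightarrow> set X = set P"
  unfolding irr_M_eq[OF assms(1,2)]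
  using char_pair_iso_imp[OF assms(3) char_pair_Lam[OF assms(1,2)]]
    char_pair_iso[OF char_pair_cong[OF assms(3,2)] char_pair_Lam[OF assms(1,2)]]
  by blast

lemma composition_series_iff:
  fixes Ns :: "'f::field fpi set list"
  assumes "left_stable A V" "V \<subseteq> FPi_on A"
  shows "composition_series (FPi_ring A) (sub_module V) Ns \<longleftrightarrow>
    Ns \<noteq> [] \<and> hd Ns = {0} \<and> last Ns = V \<and> (\<forall>N\<in>set Ns. N \<subseteq> V \<and> left_stable A N) \<and>
    (\<forall>i. Suc i < length Ns \<longrightarrow> simple_pair A (Ns ! i) (Ns ! Suc i))"
proof -
  have "(Ns ! i \<subseteq> Ns ! Suc i \<and> irreducible_module (FPi_ring A) (factor_module (sub_module V) Ns i))
      \<longleftrightarrow> simple_pair A (Ns ! i) (Ns ! Suc i)"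
    if "\<forall>N\<in>set Ns. N \<subseteq> V \<and> left_stable A N" "Suc i < length Ns" for i
  proof -
    have mem: "Ns ! i \<in> set Ns" "Ns ! Suc i \<in> set Ns" using that(2) by simp_all
    then have "left_stable A (Ns ! i)" "left_stable A (Ns ! Suc i)" "Ns ! Suc i \<subseteq> FPi_on A"
      using that(1) assms(2) by blast+
    then show ?thesis
      using irreducible_quot_iff[of A "Ns ! i" "Ns ! Suc i"]
      by (auto simp: factor_module_def restr_sub_module simple_pair_def)
  qed
  then show ?thesis
    unfolding composition_series_def submodule_sub_module_iff[OF assms] by (simp cong: conj_cong)
qed

lemma dim_strict_mono:
  fixes N N' G :: "'f::field fpi set"
  assumes "fpi.subspace N" "N \<subset> N'" "finite G" "N' \<subseteq> fpi.span G"
  shows "fpi.dim N < fpi.dim N'"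
proof -
  obtain B where B: "B \<subseteq> N" "fpi.independent B" "N \<subseteq> fpi.span B" "card B = fpi.dim N"
    using fpi.basis_exists by blast
  obtain B' where B': "B' \<subseteq> N'" "fpi.independent B'" "N' \<subseteq> fpi.span B'" "card B' = fpi.dim N'"
    using fpi.basis_exists by blast
  obtain w where w: "w \<in> N'" "w \<notin> N" using assms(2) by blast
  have "fpi.span B \<subseteq> N" using B(1) assms(1) by (rule fpi.span_minimal)
  then have wB: "w \<notin> fpi.span B" using w by blast
  then have ind: "fpi.independent (insert w B)" using B(2) by (rule fpi.independent_insertI)
  have "finite B'"
    using fpi.independent_span_bound[OF assms(3) B'(2)] B'(1) assms(4) by blast
  then have le: "finite (insert w B) \<and> card (insert w B) \<le> card B'"
    using B(1) B'(3) w assms(2) by (intro fpi.independent_span_bound[OF _ ind]) auto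
  have "w \<notin> B" using wB fpi.span_base by blast
  moreover have "finite B" using le by simp
  ultimately have "card (insert w B) = Suc (card B)" by simp
  with le show ?thesis using B(4) B'(4) by linarith
qed

text \<open>
  Induction on the dimension: a proper submodule of largest dimension is maximal.
\<close>

lemma exists_series:
  fixes N G :: "'f::field fpi set"
  assumes "finite G" "left_stable A N" "N \<subseteq> fpi.span G" "N \<subseteq> FPi_on A"
  shows "\<exists>Ns. Ns \<noteq> [] \<and> hd Ns = {0} \<and> last Ns = N \<and> (\<forall>M\<in>set Ns. M \<subseteq> N \<and> left_stable A M) \<and>
    (\<forall>i. Suc i < length Ns \<longrightarrow> simple_pair A (Ns ! i) (Ns ! Suc i))"
  using assms(2-)
proof (induction "fpi.dim N" arbitrary: N rule: less_induct)
  case less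
  note sub = left_stable_subspace[OF less.prems(1)]
  show ?case
  proof (cases "N = {0}")
    case True
    with less.prems show ?thesis by (intro exI[of _ "[{0}]"]) simp
  next
    case False
    let ?P = "\<lambda>K. left_stable A K \<and> K \<subset> N"
    have "left_stable A {0 :: 'f fpi}" by (simp add: left_stable_def fpi.subspace_single_0)
    then have "?P {0}" using False fpi.subspace_0[OF sub] by blast
    moreover have lt: "fpi.dim K < fpi.dim N" if "?P K" for K
      using that dim_strict_mono[OF left_stable_subspace _ assms(1) less.prems(2)] by blast
    ultimately obtain M where M: "?P M" "\<And>K. ?P K \<Longrightarrow> fpi.dim K \<le> fpi.dim M"
      using ex_has_greatest_nat[of ?P "{0}" fpi.dim "fpi.dim N"] by (metis less_imp_le)
    have "K = M \<or> K = N" if K: "left_stable A K" "M \<subseteq> K" "K \<subseteq> N" for K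
    proof (rule ccontr)
      assume "\<not> ?thesis"
      then have MK: "M \<subset> K" "?P K" using K by blast+
      then have "fpi.dim M < fpi.dim K"
        using M(1) K(3) less.prems(2)
        by (intro dim_strict_mono[OF left_stable_subspace[of A M] _ assms(1)]) auto
      with M(2)[OF MK(2)] show False by simp
    qed
    then have sp: "simple_pair A M N" using M(1) less.prems by (auto simp: simple_pair_def)
    obtain Ns where Ns: "Ns \<noteq> []" "hd Ns = {0}" "last Ns = M" "\<forall>K\<in>set Ns. K \<subseteq> M \<and> left_stable A K"
      "\<forall>i. Suc i < length Ns \<longrightarrow> simple_pair A (Ns ! i) (Ns ! Suc i)"
      using less.hyps[OF lt[OF M(1)]] M(1) less.prems by blast
    have "simple_pair A ((Ns @ [N]) ! i) ((Ns @ [N]) ! Suc i)" if "Suc i < length (Ns @ [N])" for i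
    proof (cases "Suc i < length Ns")
      case True
      with Ns(5) show ?thesis by (simp add: nth_append)
    next
      case False
      with that have i: "i = length Ns - 1" "Suc i = length Ns" by auto
      then have "Ns ! i = M" using Ns(1,3) by (simp add: last_conv_nth)
      with i sp show ?thesis by (simp add: nth_append)
    qed
    moreover have "\<forall>K\<in>set (Ns @ [N]). K \<subseteq> N \<and> left_stable A K"
      using Ns(4) M(1) less.prems(1) by (auto dest: subsetD)
    ultimately show ?thesis using Ns(1,2) by (intro exI[of _ "Ns @ [N]"]) simp
  qed
qed

lemma Lam_subset_span:
  fixes Q :: scomp
  shows "(Lam A Q :: 'f::field fpi set) \<subseteq> fpi.span ((\<lambda>T. basis_elt T \<^bold>\<and> e_comp Q) ` set_comps A)"
proof
  fix v :: "'f fpi" assume "v \<in> Lam A Q"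
  then obtain f where f: "f \<in> FPi_on A" "v = f \<^bold>\<and> e_comp Q" by (auto simp: Lam_def)
  from f(1) have "f \<^bold>\<and> e_comp Q \<in> fpi.span ((\<lambda>T. basis_elt T \<^bold>\<and> e_comp Q) ` set_comps A)"
    by (induction f rule: FPi_on_induct)
      (auto simp: wedge_add_left wedge_scal_left intro: fpi.span_base fpi.span_zero fpi.span_add fpi.span_scale)
  with f show "v \<in> fpi.span ((\<lambda>T. basis_elt T \<^bold>\<and> e_comp Q) ` set_comps A)" by simp
qed

text \<open>
  If \<open>e\<^sub>P\<close> acts on \<open>N' / N\<close> as zero, it maps \<open>N'\<close> into \<open>N\<close>, and by idempotency onto \<open>e\<^sub>P \<and> N\<close>. If it acts
  as the identity, then \<open>e\<^sub>P \<and> v0\<close> is outside \<open>N\<close> and extends a basis of \<open>e\<^sub>P \<and> N\<close> to one of \<open>e\<^sub>P \<and> N'\<close>.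
\<close>

lemma basis_step:
  fixes N N' B :: "'f::field fpi set"
  assumes "finite A" "P \<in> set_comps A" "char_pair A X N N' v0"
    and B: "finite B" "fpi.independent B" "fpi.span B = (\<lambda>v. e_comp P \<^bold>\<and> v) ` N"
  shows "\<exists>B'. finite B' \<and> fpi.independent B' \<and> fpi.span B' = (\<lambda>v. e_comp P \<^bold>\<and> v) ` N' \<and>
    card B' = card B + (if set X = set P then 1 else 0)"
proof -
  let ?e = "e_comp P :: 'f fpi"
  have st: "left_stable A N" "left_stable A N'" "N \<subseteq> N'" and v0: "v0 \<in> N'" "v0 \<notin> N"
    and coord: "\<And>v. v \<in> N' \<Longrightarrow> \<exists>c. v - scal c v0 \<in> N"
    using assms(3) by (auto simp: char_pair_def)
  note sub = left_stable_subspace[OF st(1)] and sub' = left_stable_subspace[OF st(2)]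
  have eA: "?e \<in> FPi_on A" using e_comp_in_FPi_on[OF assms(2)] .
  have idem: "?e \<^bold>\<and> (?e \<^bold>\<and> v) = ?e \<^bold>\<and> v" for v
    using e_comp_wedge_perm[OF assms(1,2) refl, where 'f='f] by (simp add: wedge_assoc[symmetric])
  show ?thesis
  proof (cases "set X = set P")
    case False
    have "(\<lambda>v. ?e \<^bold>\<and> v) ` N' \<subseteq> (\<lambda>v. ?e \<^bold>\<and> v) ` N"
    proof
      fix x assume "x \<in> (\<lambda>v. ?e \<^bold>\<and> v) ` N'"
      then obtain v where v: "v \<in> N'" "x = ?e \<^bold>\<and> v" by blast
      then have "?e \<^bold>\<and> v \<in> N" using char_pair_e_comp(2)[OF assms(1-3)] False by blast
      then show "x \<in> (\<lambda>v. ?e \<^bold>\<and> v) ` N" using v(2) idem[of v] by (metis imageI)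
    qed
    then have "(\<lambda>v. ?e \<^bold>\<and> v) ` N' = (\<lambda>v. ?e \<^bold>\<and> v) ` N" using st(3) by blast
    with B False show ?thesis by auto
  next
    case True
    define w where "w = ?e \<^bold>\<and> v0"
    have "w - v0 \<in> N" unfolding w_def using char_pair_e_comp(1)[OF assms(1-3) v0(1) True] .
    then have wN: "w \<notin> N" using v0(2) fpi.subspace_diff[OF sub, of w "w - v0"] by auto
    have "fpi.span B \<subseteq> N" using B(3) left_stable_wedge[OF st(1) eA] by auto
    then have wB: "w \<notin> fpi.span B" using wN by blast
    have subE: "fpi.subspace ((\<lambda>v. ?e \<^bold>\<and> v) ` N')"
    proof (rule fpi.subspaceI)
      show "0 \<in> (\<lambda>v. ?e \<^bold>\<and> v) ` N'" using fpi.subspace_0[OF sub'] by (force intro!: image_eqI[of _ _ 0])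
      show "x + y \<in> (\<lambda>v. ?e \<^bold>\<and> v) ` N'" if "x \<in> (\<lambda>v. ?e \<^bold>\<and> v) ` N'" "y \<in> (\<lambda>v. ?e \<^bold>\<and> v) ` N'" for x y
        using that fpi.subspace_add[OF sub'] by (force simp: wedge_add_right[symmetric])
      show "scal c x \<in> (\<lambda>v. ?e \<^bold>\<and> v) ` N'" if "x \<in> (\<lambda>v. ?e \<^bold>\<and> v) ` N'" for c x
        using that fpi.subspace_scale[OF sub'] by (force simp: wedge_scal_right[symmetric])
    qed
    have "fpi.span (insert w B) = (\<lambda>v. ?e \<^bold>\<and> v) ` N'"
    proof
      have "B \<subseteq> (\<lambda>v. ?e \<^bold>\<and> v) ` N'" using fpi.span_superset[of B] B(3) st(3) by blast
      then have "insert w B \<subseteq> (\<lambda>v. ?e \<^bold>\<and> v) ` N'" using v0(1) by (auto simp: w_def)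
      then show "fpi.span (insert w B) \<subseteq> (\<lambda>v. ?e \<^bold>\<and> v) ` N'" using subE by (rule fpi.span_minimal)
      show "(\<lambda>v. ?e \<^bold>\<and> v) ` N' \<subseteq> fpi.span (insert w B)"
      proof
        fix x assume "x \<in> (\<lambda>v. ?e \<^bold>\<and> v) ` N'"
        then obtain v where v: "v \<in> N'" "x = ?e \<^bold>\<and> v" by blast
        obtain c where "v - scal c v0 \<in> N" using coord[OF v(1)] by blast
        then have "?e \<^bold>\<and> (v - scal c v0) \<in> fpi.span B" using B(3) by blast
        then have "?e \<^bold>\<and> (v - scal c v0) \<in> fpi.span (insert w B)"
          using fpi.span_mono[of B "insert w B"] by blast
        moreover have "scal c w \<in> fpi.span (insert w B)"
          by (intro fpi.span_scale fpi.span_base) simp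
        ultimately have "?e \<^bold>\<and> (v - scal c v0) + scal c w \<in> fpi.span (insert w B)"
          by (rule fpi.span_add)
        then show "x \<in> fpi.span (insert w B)"
          by (simp add: v(2) w_def wedge_diff_right wedge_scal_right)
      qed
    qed
    moreover have "fpi.independent (insert w B)" using wB B(2) by (rule fpi.independent_insertI)
    moreover have "card (insert w B) = card B + 1"
    proof -
      have "w \<notin> B" using wB fpi.span_base by blast
      with B(1) show ?thesis by simp
    qed
    ultimately show ?thesis using B(1) True by auto
  qed
qed

lemma series_basis:
  fixes Ns :: "'f::field fpi set list"
  assumes "finite A" "P \<in> set_comps A" "hd Ns = {0}"
    and "\<And>i. Suc i < length Ns \<Longrightarrow> simple_pair A (Ns ! i) (Ns ! Suc i)"
    and "n < length Ns"
  shows "\<exists>B. finite B \<and> fpi.independent B \<and> fpi.span B = (\<lambda>v. e_comp P \<^bold>\<and> v) ` (Ns ! n) \<and>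
    card B = card {i. i < n \<and> module_iso (FPi_ring A) (quot_module (sub_module (Ns ! Suc i)) (Ns ! i))
      (irr_M A P :: ('f fpi, 'f fpi set) module)}"
  using assms(5)
proof (induction n)
  case 0
  then have "Ns ! 0 = {0}" using assms(3) by (simp add: hd_conv_nth)
  then show ?case using fpi.independent_empty by (intro exI[of _ "{}"]) simp
next
  case (Suc n)
  let ?c = "\<lambda>i. module_iso (FPi_ring A) (quot_module (sub_module (Ns ! Suc i)) (Ns ! i))
      (irr_M A P :: ('f fpi, 'f fpi set) module)"
  obtain B where B: "finite B" "fpi.independent B" "fpi.span B = (\<lambda>v. e_comp P \<^bold>\<and> v) ` (Ns ! n)"
    "card B = card {i. i < n \<and> ?c i}" using Suc by auto
  obtain X v0 where X: "char_pair A X (Ns ! n) (Ns ! Suc n) v0"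
    using simple_pair_char[OF assms(1) assms(4)[OF Suc.prems]] by blast
  have c: "?c n \<longleftrightarrow> set X = set P" using char_pair_iso_irr_M[OF assms(1,2) X] .
  have "{i. i < Suc n \<and> ?c i} = (if ?c n then insert n {i. i < n \<and> ?c i} else {i. i < n \<and> ?c i})"
    by (auto simp: less_Suc_eq)
  then have "card {i. i < Suc n \<and> ?c i} = card B + (if set X = set P then 1 else 0)"
    using B(4) c by simp
  with basis_step[OF assms(1,2) X B(1-3)] show ?case by metis
qed

lemma cartan_invariant:
  assumes "finite A" "P \<in> set_comps A" "Q \<in> set_comps A" "Q \<preceq> P"
  shows "is_cartan_invariant TYPE('f::field) A P Q (card (dag_tuples P Q))"
proof -
  let ?L = "Lam A Q :: 'f fpi set"
  note LA = Lam_subset[OF assms(3), where 'a='f]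
  note series = composition_series_iff[OF left_stable_Lam LA, folded Lambda_eq_Lam]
  have "\<exists>Ns. composition_series (FPi_ring A) (Lambda A Q :: ('f fpi, 'f fpi) module) Ns"
    using exists_series[OF _ left_stable_Lam Lam_subset_span LA] finite_set_comps[OF assms(1)]
    unfolding series by blast
  moreover have "series_multiplicity (FPi_ring A) (Lambda A Q) Ns (irr_M A P) = card (dag_tuples P Q)"
    if "composition_series (FPi_ring A) (Lambda A Q :: ('f fpi, 'f fpi) module) Ns" for Ns
  proof -
    from that have Ns: "Ns \<noteq> []" "hd Ns = {0}" "last Ns = ?L"
      "\<And>i. Suc i < length Ns \<Longrightarrow> simple_pair A (Ns ! i) (Ns ! Suc i)"
      unfolding series by auto
    let ?n = "length Ns - 1"
    have n: "?n < length Ns" "Ns ! ?n = ?L" using Ns(1,3) by (auto simp: last_conv_nth)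
    obtain B where B: "fpi.independent B" "fpi.span B = (\<lambda>v. e_comp P \<^bold>\<and> v) ` ?L"
      "card B = card {i. i < ?n \<and> module_iso (FPi_ring A) (quot_module (sub_module (Ns ! Suc i)) (Ns ! i))
        (irr_M A P :: ('f fpi, 'f fpi set) module)}"
      using series_basis[OF assms(1,2) Ns(2) Ns(4) n(1)] n(2) by auto
    have "fpi.span B = fpi.span (dag_elt ` dag_tuples P Q :: 'f fpi set)"
      unfolding B(2) span_dag_elt[OF assms] by (auto simp: Lam_def wedge_assoc)
    then have "card B = card (dag_elt ` dag_tuples P Q :: 'f fpi set)"
      using fpi.dim_eq_card[OF _ B(1), of "dag_elt ` dag_tuples P Q"]
        fpi.dim_eq_card_independent[OF independent_dag_elt[OF assms, where 'f='f]] by simp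
    also have "\<dots> = card (dag_tuples P Q)" using inj_on_dag_elt[OF assms] by (rule card_image)
    finally have "card B = card (dag_tuples P Q)" .
    moreover have "series_multiplicity (FPi_ring A) (Lambda A Q) Ns (irr_M A P) = card B"
      unfolding series_multiplicity_def B(3) Lambda_eq_Lam factor_module_def restr_sub_module
      by (intro arg_cong[of _ _ card] Collect_cong) auto
    ultimately show ?thesis by simp
  qed
  ultimately show ?thesis by (simp add: is_cartan_invariant_def)
qed

theorem theorem6p4:
  fixes A :: "nat set" and P Q :: scomp
  assumes "finite A" and "A \<subseteq> {1..}"
    and "P \<in> set_comps_less A" and "Q \<in> set_comps_less A"
    and "Q \<preceq> P"
  shows "inj_on (dag_elt :: scomp list \<Rightarrow> 'f::field fpi) (dag_tuples P Q)
      \<and> fpi.independent ((dag_elt :: scomp list \<Rightarrow> 'f fpi) ` dag_tuples P Q)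
      \<and> fpi.span ((dag_elt :: scomp list \<Rightarrow> 'f fpi) ` dag_tuples P Q)
          = {e_comp P \<^bold>\<and> f \<^bold>\<and> e_comp Q |f. f \<in> FPi_on A}
      \<and> is_cartan_invariant TYPE('f) A P Q
          (\<Prod>j<length P. fact (card {i. i < length Q \<and> Q ! i \<subseteq> P ! j} - 1))"
proof -
  have PQ: "P \<in> set_comps A" "Q \<in> set_comps A" using assms by (auto simp: set_comps_less_def)
  note hyps = assms(1) PQ assms(5)
  show ?thesis
    using inj_on_dag_elt[OF hyps] independent_dag_elt[OF hyps] span_dag_elt[OF hyps]
      cartan_invariant[OF hyps] card_dag_tuples[OF hyps] by simp
qed

end
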